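(* Suppose $u\in C^4(\mathbb{R}^3)$ is a $2$-convex entire solution of $\sigma_2(D^2u(x))=1$ on $\mathbb{R}^3$, and suppose $u$ satisfies the quadratic growth condition: there exist constants $b>0$, $c>0$ and $R>0$ such that $u(x)\ge b|x|^2-c$ for all $|x|\ge R$. Then $u$ is a quadratic polynomial.
   Context: For $\lambda\in\mathbb{R}^n$, $\sigma_k(\lambda)$ denotes the $k$-th elementary symmetric function of $\lambda$, and for a symmetric matrix $W$, $\sigma_k(W)=\sigma_k(\lambda[W])$ where $\lambda[W]$ are the eigenvalues of $W$. The Gårding cone is $\Gamma_k=\{\lambda\in\mathbb{R}^n:\sigma_j(\lambda)>0 \text{ for all } 1\le j\le k\}$. A function $u\in C^2$ is called $k$-convex if $\lambda[D^2u(x)]\in\Gamma_k$ at every point $x$. *)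

theory Defs
  imports "HOL-Analysis.Analysis" "HOL-Library.Numeral_Type"
begin

definition partial_deriv :: "'n \<Rightarrow> (real^'n \<Rightarrow> real) \<Rightarrow> real^'n \<Rightarrow> real" where
  "partial_deriv i f x = frechet_derivative f (at x) (axis i 1)"

fun C_k :: "nat \<Rightarrow> (real^'n \<Rightarrow> real) \<Rightarrow> bool" where
  "C_k 0 f = continuous_on UNIV f"
| "C_k (Suc k) f = ((\<forall>x. f differentiable (at x)) \<and> (\<forall>i. C_k k (partial_deriv i f)))"

definition hessian :: "(real^'n \<Rightarrow> real) \<Rightarrow> real^'n \<Rightarrow> real^'n^'n" where
  "hessian u x = (\<chi> i j. partial_deriv j (partial_deriv i u) x)"

definition sigma :: "nat \<Rightarrow> real^'n \<Rightarrow> real" where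
  "sigma k lam = (\<Sum>S\<in>{S. card S = k}. \<Prod>i\<in>S. lam $ i)"

definition garding_cone :: "nat \<Rightarrow> (real^'n) set" where
  "garding_cone k = {lam. \<forall>j. 1 \<le> j \<and> j \<le> k \<longrightarrow> sigma j lam > 0}"

definition diag_mat :: "real^'n \<Rightarrow> real^'n^'n" where
  "diag_mat lam = (\<chi> i j. if i = j then lam $ i else 0)"

definition is_eigenvalues :: "real^'n^'n \<Rightarrow> real^'n \<Rightarrow> bool" where
  "is_eigenvalues W lam \<longleftrightarrow>
     (\<exists>P. orthogonal_matrix P \<and> W = P ** diag_mat lam ** transpose P)"

text \<open>sigma_k(W) = sigma_k(lambda[W]) for symmetric W.\<close>
definition sigma_mat :: "nat \<Rightarrow> real^'n^'n \<Rightarrow> real" where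
  "sigma_mat k W = sigma k (SOME lam. is_eigenvalues W lam)"

definition k_convex :: "nat \<Rightarrow> (real^'n \<Rightarrow> real) \<Rightarrow> bool" where
  "k_convex k u \<longleftrightarrow> (\<forall>x. \<exists>lam. is_eigenvalues (hessian u x) lam \<and> lam \<in> garding_cone k)"

end

theory Submission
  imports Defs
begin

text \<open>
  Write \<open>f = \<Delta>u\<close>, \<open>F = f I - D\<^sup>2u\<close> and \<open>L = \<Sum> F\<^sub>i\<^sub>j \<partial>\<^sub>i\<partial>\<^sub>j\<close>; since \<open>F\<close> is divergence free,
  \<open>L\<close> is symmetric. In dimension three \<open>ln f\<close> satisfies the Jacobi inequality
  \<open>L (ln f) \<ge> F(\<nabla> ln f, \<nabla> ln f) / 3\<close>. At a maximum of \<open>(T - u)\<^sup>6 f exp (\<delta>|x|\<^sup>2/2)\<close> on the bounded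
  sublevel set \<open>{u < T}\<close> it yields, without any gradient bound, a Pogorelov estimate which is scale
  invariant, so \<open>T \<rightarrow> \<infinity>\<close> bounds \<open>D\<^sup>2u\<close> on the whole space.

  The gradient graph of \<open>u\<close> is a minimal submanifold with Laplace-Beltrami operator \<open>L / V\<close>. For
  \<open>s = |x - a|\<^sup>2 + |Du(x) - Du(a)|\<^sup>2\<close> one has \<open>L s = 6 V\<close> and \<open>F(\<nabla>s, \<nabla>s) \<le> 4 s V\<close>, so suitable
  functions of \<open>s\<close> replace the Green function: they give a mean value inequality for nonnegative
  subsolutions, and, tested with \<open>L f \<ge> c |D\<^sup>3u|\<^sup>2\<close>, the finiteness of \<open>\<integral> |D\<^sup>3u|\<^sup>2 / (1 + |x|)\<close>.
  The function \<open>\<psi>(x, y) = - \<sigma>\<^sub>2 (D\<^sup>2u(x) - D\<^sup>2u(y))\<close> is nonnegative, vanishes only if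
  \<open>D\<^sup>2u(x) = D\<^sup>2u(y)\<close>, and is a subsolution in each variable. Applying the mean value inequality in both
  variables and the Poincare inequality bounds \<open>\<psi>\<close> by \<open>C R\<^sup>-\<^sup>1 \<integral>\<^bsub>|x| < 5R\<^esub> |D\<^sup>3u|\<^sup>2\<close>, which tends to 0.
\<close>

section \<open>Algebra of symmetric matrices and the Jacobi inequality\<close>

text \<open>The graph is minimal because det (I + iH) = (1 - sigma_2) + i (sigma_1 - sigma_3) for a
  symmetric 3x3 matrix H: sigma_2 = 1 makes it special Lagrangian, with volume density V = sigma_1 -
  sigma_3, and F / V is the inverse of the induced metric I + H^2. The obstacle is degeneracy: the
  ellipticity constants of F are 1/f and 2f, so nothing is uniform before f is bounded. Quadratic
  growth gives sublevel sets of diameter of order sqrt T, which makes the Pogorelov bound scale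
  invariant. On symmetric matrices sigma_2 is a Lorentzian form of signature (1, 5), and sigma_2 = 1
  with positive trace is one sheet of a hyperboloid. Two points of it differ by a spacelike vector
  or coincide, hence the sign of psi. The exponents belong to dimension three: s^(-1/2) is the
  Newtonian potential; two mean values cost R^-6, the ball of differences x - y contributes R^3 and
  the Poincare inequality R^2. The resulting R^-1 matches the weight of the energy integral, and it
  is the finiteness of that integral over the whole space that turns a bounded quantity into a
  vanishing one.\<close>

lemma Cauchy_Schwarz_double_sum:
  fixes a b :: "'n::finite \<Rightarrow> 'm::finite \<Rightarrow> real"
  shows "(\<Sum>i\<in>UNIV. \<Sum>j\<in>UNIV. a i j * b i j)\<^sup>2
    \<le> (\<Sum>i\<in>UNIV. \<Sum>j\<in>UNIV. (a i j)\<^sup>2) * (\<Sum>i\<in>UNIV. \<Sum>j\<in>UNIV. (b i j)\<^sup>2)"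
  using Cauchy_Schwarz_ineq_sum[of "\<lambda>(i, j). a i j" "\<lambda>(i, j). b i j" "UNIV \<times> UNIV"]
  by (simp add: sum.cartesian_product case_prod_unfold)

lemma psd_entry_le:
  fixes M :: "'n::finite \<Rightarrow> 'n \<Rightarrow> real"
  assumes psd: "\<And>v. 0 \<le> (\<Sum>i\<in>UNIV. \<Sum>j\<in>UNIV. M i j * v i * v j)"
    and sym: "\<And>i j. M i j = M j i"
  shows "(M k l)\<^sup>2 \<le> M k k * M l l" and "0 \<le> M k k"
proof -
  have form: "0 \<le> M k k * x\<^sup>2 + 2 * M k l * x * y + M l l * y\<^sup>2" for x y
  proof -
    \<comment> \<open>The test vector is x e_k + y e_l; for \<open>k = l\<close> the two
      coefficients simply add, so no case distinction arises.\<close>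
    define w where "w i = x * of_bool (i = k) + y * of_bool (i = l)" for i
    have lin: "(\<Sum>j\<in>UNIV. g j * w j) = x * g k + y * g l" for g
    proof -
      have "g j * w j = (if j = k then x * g j else 0) + (if j = l then y * g j else 0)" for j
        by (auto simp: w_def algebra_simps)
      then show ?thesis by (simp add: sum.distrib)
    qed
    have "(\<Sum>i\<in>UNIV. \<Sum>j\<in>UNIV. M i j * w i * w j) = (\<Sum>i\<in>UNIV. (\<Sum>j\<in>UNIV. M i j * w j) * w i)"
      by (simp add: sum_distrib_left sum_distrib_right mult_ac)
    also have "\<dots> = x * (x * M k k + y * M k l) + y * (x * M l k + y * M l l)"
      unfolding lin ..
    also have "\<dots> = M k k * x\<^sup>2 + 2 * M k l * x * y + M l l * y\<^sup>2"
      unfolding sym[of l k] by (simp add: algebra_simps power2_eq_square)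
    finally show ?thesis using psd[of w] by simp
  qed
  show nn: "0 \<le> M k k" using form[of 1 0] by simp
  have nl: "0 \<le> M l l" using form[of 0 1] by simp
  show "(M k l)\<^sup>2 \<le> M k k * M l l"
  proof (cases "M k k = 0")
    case True
    have "M k l = 0"
    proof (rule ccontr)
      assume ne: "M k l \<noteq> 0"
      \<comment> \<open>With \<open>M k k = 0\<close> the form is affine in \<open>x\<close>, and
        this choice of \<open>x\<close> makes it -1.\<close>
      have "0 \<le> 2 * M k l * (- (M l l + 1) / (2 * M k l)) + M l l"
        using form[of "- (M l l + 1) / (2 * M k l)" 1] True by simp
      also have "\<dots> = -1" using ne by (simp add: field_simps)
      finally show False by simp
    qed
    then show ?thesis using True by simp
  next
    case False
    then have pos: "M k k > 0" using nn by simp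
    have "0 \<le> M k k * (M k k * M l l - (M k l)\<^sup>2)"
      using form[of "- M k l" "M k k"] by (simp add: algebra_simps power2_eq_square)
    then show ?thesis using pos by (simp add: zero_le_mult_iff)
  qed
qed

text \<open>A positive semidefinite \<open>M\<close> has Frobenius norm at most its trace, since
  each squared entry is at most the product of two diagonal entries; Cauchy-Schwarz does the rest.
  \<open>H\<close> and \<open>M\<close> are unrelated, so f I - H may be taken at one point of space
  and \<open>M\<close> at another, as the two-variable function \<open>psi\<close> requires.\<close>

lemma psd_pairing_nonneg:
  fixes H M :: "'n::finite \<Rightarrow> 'n \<Rightarrow> real"
  assumes psd: "\<And>v. 0 \<le> (\<Sum>i\<in>UNIV. \<Sum>j\<in>UNIV. M i j * v i * v j)"
    and sym: "\<And>i j. M i j = M j i"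
    and H: "(\<Sum>i\<in>UNIV. \<Sum>j\<in>UNIV. (H i j)\<^sup>2) \<le> f\<^sup>2" and f: "0 \<le> f"
  shows "(\<Sum>i\<in>UNIV. \<Sum>j\<in>UNIV. H i j * M i j) \<le> f * (\<Sum>i\<in>UNIV. M i i)"
proof -
  have M: "(\<Sum>i\<in>UNIV. \<Sum>j\<in>UNIV. (M i j)\<^sup>2) \<le> (\<Sum>i\<in>UNIV. M i i)\<^sup>2"
  proof -
    have "(\<Sum>i\<in>UNIV. \<Sum>j\<in>UNIV. (M i j)\<^sup>2) \<le> (\<Sum>i\<in>UNIV. \<Sum>j\<in>UNIV. M i i * M j j)"
      by (intro sum_mono psd_entry_le[OF psd sym])
    then show ?thesis by (simp add: power2_eq_square sum_product)
  qed
  have tr: "0 \<le> (\<Sum>i\<in>UNIV. M i i)" by (intro sum_nonneg psd_entry_le[OF psd sym])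
  have "(\<Sum>i\<in>UNIV. \<Sum>j\<in>UNIV. H i j * M i j)\<^sup>2
      \<le> (\<Sum>i\<in>UNIV. \<Sum>j\<in>UNIV. (H i j)\<^sup>2) * (\<Sum>i\<in>UNIV. \<Sum>j\<in>UNIV. (M i j)\<^sup>2)"
    by (rule Cauchy_Schwarz_double_sum)
  also have "\<dots> \<le> f\<^sup>2 * (\<Sum>i\<in>UNIV. M i i)\<^sup>2"
    by (intro mult_mono H M) (auto intro!: sum_nonneg)
  finally have "(\<Sum>i\<in>UNIV. \<Sum>j\<in>UNIV. H i j * M i j)\<^sup>2 \<le> (f * (\<Sum>i\<in>UNIV. M i i))\<^sup>2"
    by (simp add: power_mult_distrib)
  then show ?thesis using f tr by (simp add: power2_le_iff_abs_le)
qed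

text \<open>One column of the Jacobi inequality in an eigenframe: \<open>a\<close>,
  \<open>b\<close>, \<open>c\<close> are the eigenvalues of F, half their sum is the Laplacian,
  \<open>x\<close>, \<open>y\<close>, \<open>z\<close> are third derivatives and \<open>eq\<close>
  is the linearised equation. The squared trace is maximised on the plane \<open>eq\<close> by
  duality. Equality occurs for a = 4, b = c = 1, so 4/3 cannot be raised here.\<close>

lemma weighted_trace_bound:
  fixes a b c x y z :: real
  assumes pos: "a > 0" "b > 0" "c > 0" and bc: "(a - b - c)\<^sup>2 \<le> 4 * b * c"
    and eq: "a * x + b * y + c * z = 0"
  shows "((a + b + c) / 2 + 4 / 3 * a) * (x + y + z)\<^sup>2 \<le> (a + b + c) / 2 * (x\<^sup>2 + 3 * y\<^sup>2 + 3 * z\<^sup>2)"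
proof -
  define D where "D = 3 * a\<^sup>2 + b\<^sup>2 + c\<^sup>2"
  define s where "s = b + c"
  define Q where "Q = x\<^sup>2 + 3 * y\<^sup>2 + 3 * z\<^sup>2"
  define S where "S = x + y + z"
  have D: "D > 0" unfolding D_def using pos by (simp add: add_pos_pos)
  have s: "s > 0" using pos by (simp add: s_def)
  \<comment> \<open>The Lagrange multiplier of \<open>eq\<close>: it minimises the dual norm, with
    weights 1, 1/3, 1/3, of the coefficients of \<open>S\<close>.\<close>
  define m where "m = (3 * a + s) / D"
  have mD: "m * D = 3 * a + s" using D by (simp add: m_def)
  have S: "S = (1 - m * a) * x + (1 - m * b) * y + (1 - m * c) * z"
    using arg_cong[OF eq, of "\<lambda>t. m * t"] by (simp add: S_def algebra_simps)
  have cs: "(p * x + q * y + r * z)\<^sup>2 \<le> (p\<^sup>2 + q\<^sup>2 / 3 + r\<^sup>2 / 3) * Q" for p q r :: real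
  proof -
    have "(p\<^sup>2 + q\<^sup>2 / 3 + r\<^sup>2 / 3) * Q - (p * x + q * y + r * z)\<^sup>2
      = (3 * p * y - q * x)\<^sup>2 / 3 + (3 * p * z - r * x)\<^sup>2 / 3 + (q * z - r * y)\<^sup>2"
      by (simp add: Q_def power2_eq_square field_simps)
    also have "\<dots> \<ge> 0" by simp
    finally show ?thesis by simp
  qed
  have W: "((1 - m * a)\<^sup>2 + (1 - m * b)\<^sup>2 / 3 + (1 - m * c)\<^sup>2 / 3) * (3 * D) = 5 * D - (3 * a + s)\<^sup>2"
  proof -
    have "((1 - m * a)\<^sup>2 + (1 - m * b)\<^sup>2 / 3 + (1 - m * c)\<^sup>2 / 3) * (3 * D)
      = 5 * D - 2 * (m * D) * (3 * a + s) + (m * D)\<^sup>2"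
      by (simp add: D_def s_def power2_eq_square field_simps)
    also have "\<dots> = 5 * D - (3 * a + s)\<^sup>2" unfolding mD by (simp add: power2_eq_square)
    finally show ?thesis .
  qed
  have as: "a \<le> 2 * s"
  proof -
    have "(a - s)\<^sup>2 \<le> 4 * b * c" using bc by (simp add: s_def diff_diff_eq)
    also have "\<dots> \<le> s\<^sup>2" using zero_le_power2[of "b - c"] by (simp add: s_def power2_eq_square algebra_simps)
    finally have "\<bar>a - s\<bar> \<le> s" using s by (simp add: abs_le_square_iff[symmetric])
    then show ?thesis by simp
  qed
  \<comment> \<open>Here 2 (b^2 + c^2) = 2 s^2 - 4 b c, and \<open>bc\<close> bounds 4 b c from
    below; afterwards only \<open>a\<close> and \<open>s\<close> occur.\<close>
  have Dle: "2 * D \<le> 5 * a\<^sup>2 + 2 * a * s + s\<^sup>2"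
    using bc by (simp add: D_def s_def power2_eq_square algebra_simps)
  have key: "(a + s + 8 / 3 * a) * (5 * D - (3 * a + s)\<^sup>2) \<le> (a + s) * (3 * D)"
  proof -
    have "2 * D * (23 * a + 3 * s) \<le> (5 * a\<^sup>2 + 2 * a * s + s\<^sup>2) * (23 * a + 3 * s)"
      using Dle pos s by (intro mult_right_mono) auto
    \<comment> \<open>The added term, nonnegative by \<open>as\<close>, completes the product to (11
      a + 3 s) (3 a + s)^2.\<close>
    also have "\<dots> \<le> (5 * a\<^sup>2 + 2 * a * s + s\<^sup>2) * (23 * a + 3 * s) + 16 * a\<^sup>2 * (2 * s - a)"
      using as by simp
    also have "\<dots> = (11 * a + 3 * s) * (3 * a + s)\<^sup>2"
      by (simp add: power2_eq_square algebra_simps)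
    finally show ?thesis by (simp add: algebra_simps)
  qed
  have "((a + s) + 8 / 3 * a) * S\<^sup>2 * (3 * D)
      \<le> ((a + s) + 8 / 3 * a) * (((1 - m * a)\<^sup>2 + (1 - m * b)\<^sup>2 / 3 + (1 - m * c)\<^sup>2 / 3) * Q) * (3 * D)"
    unfolding S using D pos s by (intro mult_right_mono mult_left_mono cs) auto
  also have "\<dots> = (a + s + 8 / 3 * a) * (5 * D - (3 * a + s)\<^sup>2) * Q"
    unfolding W[symmetric] by (simp add: mult_ac)
  also have "\<dots> \<le> (a + s) * (3 * D) * Q"
    using key by (intro mult_right_mono) (auto simp: Q_def)
  finally have "((a + s) + 8 / 3 * a) * S\<^sup>2 * (3 * D) \<le> (a + s) * Q * (3 * D)"
    by (simp add: mult_ac)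
  then have "((a + s) + 8 / 3 * a) * S\<^sup>2 \<le> (a + s) * Q"
    using D by (simp add: mult_le_cancel_right)
  then show ?thesis unfolding S_def Q_def s_def by (simp add: field_simps)
qed

section \<open>Orthogonal change of frame\<close>

lemma orthogonal_matrix_rows:
  fixes P :: "real^'n^'n"
  assumes "orthogonal_matrix P"
  shows "(\<Sum>a\<in>UNIV. P$i$a * P$j$a) = (if i = j then 1 else 0)"
    and "(\<Sum>i\<in>UNIV. P$i$a * P$i$b) = (if a = b then 1 else 0)"
proof -
  have "P ** transpose P = mat 1" "transpose P ** P = mat 1"
    using assms by (auto simp: orthogonal_matrix_def)
  from arg_cong[OF this(1), of "\<lambda>A. A$i$j"] arg_cong[OF this(2), of "\<lambda>A. A$a$b"]
  show "(\<Sum>a\<in>UNIV. P$i$a * P$j$a) = (if i = j then 1 else 0)"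
    and "(\<Sum>i\<in>UNIV. P$i$a * P$i$b) = (if a = b then 1 else 0)"
    by (simp_all add: matrix_matrix_mult_def transpose_def mat_def)
qed

lemma orthogonal_parseval:
  fixes P :: "real^'n^'n"
  assumes "orthogonal_matrix P"
  shows "(\<Sum>a\<in>UNIV. (\<Sum>i\<in>UNIV. P$i$a * v i) * (\<Sum>i\<in>UNIV. P$i$a * w i)) = (\<Sum>i\<in>UNIV. v i * w i)"
proof -
  have "(\<Sum>a\<in>UNIV. (\<Sum>i\<in>UNIV. P$i$a * v i) * (\<Sum>i\<in>UNIV. P$i$a * w i))
      = (\<Sum>a\<in>UNIV. \<Sum>i\<in>UNIV. \<Sum>j\<in>UNIV. v i * w j * (P$i$a * P$j$a))"
    by (simp add: sum_product mult_ac)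
  also have "\<dots> = (\<Sum>i\<in>UNIV. \<Sum>j\<in>UNIV. \<Sum>a\<in>UNIV. v i * w j * (P$i$a * P$j$a))"
    by (subst sum.swap, subst (2) sum.swap) (rule refl)
  also have "\<dots> = (\<Sum>i\<in>UNIV. \<Sum>j\<in>UNIV. v i * w j * (if i = j then 1 else 0))"
    by (simp add: sum_distrib_left[symmetric] orthogonal_matrix_rows[OF assms])
  also have "\<dots> = (\<Sum>i\<in>UNIV. v i * w i)" by (simp add: if_distrib cong: if_cong)
  finally show ?thesis .
qed

lemma orthogonal_diagonal_form:
  fixes P :: "real^'n^'n"
  assumes "\<And>i j. H i j = (\<Sum>a\<in>UNIV. P$i$a * lam$a * P$j$a)"
  shows "(\<Sum>i\<in>UNIV. \<Sum>j\<in>UNIV. H i j * B i j)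
    = (\<Sum>a\<in>UNIV. lam$a * (\<Sum>i\<in>UNIV. \<Sum>j\<in>UNIV. P$i$a * P$j$a * B i j))"
proof -
  have "(\<Sum>i\<in>UNIV. \<Sum>j\<in>UNIV. H i j * B i j)
      = (\<Sum>i\<in>UNIV. \<Sum>j\<in>UNIV. \<Sum>a\<in>UNIV. lam$a * (P$i$a * P$j$a * B i j))"
    by (simp add: assms sum_distrib_left sum_distrib_right mult_ac)
  also have "\<dots> = (\<Sum>a\<in>UNIV. \<Sum>i\<in>UNIV. \<Sum>j\<in>UNIV. lam$a * (P$i$a * P$j$a * B i j))"
    by (subst (2) sum.swap, subst sum.swap) (rule refl)
  finally show ?thesis by (simp add: sum_distrib_left)
qed

text \<open>The weights 1 and 3 count the arrangements of the index patterns aaa and aab. The six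
  entries with distinct indices are dropped: in an eigenframe they enter neither the traces nor the
  linearised equation.\<close>

lemma symmetric_tensor_norm_ge:
  fixes T :: "3 \<Rightarrow> 3 \<Rightarrow> 3 \<Rightarrow> real"
  assumes s1: "\<And>i j k. T i j k = T j i k" and s2: "\<And>i j k. T i j k = T i k j"
  shows "(T 1 1 1)\<^sup>2 + 3 * (T 2 2 1)\<^sup>2 + 3 * (T 3 3 1)\<^sup>2
      + ((T 2 2 2)\<^sup>2 + 3 * (T 1 1 2)\<^sup>2 + 3 * (T 3 3 2)\<^sup>2)
      + ((T 3 3 3)\<^sup>2 + 3 * (T 1 1 3)\<^sup>2 + 3 * (T 2 2 3)\<^sup>2)
    \<le> (\<Sum>i\<in>UNIV. \<Sum>j\<in>UNIV. \<Sum>k\<in>UNIV. (T i j k)\<^sup>2)"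
proof -
  have a: "T 1 2 1 = T 1 1 2" "T 2 1 1 = T 1 1 2" "T 1 3 1 = T 1 1 3" "T 3 1 1 = T 1 1 3"
    "T 1 2 2 = T 2 2 1" "T 2 1 2 = T 2 2 1" "T 2 3 2 = T 2 2 3" "T 3 2 2 = T 2 2 3"
    "T 1 3 3 = T 3 3 1" "T 3 1 3 = T 3 3 1" "T 2 3 3 = T 3 3 2" "T 3 2 3 = T 3 3 2"
    using s1 s2 by metis+
  have "0 \<le> (T 1 2 3)\<^sup>2 + (T 1 3 2)\<^sup>2 + (T 2 1 3)\<^sup>2 + (T 2 3 1)\<^sup>2 + (T 3 1 2)\<^sup>2 + (T 3 2 1)\<^sup>2"
    by simp
  then show ?thesis by (simp add: sum_3 a)
qed

lemma orthogonal_diagonal_trace: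
  fixes P :: "real^'n^'n"
  assumes P: "orthogonal_matrix P" and H: "\<And>i j. H i j = (\<Sum>a\<in>UNIV. P$i$a * lam$a * P$j$a)"
  shows "(\<Sum>i\<in>UNIV. H i i) = (\<Sum>a\<in>UNIV. lam$a)"
proof -
  have "(\<Sum>i\<in>UNIV. H i i) = (\<Sum>a\<in>UNIV. lam$a * (\<Sum>i\<in>UNIV. P$i$a * P$i$a))"
    unfolding H by (subst sum.swap) (simp add: sum_distrib_left mult_ac)
  then show ?thesis by (simp add: orthogonal_matrix_rows[OF P])
qed

lemma orthogonal_diagonal_norm:
  fixes P :: "real^'n^'n"
  assumes P: "orthogonal_matrix P" and H: "\<And>i j. H i j = (\<Sum>a\<in>UNIV. P$i$a * lam$a * P$j$a)"
  shows "(\<Sum>i\<in>UNIV. \<Sum>j\<in>UNIV. (H i j)\<^sup>2) = (\<Sum>a\<in>UNIV. (lam$a)\<^sup>2)"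
proof -
  note PP = orthogonal_matrix_rows[OF P]
  have "(\<Sum>i\<in>UNIV. \<Sum>j\<in>UNIV. P$i$a * P$j$a * H i j) = lam$a" for a
  proof -
    have "(\<Sum>j\<in>UNIV. P$j$a * H i j) = lam$a * P$i$a" for i
    proof -
      have "(\<Sum>j\<in>UNIV. P$j$a * H i j) = (\<Sum>b\<in>UNIV. P$i$b * lam$b * (\<Sum>j\<in>UNIV. P$j$a * P$j$b))"
        unfolding H sum_distrib_left by (subst sum.swap) (simp add: mult_ac)
      then show ?thesis by (simp add: PP if_distrib cong: if_cong)
    qed
    then have "(\<Sum>i\<in>UNIV. \<Sum>j\<in>UNIV. P$i$a * P$j$a * H i j) = (\<Sum>i\<in>UNIV. lam$a * (P$i$a * P$i$a))"
      by (simp add: mult.assoc sum_distrib_left[symmetric]) (simp add: mult_ac sum_distrib_left)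
    then show ?thesis by (simp add: sum_distrib_left[symmetric] PP)
  qed
  then show ?thesis
    using orthogonal_diagonal_form[of H P lam H, OF H] by (simp add: power2_eq_square)
qed

text \<open>In an eigenframe of \<open>H\<close>, both the traces and the linearised equation
  \<open>con\<close> involve only the entries \<open>T3 a a c\<close>. The inequality therefore
  splits into one problem for each \<open>c\<close>, which \<open>weighted_trace_bound\<close>
  solves with the eigenvalue of F in direction \<open>c\<close> in the distinguished role.\<close>

lemma sigma2_jacobi_algebra:
  fixes P :: "real^3^3" and H :: "3 \<Rightarrow> 3 \<Rightarrow> real" and T :: "3 \<Rightarrow> 3 \<Rightarrow> 3 \<Rightarrow> real"
  assumes P: "orthogonal_matrix P" and H: "\<And>i j. H i j = (\<Sum>a\<in>UNIV. P$i$a * lam$a * P$j$a)"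
    and s1: "\<And>i j k. T i j k = T j i k" and s2: "\<And>i j k. T i j k = T i k j"
    and f: "f = (\<Sum>i\<in>UNIV. H i i)" and fpos: "f > 0"
    and sig: "f\<^sup>2 - (\<Sum>i\<in>UNIV. \<Sum>j\<in>UNIV. (H i j)\<^sup>2) = 2"
    and tau: "\<And>k. tau k = (\<Sum>i\<in>UNIV. T i i k)"
    and con: "\<And>k. f * tau k = (\<Sum>i\<in>UNIV. \<Sum>j\<in>UNIV. H i j * T i j k)"
  shows "4 / 3 * (f * (\<Sum>k\<in>UNIV. (tau k)\<^sup>2) - (\<Sum>i\<in>UNIV. \<Sum>j\<in>UNIV. H i j * (tau i * tau j)))
    \<le> f * ((\<Sum>i\<in>UNIV. \<Sum>j\<in>UNIV. \<Sum>k\<in>UNIV. (T i j k)\<^sup>2) - (\<Sum>k\<in>UNIV. (tau k)\<^sup>2))"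
proof -
  note PP = orthogonal_matrix_rows[OF P]
  note pars = orthogonal_parseval[OF P]
  \<comment> \<open>One index is rotated at a time, so that invariance of the norm is Parseval
    applied three times.\<close>
  define T1 where "T1 i j c = (\<Sum>k\<in>UNIV. P$k$c * T i j k)" for i j c
  define T2 where "T2 i b c = (\<Sum>j\<in>UNIV. P$j$b * T1 i j c)" for i b c
  define T3 where "T3 a b c = (\<Sum>i\<in>UNIV. P$i$a * T2 i b c)" for a b c
  define t where "t c = (\<Sum>k\<in>UNIV. P$k$c * tau k)" for c
  have T3: "T3 a b c = (\<Sum>i\<in>UNIV. \<Sum>j\<in>UNIV. P$i$a * P$j$b * T1 i j c)" for a b c
    by (simp add: T3_def T2_def sum_distrib_left mult_ac)
  have T3': "T3 a b c = (\<Sum>i\<in>UNIV. \<Sum>j\<in>UNIV. \<Sum>k\<in>UNIV. P$i$a * P$j$b * P$k$c * T i j k)" for a b c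
    by (simp add: T3 T1_def sum_distrib_left mult_ac)
  have sym1: "T3 a b c = T3 b a c" for a b c
  proof -
    have "T3 a b c = (\<Sum>j\<in>UNIV. \<Sum>i\<in>UNIV. P$i$a * P$j$b * T1 i j c)"
      unfolding T3 by (rule sum.swap)
    also have "\<dots> = T3 b a c" unfolding T3
      by (intro sum.cong refl) (simp add: T1_def s1 mult_ac)
    finally show ?thesis .
  qed
  have sym2: "T3 a b c = T3 a c b" for a b c
  proof -
    have "T3 a b c = (\<Sum>i\<in>UNIV. \<Sum>k\<in>UNIV. \<Sum>j\<in>UNIV. P$i$a * P$j$b * P$k$c * T i j k)"
      unfolding T3' by (intro sum.cong refl sum.swap)
    also have "\<dots> = T3 a c b" unfolding T3'
      by (intro sum.cong refl) (use s2 in \<open>simp add: mult_ac\<close>)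
    finally show ?thesis .
  qed
  have nT: "(\<Sum>i\<in>UNIV. \<Sum>j\<in>UNIV. \<Sum>k\<in>UNIV. (T i j k)\<^sup>2) = (\<Sum>a\<in>UNIV. \<Sum>b\<in>UNIV. \<Sum>c\<in>UNIV. (T3 a b c)\<^sup>2)"
  proof -
    have "(\<Sum>a\<in>UNIV. \<Sum>b\<in>UNIV. \<Sum>c\<in>UNIV. (T3 a b c)\<^sup>2) = (\<Sum>b\<in>UNIV. \<Sum>c\<in>UNIV. \<Sum>a\<in>UNIV. (T3 a b c)\<^sup>2)"
      by (subst sum.swap, subst (2) sum.swap) (rule refl)
    also have "\<dots> = (\<Sum>b\<in>UNIV. \<Sum>c\<in>UNIV. \<Sum>i\<in>UNIV. (T2 i b c)\<^sup>2)"
      unfolding T3_def power2_eq_square pars ..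
    also have "\<dots> = (\<Sum>i\<in>UNIV. \<Sum>c\<in>UNIV. \<Sum>b\<in>UNIV. (T2 i b c)\<^sup>2)"
      by (subst (2) sum.swap, subst sum.swap, subst (2) sum.swap) (rule refl)
    also have "\<dots> = (\<Sum>i\<in>UNIV. \<Sum>c\<in>UNIV. \<Sum>j\<in>UNIV. (T1 i j c)\<^sup>2)"
      unfolding T2_def power2_eq_square pars ..
    also have "\<dots> = (\<Sum>i\<in>UNIV. \<Sum>j\<in>UNIV. \<Sum>c\<in>UNIV. (T1 i j c)\<^sup>2)"
      by (subst (2) sum.swap) (rule refl)
    also have "\<dots> = (\<Sum>i\<in>UNIV. \<Sum>j\<in>UNIV. \<Sum>k\<in>UNIV. (T i j k)\<^sup>2)"
      unfolding T1_def power2_eq_square pars ..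
    finally show ?thesis by simp
  qed
  have nt: "(\<Sum>k\<in>UNIV. (tau k)\<^sup>2) = (\<Sum>c\<in>UNIV. (t c)\<^sup>2)"
    unfolding t_def power2_eq_square pars ..
  have Htt: "(\<Sum>i\<in>UNIV. \<Sum>j\<in>UNIV. H i j * (tau i * tau j)) = (\<Sum>a\<in>UNIV. lam$a * (t a)\<^sup>2)"
    unfolding orthogonal_diagonal_form[of H P lam, OF H]
    by (simp add: t_def power2_eq_square sum_product mult_ac)
  have tr3: "t c = (\<Sum>a\<in>UNIV. T3 a a c)" for c
  proof -
    have "(\<Sum>a\<in>UNIV. T3 a a c) = (\<Sum>i\<in>UNIV. \<Sum>j\<in>UNIV. \<Sum>a\<in>UNIV. T1 i j c * (P$i$a * P$j$a))"
      unfolding T3 by (subst sum.swap, subst (2) sum.swap) (simp add: mult_ac)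
    also have "\<dots> = (\<Sum>i\<in>UNIV. T1 i i c)"
      by (simp add: sum_distrib_left[symmetric] PP if_distrib cong: if_cong)
    also have "\<dots> = t c" unfolding T1_def t_def tau
      by (subst sum.swap) (simp add: sum_distrib_left)
    finally show ?thesis by simp
  qed
  have con3: "f * t c = (\<Sum>a\<in>UNIV. lam$a * T3 a a c)" for c
  proof -
    have "(\<Sum>a\<in>UNIV. lam$a * T3 a a c) = (\<Sum>i\<in>UNIV. \<Sum>j\<in>UNIV. H i j * T1 i j c)"
      unfolding orthogonal_diagonal_form[of H P lam, OF H] T3 ..
    also have "\<dots> = (\<Sum>i\<in>UNIV. \<Sum>j\<in>UNIV. \<Sum>k\<in>UNIV. P$k$c * (H i j * T i j k))"
      by (simp add: T1_def sum_distrib_left mult_ac)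
    also have "\<dots> = (\<Sum>k\<in>UNIV. \<Sum>i\<in>UNIV. \<Sum>j\<in>UNIV. P$k$c * (H i j * T i j k))"
      by (subst (2) sum.swap, subst sum.swap) (rule refl)
    also have "\<dots> = (\<Sum>k\<in>UNIV. P$k$c * (f * tau k))"
      by (simp add: con sum_distrib_left)
    also have "\<dots> = f * t c" by (simp add: t_def sum_distrib_left mult_ac)
    finally show ?thesis by simp
  qed
  have fl: "f = lam$1 + lam$2 + lam$3"
    unfolding f orthogonal_diagonal_trace[OF P H] by (simp add: sum_3)
  note Hl = orthogonal_diagonal_norm[OF P H]
  have sig2: "lam$1 * lam$2 + lam$1 * lam$3 + lam$2 * lam$3 = 1"
    using sig unfolding Hl fl by (simp add: sum_3 power2_eq_square algebra_simps)
  have lt: "lam$a < f" for a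
  proof -
    have "(lam$a)\<^sup>2 \<le> (\<Sum>a\<in>UNIV. (lam$a)\<^sup>2)" by (rule member_le_sum) auto
    also have "\<dots> < f\<^sup>2" using sig Hl by simp
    finally show ?thesis using fpos by (simp add: power_less_imp_less_base)
  qed
  have main: "(f + 4 / 3 * (f - lam$a)) * (T3 a a a + T3 b b a + T3 c c a)\<^sup>2
      \<le> f * ((T3 a a a)\<^sup>2 + 3 * (T3 b b a)\<^sup>2 + 3 * (T3 c c a)\<^sup>2)"
    if fabc: "f = lam$a + lam$b + lam$c" and sabc: "lam$a * lam$b + lam$a * lam$c + lam$b * lam$c = 1"
      and con: "f * (T3 a a a + T3 b b a + T3 c c a)
        = lam$a * T3 a a a + lam$b * T3 b b a + lam$c * T3 c c a" for a b c
  proof -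
    have h: "((f - lam$a) + (f - lam$b) + (f - lam$c)) / 2 = f" using fabc by simp
    \<comment> \<open>By sigma_2 = 1 this product is 1 + lambda_a^2, hence larger than lambda_a^2:
      exactly the hypothesis \<open>bc\<close> of the trace bound.\<close>
    have bc: "(f - lam$b) * (f - lam$c) = 1 + (lam$a)\<^sup>2"
      using sabc by (simp add: fabc algebra_simps power2_eq_square)
    have "((f - lam$a) - (f - lam$b) - (f - lam$c))\<^sup>2 = 4 * (lam$a)\<^sup>2"
      by (simp add: fabc power2_eq_square algebra_simps)
    also have "\<dots> \<le> 4 * (f - lam$b) * (f - lam$c)" unfolding mult.assoc bc by simp
    finally have b: "((f - lam$a) - (f - lam$b) - (f - lam$c))\<^sup>2 \<le> 4 * (f - lam$b) * (f - lam$c)" .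
    show ?thesis
      using weighted_trace_bound[OF _ _ _ b, of "T3 a a a" "T3 b b a" "T3 c c a"] lt con
      unfolding h by (simp add: algebra_simps)
  qed
  have 1: "(f + 4 / 3 * (f - lam$1)) * (t 1)\<^sup>2 \<le> f * ((T3 1 1 1)\<^sup>2 + 3 * (T3 2 2 1)\<^sup>2 + 3 * (T3 3 3 1)\<^sup>2)"
    using main[of 1 2 3] fl sig2 con3[of 1] by (simp add: tr3 sum_3 add_ac)
  have 2: "(f + 4 / 3 * (f - lam$2)) * (t 2)\<^sup>2 \<le> f * ((T3 2 2 2)\<^sup>2 + 3 * (T3 1 1 2)\<^sup>2 + 3 * (T3 3 3 2)\<^sup>2)"
    using main[of 2 1 3] fl sig2 con3[of 2] by (simp add: tr3 sum_3 ac_simps)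
  have 3: "(f + 4 / 3 * (f - lam$3)) * (t 3)\<^sup>2 \<le> f * ((T3 3 3 3)\<^sup>2 + 3 * (T3 1 1 3)\<^sup>2 + 3 * (T3 2 2 3)\<^sup>2)"
    using main[of 3 1 2] fl sig2 con3[of 3] by (simp add: tr3 sum_3 ac_simps)
  define NT where "NT = (\<Sum>i\<in>UNIV. \<Sum>j\<in>UNIV. \<Sum>k\<in>UNIV. (T i j k)\<^sup>2)"
  have "f * ((T3 1 1 1)\<^sup>2 + 3 * (T3 2 2 1)\<^sup>2 + 3 * (T3 3 3 1)\<^sup>2
      + ((T3 2 2 2)\<^sup>2 + 3 * (T3 1 1 2)\<^sup>2 + 3 * (T3 3 3 2)\<^sup>2)
      + ((T3 3 3 3)\<^sup>2 + 3 * (T3 1 1 3)\<^sup>2 + 3 * (T3 2 2 3)\<^sup>2))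
    \<le> f * NT"
    unfolding NT_def nT using fpos by (intro mult_left_mono symmetric_tensor_norm_ge sym1 sym2) auto
  with 1 2 3 show ?thesis
    unfolding nt Htt NT_def[symmetric] by (simp add: sum_3 field_simps)
qed

section \<open>Calculus on Euclidean space\<close>

text \<open>The partial derivatives are carried as explicit functions next to the Frechet
  derivative. They are unique, so an identity between functions is differentiated by computing the
  partials of both sides and comparing, and higher derivatives become indexed families.\<close>

definition has_partials :: "(real^'n \<Rightarrow> real) \<Rightarrow> ('n \<Rightarrow> real^'n \<Rightarrow> real) \<Rightarrow> bool" where
  "has_partials f g \<longleftrightarrow> (\<forall>x. (f has_derivative (\<lambda>v. \<Sum>i\<in>UNIV. g i x * v$i)) (at x))"

lemma has_partialsD: "has_partials f g \<Longrightarrow> (f has_derivative (\<lambda>v. \<Sum>i\<in>UNIV. g i x * v$i)) (at x)"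
  by (simp add: has_partials_def)

lemma has_partials_continuous: "has_partials f g \<Longrightarrow> continuous_on UNIV f"
  by (meson has_partialsD has_derivative_continuous continuous_at_imp_continuous_on)

lemma has_partials_partial_deriv:
  fixes f :: "real^'n \<Rightarrow> real"
  assumes "\<forall>x. f differentiable (at x)"
  shows "has_partials f (\<lambda>i. partial_deriv i f)"
  unfolding has_partials_def
proof
  fix x
  define D where "D = frechet_derivative f (at x)"
  have D: "(f has_derivative D) (at x)"
    using assms by (simp add: D_def frechet_derivative_works[symmetric])
  interpret D: linear D using D by (rule has_derivative_linear)
  have "D v = (\<Sum>i\<in>UNIV. partial_deriv i f x * v$i)" for v
  proof -
    have "D v = D (\<Sum>i\<in>UNIV. v$i *\<^sub>R axis i 1)"
      using basis_expansion[of v] by (simp add: scalar_mult_eq_scaleR)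
    also have "\<dots> = (\<Sum>i\<in>UNIV. v$i * D (axis i 1))" by (simp add: D.sum D.scaleR)
    finally show ?thesis by (simp add: partial_deriv_def D_def mult.commute)
  qed
  then have "D = (\<lambda>v. \<Sum>i\<in>UNIV. partial_deriv i f x * v$i)" by auto
  then show "(f has_derivative (\<lambda>v. \<Sum>i\<in>UNIV. partial_deriv i f x * v$i)) (at x)"
    using D by simp
qed

lemma has_partials_unique:
  fixes f :: "real^'n \<Rightarrow> real"
  assumes "has_partials f g" "has_partials f g'"
  shows "g i x = g' i x"
proof -
  have "(\<lambda>v. \<Sum>i\<in>UNIV. g i x * v$i) = (\<lambda>v. \<Sum>i\<in>UNIV. g' i x * v$i)"
    using has_derivative_unique[OF has_partialsD has_partialsD] assms by blast
  then have "(\<Sum>j\<in>UNIV. g j x * (axis i 1 :: real^'n)$j) = (\<Sum>j\<in>UNIV. g' j x * (axis i 1 :: real^'n)$j)"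
    by meson
  then show ?thesis by (simp add: axis_def if_distrib cong: if_cong)
qed

lemma has_partials_const: "has_partials (\<lambda>x. c) (\<lambda>i x. 0)"
  by (simp add: has_partials_def)

lemma has_partials_coord: "has_partials (\<lambda>x::real^'n. x$k) (\<lambda>i x. of_bool (i = k))"
proof -
  have "bounded_linear (\<lambda>v::real^'n. v$k)" by (rule bounded_linear_vec_nth)
  moreover have "(\<Sum>i\<in>UNIV. of_bool (i = k) * v$i) = v$k" for v :: "real^'n"
    by (simp add: of_bool_def if_distribR if_distrib cong: if_cong)
  ultimately show ?thesis
    by (auto simp: has_partials_def intro: bounded_linear_imp_has_derivative)
qed

lemma has_partials_add:
  assumes "has_partials f f'" "has_partials g g'"
  shows "has_partials (\<lambda>x. f x + g x) (\<lambda>i x. f' i x + g' i x)"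
  unfolding has_partials_def
  using has_derivative_add[OF has_partialsD[OF assms(1)] has_partialsD[OF assms(2)]]
  by (simp add: sum.distrib[symmetric] algebra_simps)

lemma has_partials_diff:
  assumes "has_partials f f'" "has_partials g g'"
  shows "has_partials (\<lambda>x. f x - g x) (\<lambda>i x. f' i x - g' i x)"
  unfolding has_partials_def
  using has_derivative_diff[OF has_partialsD[OF assms(1)] has_partialsD[OF assms(2)]]
  by (simp add: sum_subtractf[symmetric] algebra_simps)

lemma has_partials_mult:
  assumes "has_partials f f'" "has_partials g g'"
  shows "has_partials (\<lambda>x. f x * g x) (\<lambda>i x. f' i x * g x + f x * g' i x)"
  unfolding has_partials_def
proof
  fix x
  have "((\<lambda>x. f x * g x) has_derivative
      (\<lambda>v. f x * (\<Sum>i\<in>UNIV. g' i x * v$i) + (\<Sum>i\<in>UNIV. f' i x * v$i) * g x)) (at x)"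
    by (intro has_derivative_mult has_partialsD assms)
  then show "((\<lambda>x. f x * g x) has_derivative (\<lambda>v. \<Sum>i\<in>UNIV. (f' i x * g x + f x * g' i x) * v$i)) (at x)"
    by (simp add: sum_distrib_left sum_distrib_right sum.distrib[symmetric] algebra_simps)
qed

lemma has_partials_cmult:
  assumes "has_partials f f'"
  shows "has_partials (\<lambda>x. c * f x) (\<lambda>i x. c * f' i x)"
  using has_partials_mult[OF has_partials_const assms, of c] by simp

lemma has_partials_sum:
  assumes "\<And>k. k \<in> I \<Longrightarrow> has_partials (f k) (f' k)"
  shows "has_partials (\<lambda>x. \<Sum>k\<in>I. f k x) (\<lambda>i x. \<Sum>k\<in>I. f' k i x)"
  using assms
proof (induction I rule: infinite_finite_induct)
  case (insert k I)
  then show ?case by (simp add: has_partials_add)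
qed (simp_all add: has_partials_const)

lemma has_partials_compose:
  assumes "has_partials f f'" "\<And>x. (G has_real_derivative G' (f x)) (at (f x))"
  shows "has_partials (\<lambda>x. G (f x)) (\<lambda>i x. G' (f x) * f' i x)"
  unfolding has_partials_def
proof
  fix x
  have "(G has_derivative (\<lambda>t. G' (f x) * t)) (at (f x))"
    using assms(2) by (simp add: has_field_derivative_def)
  from has_derivative_compose[OF has_partialsD[OF assms(1)] this]
  show "((\<lambda>x. G (f x)) has_derivative (\<lambda>v. \<Sum>i\<in>UNIV. G' (f x) * f' i x * v$i)) (at x)"
    by (simp add: sum_distrib_left mult_ac)
qed

lemma has_partials_line:
  assumes "has_partials f g"
  shows "((\<lambda>t. f (x + t *\<^sub>R e)) has_real_derivative (\<Sum>i\<in>UNIV. g i (x + t *\<^sub>R e) * e$i)) (at t)"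
proof -
  have "((\<lambda>t. x + t *\<^sub>R e) has_derivative (\<lambda>s. s *\<^sub>R e)) (at t)"
    by (auto intro!: derivative_eq_intros)
  from has_derivative_compose[OF this has_partialsD[OF assms]]
  have "((\<lambda>t. f (x + t *\<^sub>R e)) has_derivative
      (\<lambda>s. \<Sum>i\<in>UNIV. g i (x + t *\<^sub>R e) * (s *\<^sub>R e)$i)) (at t)" .
  moreover have "(\<lambda>s. \<Sum>i\<in>UNIV. g i (x + t *\<^sub>R e) * (s *\<^sub>R e)$i)
      = (\<lambda>s. (\<Sum>i\<in>UNIV. g i (x + t *\<^sub>R e) * e$i) * s)"
    by (simp add: fun_eq_iff sum_distrib_left mult_ac)
  ultimately show ?thesis by (simp add: has_field_derivative_def)
qed

lemma has_partials_line_axis: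
  assumes "has_partials f g"
  shows "((\<lambda>t. f (x + t *\<^sub>R axis i 1)) has_real_derivative g i (x + t *\<^sub>R axis i 1)) (at t)"
  using has_partials_line[OF assms, of x "axis i 1" t]
  by (simp add: axis_def if_distrib cong: if_cong)

lemma has_partials_mvt:
  assumes "has_partials f g" "s > 0"
  obtains \<theta> where "0 < \<theta>" "\<theta> < s" "f (x + s *\<^sub>R axis i 1) - f x = s * g i (x + \<theta> *\<^sub>R axis i 1)"
  using MVT2[OF \<open>s > 0\<close>, of "\<lambda>t. f (x + t *\<^sub>R axis i 1)" "\<lambda>t. g i (x + t *\<^sub>R axis i 1)"]
    has_partials_line_axis[OF assms(1)] by auto

text \<open>The mean value theorem is applied in direction \<open>i\<close> and then in direction
  \<open>j\<close>. The second difference is symmetric in \<open>i\<close> and \<open>j\<close>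
  while \<open>h i j\<close> is not visibly so; small \<open>s\<close> then gives Schwarz's
  theorem.\<close>

lemma second_difference:
  fixes f :: "real^'n \<Rightarrow> real"
  assumes f: "has_partials f g" and g: "\<And>i. has_partials (g i) (h i)" and s: "s > 0"
  obtains y where "dist y x \<le> 2 * s"
    "f (x + s *\<^sub>R axis i 1 + s *\<^sub>R axis j 1) - f (x + s *\<^sub>R axis i 1) - f (x + s *\<^sub>R axis j 1) + f x
      = s\<^sup>2 * h i j y"
proof -
  have "has_partials (\<lambda>y. f (y + s *\<^sub>R axis j 1) - f y) (\<lambda>i y. g i (y + s *\<^sub>R axis j 1) - g i y)"
    unfolding has_partials_def
  proof
    fix y
    have a: "((\<lambda>y. y + s *\<^sub>R axis j 1) has_derivative (\<lambda>v::real^'n. v)) (at y)"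
      by (auto intro!: derivative_eq_intros)
    have "((\<lambda>y. f (y + s *\<^sub>R axis j 1) - f y) has_derivative
        (\<lambda>v. (\<Sum>i\<in>UNIV. g i (y + s *\<^sub>R axis j 1) * v$i) - (\<Sum>i\<in>UNIV. g i y * v$i))) (at y)"
      by (intro has_derivative_diff has_partialsD f has_derivative_compose[OF a has_partialsD[OF f]])
    then show "((\<lambda>y. f (y + s *\<^sub>R axis j 1) - f y) has_derivative
        (\<lambda>v. \<Sum>i\<in>UNIV. (g i (y + s *\<^sub>R axis j 1) - g i y) * v$i)) (at y)"
      by (simp add: sum_subtractf[symmetric] algebra_simps)
  qed
  from has_partials_mvt[OF this s, of x i] obtain \<theta> where \<theta>: "0 < \<theta>" "\<theta> < s"
    "f (x + s *\<^sub>R axis i 1 + s *\<^sub>R axis j 1) - f (x + s *\<^sub>R axis i 1) - (f (x + s *\<^sub>R axis j 1) - f x)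
      = s * (g i (x + \<theta> *\<^sub>R axis i 1 + s *\<^sub>R axis j 1) - g i (x + \<theta> *\<^sub>R axis i 1))"
    by auto
  from has_partials_mvt[OF g s, of i "x + \<theta> *\<^sub>R axis i 1" j] obtain \<eta> where \<eta>: "0 < \<eta>" "\<eta> < s"
    "g i (x + \<theta> *\<^sub>R axis i 1 + s *\<^sub>R axis j 1) - g i (x + \<theta> *\<^sub>R axis i 1)
      = s * h i j (x + \<theta> *\<^sub>R axis i 1 + \<eta> *\<^sub>R axis j 1)" by auto
  have "dist (x + \<theta> *\<^sub>R axis i 1 + \<eta> *\<^sub>R axis j 1) x = norm (\<theta> *\<^sub>R axis i 1 + \<eta> *\<^sub>R axis j 1 :: real^'n)"
    by (simp add: dist_norm add.assoc)
  also have "\<dots> \<le> \<theta> + \<eta>" using norm_triangle_ineq[of "\<theta> *\<^sub>R axis i 1" "\<eta> *\<^sub>R axis j 1 :: real^'n"] \<theta> \<eta> by simp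
  finally have "dist (x + \<theta> *\<^sub>R axis i 1 + \<eta> *\<^sub>R axis j 1) x \<le> 2 * s" using \<theta> \<eta> by simp
  then show thesis using \<theta>(3) \<eta>(3) by (intro that) (auto simp: power2_eq_square)
qed

lemma mixed_partials_commute:
  fixes f :: "real^'n \<Rightarrow> real"
  assumes f: "has_partials f g" and g: "\<And>i. has_partials (g i) (h i)"
    and h: "\<And>i j. continuous_on UNIV (h i j)"
  shows "h i j x = h j i x"
proof (rule ccontr)
  assume ne: "h i j x \<noteq> h j i x"
  define e where "e = \<bar>h i j x - h j i x\<bar> / 2"
  have e: "e > 0" using ne by (simp add: e_def)
  have "\<exists>d>0. \<forall>y. dist y x < d \<longrightarrow> dist (h i j y) (h i j x) < e" for i j
    using h[of i j] e by (auto simp: continuous_on_iff)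
  then obtain d1 d2 where d: "d1 > 0" "\<And>y. dist y x < d1 \<Longrightarrow> dist (h i j y) (h i j x) < e"
     "d2 > 0" "\<And>y. dist y x < d2 \<Longrightarrow> dist (h j i y) (h j i x) < e" by meson
  define s where "s = min d1 d2 / 4"
  have s: "s > 0" "2 * s < d1" "2 * s < d2" using d by (auto simp: s_def)
  obtain y where y: "dist y x \<le> 2 * s"
    "f (x + s *\<^sub>R axis i 1 + s *\<^sub>R axis j 1) - f (x + s *\<^sub>R axis i 1) - f (x + s *\<^sub>R axis j 1) + f x
      = s\<^sup>2 * h i j y" using second_difference[OF f g s(1)] by blast
  obtain z where z: "dist z x \<le> 2 * s"
    "f (x + s *\<^sub>R axis j 1 + s *\<^sub>R axis i 1) - f (x + s *\<^sub>R axis j 1) - f (x + s *\<^sub>R axis i 1) + f x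
      = s\<^sup>2 * h j i z" using second_difference[OF f g s(1)] by blast
  have swap: "x + s *\<^sub>R axis j 1 + s *\<^sub>R axis i 1 = x + s *\<^sub>R axis i 1 + s *\<^sub>R axis j 1"
    by (simp add: add_ac)
  have "s\<^sup>2 * h i j y = s\<^sup>2 * h j i z" using y(2) z(2) unfolding swap by linarith
  then have "h i j y = h j i z" using s by simp
  moreover have "dist (h i j y) (h i j x) < e" "dist (h j i z) (h j i x) < e" using d y z s by auto
  ultimately show False by (auto simp: e_def dist_real_def abs_if split: if_splits)
qed

section \<open>Integration: translation, divergence and a Poincare estimate\<close>

lemma integrable_continuous_support:
  fixes w :: "'a::euclidean_space \<Rightarrow> real"
  assumes "continuous_on UNIV w" "\<And>x. norm x > R \<Longrightarrow> w x = 0"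
  shows "integrable lborel w"
proof -
  have "integrable lborel (\<lambda>x. indicator (cball 0 R) x *\<^sub>R w x)"
    by (intro borel_integrable_compact compact_cball continuous_on_subset[OF assms(1)]) auto
  moreover have "(\<lambda>x. indicator (cball 0 R) x *\<^sub>R w x) = w"
    using assms(2) by (auto simp: indicator_def fun_eq_iff not_le)
  ultimately show ?thesis by simp
qed

lemma integral_lborel_translate:
  fixes w :: "'a::euclidean_space \<Rightarrow> real"
  assumes "w \<in> borel_measurable borel"
  shows "(\<integral>x. w (x + c) \<partial>lborel) = (\<integral>x. w x \<partial>lborel)"
proof -
  have "(\<integral>x. w x \<partial>lborel) = (\<integral>x. w x \<partial>(distr lborel borel ((+) c)))"
    by (simp add: lborel_distr_plus)
  also have "\<dots> = (\<integral>x. w (c + x) \<partial>lborel)"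
    using assms by (intro integral_distr) auto
  finally show ?thesis by (simp add: add.commute)
qed

lemma nn_integral_lborel_translate:
  fixes w :: "'a::euclidean_space \<Rightarrow> ennreal"
  assumes "w \<in> borel_measurable borel"
  shows "(\<integral>\<^sup>+x. w (x + c) \<partial>lborel) = (\<integral>\<^sup>+x. w x \<partial>lborel)"
proof -
  have "(\<integral>\<^sup>+x. w x \<partial>lborel) = (\<integral>\<^sup>+x. w x \<partial>(distr lborel borel ((+) c)))"
    by (simp add: lborel_distr_plus)
  also have "\<dots> = (\<integral>\<^sup>+x. w (c + x) \<partial>lborel)"
    using assms by (intro nn_integral_distr) auto
  finally show ?thesis by (simp add: add.commute)
qed

text \<open>Difference quotients of \<open>w\<close> have integral 0 by translation invariance and
  converge dominatedly to the partial derivative. Summed over \<open>i\<close>, this is the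
  divergence theorem for compactly supported fields.\<close>

lemma integral_partial_eq_0:
  fixes w :: "real^'n \<Rightarrow> real"
  assumes w: "has_partials w g" and g: "continuous_on UNIV (g i)"
    and supp: "\<And>x. norm x > R \<Longrightarrow> w x = 0"
  shows "(\<integral>x. g i x \<partial>lborel) = 0"
proof -
  have wc: "continuous_on UNIV w" using w by (rule has_partials_continuous)
  have [measurable]: "w \<in> borel_measurable borel" "g i \<in> borel_measurable borel"
    using wc g by (auto intro: borel_measurable_continuous_onI)
  have iw: "integrable lborel w" by (rule integrable_continuous_support[OF wc supp])
  define s where "s n x = (w (x + (1 / real (Suc n)) *\<^sub>R axis i 1) - w x) * real (Suc n)" for n x
  have "compact ((\<lambda>x. norm (g i x)) ` cball 0 (R + 2))"
    by (intro compact_continuous_image compact_cball continuous_on_norm continuous_on_subset[OF g]) auto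
  then obtain M where "\<forall>y\<in>(\<lambda>x. norm (g i x)) ` cball 0 (R + 2). norm y \<le> M"
    using compact_imp_bounded bounded_iff by metis
  then have M: "\<And>x. norm x \<le> R + 2 \<Longrightarrow> norm (g i x) \<le> M" by auto
  have lim: "(\<lambda>n. s n x) \<longlonglongrightarrow> g i x" for x
  proof -
    have "((\<lambda>t. w (x + t *\<^sub>R axis i 1)) has_real_derivative g i x) (at 0)"
      using has_partials_line_axis[OF w, of x i 0] by simp
    then have "((\<lambda>t. (w (x + t *\<^sub>R axis i 1) - w x) / t) \<longlongrightarrow> g i x) (at 0)"
      by (simp add: has_field_derivative_iff)
    moreover have "filterlim (\<lambda>n. 1 / real (Suc n)) (at 0) sequentially"
      using LIMSEQ_inverse_real_of_nat by (auto simp: filterlim_at inverse_eq_divide)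
    ultimately have "(\<lambda>n. (w (x + (1 / real (Suc n)) *\<^sub>R axis i 1) - w x) / (1 / real (Suc n))) \<longlonglongrightarrow> g i x"
      by (rule filterlim_compose)
    then show ?thesis by (simp add: s_def)
  qed
  \<comment> \<open>The increments are at most 1: the quotients vanish outside radius
    \<open>R + 1\<close>, and the intermediate points of the mean value theorem stay within
    \<open>R + 2\<close>, where \<open>M\<close> is a bound.\<close>
  have bound: "norm (s n x) \<le> M * indicator (cball 0 (R + 1)) x" for n x
  proof -
    have p: "1 / real (Suc n) > 0" "1 / real (Suc n) \<le> 1" by auto
    show ?thesis
    proof (cases "norm x \<le> R + 1")
      case True
      obtain \<theta> where \<theta>: "0 < \<theta>" "\<theta> < 1 / real (Suc n)"
        "w (x + (1 / real (Suc n)) *\<^sub>R axis i 1) - w x = 1 / real (Suc n) * g i (x + \<theta> *\<^sub>R axis i 1)"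
        using has_partials_mvt[OF w p(1), of x i] by blast
      have "s n x = g i (x + \<theta> *\<^sub>R axis i 1)" unfolding s_def \<theta>(3) by simp
      moreover have "norm (x + \<theta> *\<^sub>R axis i 1) \<le> R + 2"
      proof -
        have "\<theta> \<le> 1" using \<theta>(2) p(2) by linarith
        then show ?thesis using norm_triangle_ineq[of x "\<theta> *\<^sub>R axis i 1"] \<theta>(1) True by simp
      qed
      ultimately show ?thesis using M True by simp
    next
      case False
      have "norm ((1 / real (Suc n)) *\<^sub>R axis i 1 :: real^'n) \<le> 1" using p by simp
      then have "norm (x + (1 / real (Suc n)) *\<^sub>R axis i 1) > R"
        using False norm_diff_ineq[of x "(1 / real (Suc n)) *\<^sub>R axis i 1"] by linarith
      then have "s n x = 0" using False by (simp add: s_def supp)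
      then show ?thesis using False by simp
    qed
  qed
  have "(\<lambda>n. \<integral>x. s n x \<partial>lborel) \<longlonglongrightarrow> (\<integral>x. g i x \<partial>lborel)"
  proof (rule integral_dominated_convergence)
    show "integrable lborel (\<lambda>x. M * indicator (cball 0 (R + 1)) x)"
      by (intro integrable_mult_right integrable_real_indicator)
        (use emeasure_compact_finite[OF compact_cball] in auto)
    show "s n \<in> borel_measurable lborel" for n unfolding s_def by measurable
  qed (use lim bound in auto)
  moreover have "(\<integral>x. s n x \<partial>lborel) = 0" for n
  proof -
    have "integrable lborel (\<lambda>x. w (x + (1 / real (Suc n)) *\<^sub>R axis i 1))"
    proof (rule integrable_continuous_support)
      show "continuous_on UNIV (\<lambda>x. w (x + (1 / real (Suc n)) *\<^sub>R axis i 1))"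
        by (intro continuous_on_compose2[OF wc] continuous_intros) auto
      have "norm ((1 / real (Suc n)) *\<^sub>R axis i 1 :: real^'n) \<le> 1" by simp
      then show "w (x + (1 / real (Suc n)) *\<^sub>R axis i 1) = 0" if "R + 1 < norm x" for x
        using that norm_diff_ineq[of x "(1 / real (Suc n)) *\<^sub>R axis i 1"] by (intro supp) linarith
    qed
    then show ?thesis using iw
      by (simp add: s_def Bochner_Integration.integral_diff integral_lborel_translate)
  qed
  ultimately have "(\<lambda>n. 0) \<longlonglongrightarrow> (\<integral>x. g i x \<partial>lborel)" by simp
  then show ?thesis by (simp add: LIMSEQ_const_iff)
qed

text \<open>Jensen's inequality for the fundamental theorem of calculus on a segment. The conclusion
  lives in \<open>ennreal\<close> so that Tonelli applies to it without integrability
  conditions.\<close>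

lemma difference_le_line_integral:
  fixes h :: "real^'n \<Rightarrow> real"
  assumes h: "has_partials h g" and g: "\<And>i. continuous_on UNIV (g i)"
  shows "ennreal ((h (x + z) - h x)\<^sup>2)
    \<le> (\<integral>\<^sup>+t. ennreal ((norm z)\<^sup>2 * (\<Sum>i\<in>UNIV. (g i (x + t *\<^sub>R z))\<^sup>2)) * indicator {0..1} t \<partial>lborel)"
proof -
  define \<psi> where "\<psi> t = (\<Sum>i\<in>UNIV. g i (x + t *\<^sub>R z) * z$i)" for t
  define k where "k t = (norm z)\<^sup>2 * (\<Sum>i\<in>UNIV. (g i (x + t *\<^sub>R z))\<^sup>2)" for t
  define c where "c = h (x + z) - h x"
  have gc: "continuous_on S (\<lambda>t. g i (x + t *\<^sub>R z))" for i S
    by (intro continuous_on_compose2[OF g] continuous_intros) auto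
  have \<psi>c: "continuous_on S \<psi>" and kc: "continuous_on S k" for S
    unfolding \<psi>_def k_def by (intro continuous_intros gc)+
  have "(\<psi> has_integral (h (x + 1 *\<^sub>R z) - h (x + 0 *\<^sub>R z))) {0..1}"
    by (rule fundamental_theorem_of_calculus)
      (auto simp: \<psi>_def has_real_derivative_iff_has_vector_derivative[symmetric]
        intro!: has_field_derivative_at_within has_partials_line[OF h])
  then have I\<psi>: "(\<psi> has_integral c) {0..1}" by (simp add: c_def)
  have I2: "((\<lambda>t. (\<psi> t)\<^sup>2) has_integral integral {0..1} (\<lambda>t. (\<psi> t)\<^sup>2)) {0..1}"
    by (intro integrable_integral integrable_continuous_interval continuous_intros \<psi>c)
  have Ik: "(k has_integral integral {0..1} k) {0..1}"
    by (intro integrable_integral integrable_continuous_interval kc)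
  \<comment> \<open>The mean of \<open>\<psi>\<close> is \<open>c\<close>; integrating the square of
    \<open>\<psi>\<close> - \<open>c\<close> bounds c^2 by the mean of the square.\<close>
  have "((\<lambda>t. (\<psi> t)\<^sup>2 - 2 * c * \<psi> t + c\<^sup>2) has_integral
      (integral {0..1} (\<lambda>t. (\<psi> t)\<^sup>2) - 2 * c * c + measure lborel {0..1::real} *\<^sub>R c\<^sup>2)) {0..1}"
    by (intro has_integral_add has_integral_diff I2 has_integral_mult_right I\<psi>
        has_integral_const_real)
  moreover have "(\<psi> t)\<^sup>2 - 2 * c * \<psi> t + c\<^sup>2 = (\<psi> t - c)\<^sup>2" for t
    by (simp add: power2_eq_square algebra_simps)
  ultimately have "0 \<le> integral {0..1} (\<lambda>t. (\<psi> t)\<^sup>2) - 2 * c * c + c\<^sup>2"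
    by (auto dest!: has_integral_nonneg)
  then have "c\<^sup>2 \<le> integral {0..1} (\<lambda>t. (\<psi> t)\<^sup>2)" by (simp add: power2_eq_square)
  also have "\<dots> \<le> integral {0..1} k"
  proof (rule has_integral_le[OF I2 Ik])
    fix t :: real
    have "(\<psi> t)\<^sup>2 \<le> (\<Sum>i\<in>UNIV. (g i (x + t *\<^sub>R z))\<^sup>2) * (\<Sum>i\<in>UNIV. (z$i)\<^sup>2)"
      unfolding \<psi>_def by (rule Cauchy_Schwarz_ineq_sum)
    also have "(\<Sum>i\<in>UNIV. (z$i)\<^sup>2) = (norm z)\<^sup>2"
      by (simp add: power2_norm_eq_inner inner_vec_def power2_eq_square[of "z$_"])
    finally show "(\<psi> t)\<^sup>2 \<le> k t" by (simp add: k_def mult.commute)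
  qed
  finally have "ennreal (c\<^sup>2) \<le> ennreal (integral {0..1} k)" by (rule ennreal_leI)
  also have "\<dots> = (\<integral>\<^sup>+t. ennreal (k t) * indicator {0..1} t \<partial>lborel)"
    by (rule nn_integral_has_integral_lebesgue'[symmetric, OF _ Ik]) (simp add: k_def sum_nonneg)
  finally show ?thesis by (simp add: c_def k_def)
qed

text \<open>The segment bound is integrated over the ball and the order exchanged: for every
  \<open>t\<close> in the unit interval the ball shifted by t z lies in the enlarged ball, so the
  integral over \<open>t\<close> costs nothing.\<close>

lemma translation_poincare:
  fixes h :: "real^'n \<Rightarrow> real"
  assumes h: "has_partials h g" and g: "\<And>i. continuous_on UNIV (g i)"
  shows "(\<integral>\<^sup>+x. ennreal ((h (x + z) - h x)\<^sup>2) * indicator (cball c r) x \<partial>lborel)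
    \<le> ennreal ((norm z)\<^sup>2) * (\<integral>\<^sup>+x. ennreal (\<Sum>i\<in>UNIV. (g i x)\<^sup>2) * indicator (cball c (r + norm z)) x \<partial>lborel)"
    (is "?L \<le> ?R")
proof -
  define k where "k x = (\<Sum>i\<in>UNIV. (g i x)\<^sup>2)" for x
  have k0: "k x \<ge> 0" for x by (simp add: k_def sum_nonneg)
  have [measurable]: "h \<in> borel_measurable borel" "\<And>i. g i \<in> borel_measurable borel"
    using has_partials_continuous[OF h] g by (auto intro: borel_measurable_continuous_onI)
  have [measurable]: "k \<in> borel_measurable borel" unfolding k_def by measurable
  have [measurable]: "cball c q \<in> sets borel" for q by simp
  define K where "K x = ennreal (k x) * indicator (cball c (r + norm z)) x" for x
  have [measurable]: "K \<in> borel_measurable borel" unfolding K_def by measurable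
  have "?L \<le> (\<integral>\<^sup>+x. (\<integral>\<^sup>+t. ennreal ((norm z)\<^sup>2 * k (x + t *\<^sub>R z)) * indicator {0..1::real} t \<partial>lborel)
      * indicator (cball c r) x \<partial>lborel)"
    unfolding k_def
    by (intro nn_integral_mono mult_right_mono difference_le_line_integral[OF h g]) auto
  also have "\<dots> = (\<integral>\<^sup>+x. (\<integral>\<^sup>+t. ennreal ((norm z)\<^sup>2 * k (x + t *\<^sub>R z)) * indicator {0..1::real} t
      * indicator (cball c r) x \<partial>lborel) \<partial>lborel)"
    by (intro nn_integral_cong nn_integral_multc[symmetric]) measurable
  also have "\<dots> = (\<integral>\<^sup>+t. (\<integral>\<^sup>+x. ennreal ((norm z)\<^sup>2 * k (x + t *\<^sub>R z)) * indicator {0..1::real} t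
      * indicator (cball c r) x \<partial>lborel) \<partial>lborel)"
    by (rule lborel_pair.Fubini'[symmetric]) measurable
  also have "\<dots> \<le> (\<integral>\<^sup>+t. (\<integral>\<^sup>+x. (ennreal ((norm z)\<^sup>2) * indicator {0..1::real} t) * K (x + t *\<^sub>R z) \<partial>lborel) \<partial>lborel)"
  proof (intro nn_integral_mono)
    fix t x
    show "ennreal ((norm z)\<^sup>2 * k (x + t *\<^sub>R z)) * indicator {0..1::real} t * indicator (cball c r) x
      \<le> (ennreal ((norm z)\<^sup>2) * indicator {0..1::real} t) * K (x + t *\<^sub>R z)"
    proof (cases "t \<in> {0..1::real} \<and> x \<in> cball c r")
      case True
      have "norm (t *\<^sub>R z) \<le> norm z" using True by (auto simp: mult_left_le_one_le)
      moreover have "dist c (x + t *\<^sub>R z) \<le> dist c x + norm (t *\<^sub>R z)"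
        using dist_triangle[of c "x + t *\<^sub>R z" x] by (simp add: dist_norm)
      ultimately have "x + t *\<^sub>R z \<in> cball c (r + norm z)" using True by auto
      then show ?thesis using True k0 by (simp add: K_def ennreal_mult)
    qed (auto simp: indicator_def)
  qed
  also have "\<dots> = (\<integral>\<^sup>+t. (ennreal ((norm z)\<^sup>2) * indicator {0..1::real} t) * (\<integral>\<^sup>+x. K x \<partial>lborel) \<partial>lborel)"
  proof (rule nn_integral_cong)
    fix t :: real
    have "(\<integral>\<^sup>+x. a * K (x + t *\<^sub>R z) \<partial>lborel) = a * (\<integral>\<^sup>+x. K (x + t *\<^sub>R z) \<partial>lborel)" for a
      by (rule nn_integral_cmult) measurable
    then show "(\<integral>\<^sup>+x. (ennreal ((norm z)\<^sup>2) * indicator {0..1::real} t) * K (x + t *\<^sub>R z) \<partial>lborel)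
        = (ennreal ((norm z)\<^sup>2) * indicator {0..1::real} t) * (\<integral>\<^sup>+x. K x \<partial>lborel)"
      by (simp add: nn_integral_lborel_translate)
  qed
  also have "\<dots> = ennreal ((norm z)\<^sup>2) * (\<integral>\<^sup>+x. K x \<partial>lborel)"
    by (simp add: nn_integral_multc nn_integral_cmult mult_ac)
  finally show ?thesis by (simp add: K_def k_def)
qed

section \<open>The linearised operator\<close>

text \<open>This is F (I + H^2) = V I as an identity of quadratic forms, for H with diagonal
  \<open>a\<close>, \<open>b\<close>, \<open>c\<close> and off-diagonal entries \<open>d\<close>,
  \<open>e\<close>, \<open>g\<close>. On eigenvalues, sigma_2 = 1 gives 1 + lambda_1^2 = (lambda_1 +
  lambda_2) (lambda_1 + lambda_3), and the product of the three pairwise sums is sigma_1 sigma_2 -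
  sigma_3.\<close>

lemma sigma2_cofactor_identity:
  fixes a b c d e g x y z :: real
  defines "f \<equiv> a + b + c"
    and "q \<equiv> \<lambda>x y z. (a + b + c) * (x\<^sup>2 + y\<^sup>2 + z\<^sup>2)
      - (a * x\<^sup>2 + b * y\<^sup>2 + c * z\<^sup>2 + 2 * d * x * y + 2 * e * x * z + 2 * g * y * z)"
  assumes sig: "a * b + a * c + b * c - d\<^sup>2 - e\<^sup>2 - g\<^sup>2 = 1"
  shows "q x y z + q (a * x + d * y + e * z) (d * x + b * y + g * z) (e * x + g * y + c * z)
    = (f - (a * (b * c - g\<^sup>2) - d * (d * c - g * e) + e * (d * g - b * e))) * (x\<^sup>2 + y\<^sup>2 + z\<^sup>2)"
  using sig unfolding f_def q_def by algebra

text \<open>The mixed terms of q (v + H w) and q (H v - w) cancel because F commutes with H.\<close>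

lemma cofactor_rotation_identity:
  fixes a b c d e g x y z x' y' z' :: real
  defines "q \<equiv> \<lambda>x y z. (a + b + c) * (x\<^sup>2 + y\<^sup>2 + z\<^sup>2)
      - (a * x\<^sup>2 + b * y\<^sup>2 + c * z\<^sup>2 + 2 * d * x * y + 2 * e * x * z + 2 * g * y * z)"
  shows "q (x + (a * x' + d * y' + e * z')) (y + (d * x' + b * y' + g * z')) (z + (e * x' + g * y' + c * z'))
     + q ((a * x + d * y + e * z) - x') ((d * x + b * y + g * z) - y') ((e * x + g * y + c * z) - z')
    = q x y z + q (a * x + d * y + e * z) (d * x + b * y + g * z) (e * x + g * y + c * z)
     + q x' y' z' + q (a * x' + d * y' + e * z') (d * x' + b * y' + g * z') (e * x' + g * y' + c * z')"
  unfolding q_def by algebra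

lemma sum_pick:
  fixes g :: "'n::finite \<Rightarrow> real"
  shows "(\<Sum>i\<in>UNIV. g i * of_bool (i = k)) = g k" "(\<Sum>i\<in>UNIV. of_bool (i = k) * g i) = g k"
    "(\<Sum>i\<in>UNIV. of_bool (k = i) * g i) = g k" "(\<Sum>i\<in>UNIV. (of_bool (i = k))\<^sup>2 :: real) = 1"
  by (simp_all add: of_bool_def if_distrib if_distribR cong: if_cong)

lemma has_partials_constD:
  fixes c :: real
  assumes "has_partials (\<lambda>x. c) g"
  shows "g i x = 0"
  using has_partials_unique[OF assms has_partials_const] .

text \<open>The last index is always the most recent differentiation: \<open>h i j\<close> is the
  j-th partial of \<open>p i\<close>, and so on. \<open>sigma2\<close> is the equation in the form 2
  sigma_2 = (trace)^2 - (Frobenius norm)^2. Continuity below order four follows from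
  differentiability, and the symmetries of \<open>t\<close> and \<open>q\<close> are
  derived.\<close>

locale sigma2_solution =
  fixes u :: "real^3 \<Rightarrow> real" and p :: "3 \<Rightarrow> real^3 \<Rightarrow> real" and h :: "3 \<Rightarrow> 3 \<Rightarrow> real^3 \<Rightarrow> real"
    and t :: "3 \<Rightarrow> 3 \<Rightarrow> 3 \<Rightarrow> real^3 \<Rightarrow> real" and q :: "3 \<Rightarrow> 3 \<Rightarrow> 3 \<Rightarrow> 3 \<Rightarrow> real^3 \<Rightarrow> real"
  assumes du: "has_partials u p"
    and dp: "\<And>i. has_partials (p i) (h i)"
    and dh: "\<And>i j. has_partials (h i j) (t i j)"
    and dt: "\<And>i j k. has_partials (t i j k) (q i j k)"
    and q_continuous: "\<And>i j k l. continuous_on UNIV (q i j k l)"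
    and h_sym: "\<And>i j x. h i j x = h j i x"
    and h_diag: "\<And>x. \<exists>P lam. orthogonal_matrix P \<and> (\<forall>i j. h i j x = (\<Sum>a\<in>UNIV. P$i$a * lam$a * P$j$a))"
    and sigma2: "\<And>x. (\<Sum>i\<in>UNIV. h i i x)\<^sup>2 - (\<Sum>i\<in>UNIV. \<Sum>j\<in>UNIV. (h i j x)\<^sup>2) = 2"
    and trace_pos: "\<And>x. 0 < (\<Sum>i\<in>UNIV. h i i x)"
begin

definition f :: "real^3 \<Rightarrow> real" where "f x = (\<Sum>i\<in>UNIV. h i i x)"
definition tau :: "3 \<Rightarrow> real^3 \<Rightarrow> real" where "tau k x = (\<Sum>i\<in>UNIV. t i i k x)"
definition theta :: "3 \<Rightarrow> 3 \<Rightarrow> real^3 \<Rightarrow> real" where "theta k l x = (\<Sum>i\<in>UNIV. q i i k l x)"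
definition F :: "3 \<Rightarrow> 3 \<Rightarrow> real^3 \<Rightarrow> real" where "F i j x = of_bool (i = j) * f x - h i j x"
text \<open>The argument is a matrix field, not a function: usually the family of second partials of
  a function, but rank-one fields and constant matrices occur as well.\<close>

definition L :: "(3 \<Rightarrow> 3 \<Rightarrow> real^3 \<Rightarrow> real) \<Rightarrow> real^3 \<Rightarrow> real" where
  "L A x = (\<Sum>i\<in>UNIV. \<Sum>j\<in>UNIV. F i j x * A i j x)"
text \<open>The quadratic source term of the twice differentiated equation, so that L (u_kl) =
  \<open>N k l\<close>.\<close>

definition N :: "3 \<Rightarrow> 3 \<Rightarrow> real^3 \<Rightarrow> real" where
  "N k l x = (\<Sum>i\<in>UNIV. \<Sum>j\<in>UNIV. t i j k x * t i j l x) - tau k x * tau l x"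
definition T2 :: "real^3 \<Rightarrow> real" where
  "T2 x = (\<Sum>i\<in>UNIV. \<Sum>j\<in>UNIV. \<Sum>k\<in>UNIV. (t i j k x)\<^sup>2)"
text \<open>This is sigma_1 - sigma_3 of the Hessian, the volume density of the gradient
  graph.\<close>

definition V :: "real^3 \<Rightarrow> real" where
  "V x = f x - (h 1 1 x * (h 2 2 x * h 3 3 x - (h 2 3 x)\<^sup>2) - h 1 2 x * (h 1 2 x * h 3 3 x - h 2 3 x * h 1 3 x)
    + h 1 3 x * (h 1 2 x * h 2 3 x - h 2 2 x * h 1 3 x))"

lemma df: "has_partials f tau"
  unfolding f_def[abs_def] tau_def[abs_def] by (intro has_partials_sum dh)

lemma dtau: "has_partials (tau k) (theta k)"
  unfolding theta_def[abs_def] tau_def[abs_def] by (intro has_partials_sum dt)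

lemma p_continuous: "continuous_on S (p i)" and h_continuous: "continuous_on S (h i j)"
  and t_continuous: "continuous_on S (t i j k)" and f_continuous: "continuous_on S f"
  and tau_continuous: "continuous_on S (tau i)" and u_continuous: "continuous_on S u"
  using continuous_on_subset[OF has_partials_continuous] du dp dh dt df dtau by (metis subset_UNIV)+

lemma q_continuous': "continuous_on S (q i j k l)"
  using continuous_on_subset[OF q_continuous] by blast

lemma theta_continuous: "continuous_on S (theta k l)"
  unfolding theta_def by (intro continuous_intros q_continuous')

lemma F_continuous: "continuous_on S (F i j)"
  unfolding F_def by (intro continuous_intros h_continuous f_continuous)

lemma T2_continuous: "continuous_on S T2"
  unfolding T2_def[abs_def] by (intro continuous_intros t_continuous)

lemma V_continuous: "continuous_on S V"
  unfolding V_def[abs_def] by (intro continuous_intros h_continuous f_continuous)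

lemma L_continuous: "(\<And>i j. continuous_on S (A i j)) \<Longrightarrow> continuous_on S (L A)"
  unfolding L_def[abs_def] by (intro continuous_intros F_continuous)

lemma f_pos: "0 < f x"
  using trace_pos by (simp add: f_def)

lemma h_norm: "(\<Sum>i\<in>UNIV. \<Sum>j\<in>UNIV. (h i j x)\<^sup>2) = (f x)\<^sup>2 - 2"
  using sigma2[of x] by (simp add: f_def)

lemma t_sym1: "t i j k x = t j i k x"
proof -
  have "h i j = h j i" using h_sym by auto
  then show ?thesis using has_partials_unique dh by metis
qed

lemma t_sym2: "t i j k x = t i k j x"
  by (rule mixed_partials_commute[OF dp dh t_continuous])

text \<open>Four adjacent transpositions exchange the index pairs; the first two kinds are inherited
  from \<open>t\<close>, the third is Schwarz's theorem. Thus the second derivatives of an entry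
  \<open>h k l\<close> are what occurs when the equation is differentiated in directions
  \<open>k\<close> and \<open>l\<close>.\<close>

lemma q_sym: "q k l i j x = q i j k l x"
proof -
  have 1: "q i j k l x = q j i k l x" for i j k l
  proof -
    have "t i j k = t j i k" using t_sym1 by auto
    then show ?thesis using has_partials_unique dt by metis
  qed
  have 2: "q i j k l x = q i k j l x" for i j k l
  proof -
    have "t i j k = t i k j" using t_sym2 by auto
    then show ?thesis using has_partials_unique dt by metis
  qed
  have 3: "q i j k l x = q i j l k x" for i j k l
    by (rule mixed_partials_commute[OF dh dt q_continuous])
  have "q k l i j x = q k i l j x" by (rule 2)
  also have "\<dots> = q i k l j x" by (rule 1)
  also have "\<dots> = q i k j l x" by (rule 3)
  also have "\<dots> = q i j k l x" by (rule 2)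
  finally show ?thesis .
qed

section \<open>The equation differentiated once and twice\<close>

lemma first_derivative_eq: "f x * tau k x = (\<Sum>i\<in>UNIV. \<Sum>j\<in>UNIV. h i j x * t i j k x)"
proof -
  have A: "has_partials (\<lambda>x. f x * f x - (\<Sum>i\<in>UNIV. \<Sum>j\<in>UNIV. h i j x * h i j x))
     (\<lambda>k x. (tau k x * f x + f x * tau k x) - (\<Sum>i\<in>UNIV. \<Sum>j\<in>UNIV. t i j k x * h i j x + h i j x * t i j k x))"
    by (intro has_partials_diff has_partials_mult has_partials_sum df dh)
  have B: "(\<lambda>x. f x * f x - (\<Sum>i\<in>UNIV. \<Sum>j\<in>UNIV. h i j x * h i j x)) = (\<lambda>x. 2)"
    using h_norm by (simp add: power2_eq_square)
  have "(tau k x * f x + f x * tau k x) - (\<Sum>i\<in>UNIV. \<Sum>j\<in>UNIV. t i j k x * h i j x + h i j x * t i j k x) = 0"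
    by (rule has_partials_constD[OF A[unfolded B]])
  moreover have "(\<Sum>i\<in>UNIV. \<Sum>j\<in>UNIV. t i j k x * h i j x + h i j x * t i j k x)
    = 2 * (\<Sum>i\<in>UNIV. \<Sum>j\<in>UNIV. h i j x * t i j k x)"
    by (simp add: sum_distrib_left mult.commute)
  ultimately show ?thesis by simp
qed

lemma second_derivative_eq:
  "f x * theta k l x - (\<Sum>i\<in>UNIV. \<Sum>j\<in>UNIV. h i j x * q i j k l x) = N k l x"
proof -
  have A: "has_partials (\<lambda>x. f x * tau k x - (\<Sum>i\<in>UNIV. \<Sum>j\<in>UNIV. h i j x * t i j k x))
     (\<lambda>l x. (tau l x * tau k x + f x * theta k l x)
      - (\<Sum>i\<in>UNIV. \<Sum>j\<in>UNIV. t i j l x * t i j k x + h i j x * q i j k l x))"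
    by (intro has_partials_diff has_partials_mult has_partials_sum df dh dt dtau)
  have B: "(\<lambda>x. f x * tau k x - (\<Sum>i\<in>UNIV. \<Sum>j\<in>UNIV. h i j x * t i j k x)) = (\<lambda>x. 0)"
    using first_derivative_eq by simp
  have "(tau l x * tau k x + f x * theta k l x)
      - (\<Sum>i\<in>UNIV. \<Sum>j\<in>UNIV. t i j l x * t i j k x + h i j x * q i j k l x) = 0"
    by (rule has_partials_constD[OF A[unfolded B]])
  then show ?thesis by (simp add: N_def sum.distrib mult_ac)
qed

lemma L_eq: "L A x = f x * (\<Sum>i\<in>UNIV. A i i x) - (\<Sum>i\<in>UNIV. \<Sum>j\<in>UNIV. h i j x * A i j x)"
  by (simp add: L_def F_def left_diff_distrib sum_subtractf mult.assoc sum_pick sum_distrib_left)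

lemma L_h: "L (\<lambda>i j. q k l i j) x = N k l x"
proof -
  have "L (\<lambda>i j. q k l i j) x = f x * theta k l x - (\<Sum>i\<in>UNIV. \<Sum>j\<in>UNIV. h i j x * q i j k l x)"
    unfolding L_eq theta_def by (simp add: q_sym[of k l])
  then show ?thesis by (simp add: second_derivative_eq)
qed

lemma L_f: "L theta x = (\<Sum>k\<in>UNIV. N k k x)"
proof -
  have "L theta x = (\<Sum>i\<in>UNIV. \<Sum>j\<in>UNIV. \<Sum>k\<in>UNIV. F i j x * q k k i j x)"
    by (simp add: L_def theta_def sum_distrib_left)
  also have "\<dots> = (\<Sum>k\<in>UNIV. L (\<lambda>i j. q k k i j) x)"
    unfolding L_def by (subst (2) sum.swap, subst sum.swap) (rule refl)
  finally show ?thesis by (simp add: L_h)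
qed

lemma N_form:
  "(\<Sum>k\<in>UNIV. \<Sum>l\<in>UNIV. N k l x * v k * v l)
    = (\<Sum>i\<in>UNIV. \<Sum>j\<in>UNIV. (\<Sum>k\<in>UNIV. t i j k x * v k)\<^sup>2) - (\<Sum>k\<in>UNIV. tau k x * v k)\<^sup>2"
proof -
  have "(\<Sum>i\<in>UNIV. \<Sum>j\<in>UNIV. (\<Sum>k\<in>UNIV. t i j k x * v k)\<^sup>2)
    = (\<Sum>i\<in>UNIV. \<Sum>j\<in>UNIV. \<Sum>k\<in>UNIV. \<Sum>l\<in>UNIV. t i j k x * t i j l x * v k * v l)"
    by (simp add: power2_eq_square sum_product mult_ac)
  also have "\<dots> = (\<Sum>k\<in>UNIV. \<Sum>l\<in>UNIV. \<Sum>i\<in>UNIV. \<Sum>j\<in>UNIV. t i j k x * t i j l x * v k * v l)"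
    by (subst (2) sum.swap, subst (3) sum.swap, subst sum.swap, subst (2) sum.swap) (rule refl)
  finally have 1: "(\<Sum>i\<in>UNIV. \<Sum>j\<in>UNIV. (\<Sum>k\<in>UNIV. t i j k x * v k)\<^sup>2)
    = (\<Sum>k\<in>UNIV. \<Sum>l\<in>UNIV. (\<Sum>i\<in>UNIV. \<Sum>j\<in>UNIV. t i j k x * t i j l x) * v k * v l)"
    by (simp add: sum_distrib_right)
  have 2: "(\<Sum>k\<in>UNIV. tau k x * v k)\<^sup>2 = (\<Sum>k\<in>UNIV. \<Sum>l\<in>UNIV. tau k x * tau l x * v k * v l)"
    by (simp add: power2_eq_square sum_product mult_ac)
  show ?thesis
    unfolding 1 2 N_def by (simp add: left_diff_distrib sum_subtractf)
qed

text \<open>The linearised equation says that the directional derivative of the Hessian is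
  orthogonal to \<open>F\<close> for the Lorentzian form of \<open>\<sigma>\<^sub>2\<close>; as \<open>F\<close> is timelike, it is spacelike.\<close>
lemma N_form_ge:
  "2 / (f x)\<^sup>2 * (\<Sum>i\<in>UNIV. \<Sum>j\<in>UNIV. (\<Sum>k\<in>UNIV. t i j k x * v k)\<^sup>2)
    \<le> (\<Sum>k\<in>UNIV. \<Sum>l\<in>UNIV. N k l x * v k * v l)"
proof -
  define B where "B i j = (\<Sum>k\<in>UNIV. t i j k x * v k)" for i j
  define b where "b = (\<Sum>k\<in>UNIV. tau k x * v k)"
  have "f x * b = (\<Sum>k\<in>UNIV. (f x * tau k x) * v k)"
    by (simp add: b_def sum_distrib_left mult_ac)
  also have "\<dots> = (\<Sum>k\<in>UNIV. \<Sum>i\<in>UNIV. \<Sum>j\<in>UNIV. h i j x * t i j k x * v k)"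
    by (simp add: first_derivative_eq sum_distrib_right)
  also have "\<dots> = (\<Sum>i\<in>UNIV. \<Sum>j\<in>UNIV. h i j x * B i j)"
    unfolding B_def sum_distrib_left
    by (subst sum.swap, subst (2) sum.swap) (simp add: mult_ac)
  finally have "(f x * b)\<^sup>2 \<le> ((f x)\<^sup>2 - 2) * (\<Sum>i\<in>UNIV. \<Sum>j\<in>UNIV. (B i j)\<^sup>2)"
    using Cauchy_Schwarz_double_sum[of "\<lambda>i j. h i j x" B] by (simp add: h_norm)
  then have "b\<^sup>2 * (f x)\<^sup>2 \<le> ((f x)\<^sup>2 - 2) * (\<Sum>i\<in>UNIV. \<Sum>j\<in>UNIV. (B i j)\<^sup>2)"
    by (simp add: power_mult_distrib mult.commute)
  then have "b\<^sup>2 \<le> ((f x)\<^sup>2 - 2) * (\<Sum>i\<in>UNIV. \<Sum>j\<in>UNIV. (B i j)\<^sup>2) / (f x)\<^sup>2"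
    using f_pos[of x] by (simp add: pos_le_divide_eq)
  also have "\<dots> = (\<Sum>i\<in>UNIV. \<Sum>j\<in>UNIV. (B i j)\<^sup>2) - 2 / (f x)\<^sup>2 * (\<Sum>i\<in>UNIV. \<Sum>j\<in>UNIV. (B i j)\<^sup>2)"
    using f_pos[of x] by (simp add: field_simps)
  finally show ?thesis unfolding N_form B_def[symmetric] b_def[symmetric] by simp
qed

lemma N_psd: "0 \<le> (\<Sum>k\<in>UNIV. \<Sum>l\<in>UNIV. N k l x * v k * v l)"
  by (rule order_trans[OF _ N_form_ge]) (simp add: sum_nonneg)

lemma N_sym: "N k l x = N l k x"
  by (simp add: N_def mult.commute)

lemma T2_le_L_f: "2 / (f x)\<^sup>2 * T2 x \<le> L theta x"
proof -
  have "2 / (f x)\<^sup>2 * (\<Sum>i\<in>UNIV. \<Sum>j\<in>UNIV. (t i j k x)\<^sup>2) \<le> N k k x" for k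
    using N_form_ge[of x "\<lambda>i. of_bool (i = k)"]
    by (simp only: sum_pick)
  then have "(\<Sum>k\<in>UNIV. 2 / (f x)\<^sup>2 * (\<Sum>i\<in>UNIV. \<Sum>j\<in>UNIV. (t i j k x)\<^sup>2)) \<le> (\<Sum>k\<in>UNIV. N k k x)"
    by (intro sum_mono)
  moreover have "T2 x = (\<Sum>k\<in>UNIV. \<Sum>i\<in>UNIV. \<Sum>j\<in>UNIV. (t i j k x)\<^sup>2)"
    unfolding T2_def by (subst (2) sum.swap, subst sum.swap) (rule refl)
  ultimately show ?thesis by (simp add: L_f sum_distrib_left)
qed

lemma T2_nonneg: "0 \<le> T2 x"
  by (simp add: T2_def sum_nonneg)

lemma trace_N: "L theta x = T2 x - (\<Sum>k\<in>UNIV. (tau k x)\<^sup>2)"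
proof -
  have "T2 x = (\<Sum>k\<in>UNIV. \<Sum>i\<in>UNIV. \<Sum>j\<in>UNIV. (t i j k x)\<^sup>2)"
    unfolding T2_def by (subst (2) sum.swap, subst sum.swap) (rule refl)
  then show ?thesis by (simp add: L_f N_def sum_subtractf power2_eq_square)
qed

section \<open>Ellipticity and the induced metric\<close>

definition Fq :: "real^3 \<Rightarrow> (3 \<Rightarrow> real) \<Rightarrow> real" where
  "Fq x v = f x * (\<Sum>i\<in>UNIV. (v i)\<^sup>2) - (\<Sum>i\<in>UNIV. \<Sum>j\<in>UNIV. h i j x * (v i * v j))"

lemma Fq_eq: "Fq x v = (\<Sum>i\<in>UNIV. \<Sum>j\<in>UNIV. F i j x * (v i * v j))"
  using L_eq[of "\<lambda>i j x. v i * v j" x] by (simp add: Fq_def L_def power2_eq_square)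

lemma h_form_le:
  "\<bar>\<Sum>i\<in>UNIV. \<Sum>j\<in>UNIV. h i j x * (v i * v j)\<bar> \<le> sqrt ((f x)\<^sup>2 - 2) * (\<Sum>i\<in>UNIV. (v i)\<^sup>2)"
proof -
  have "(\<Sum>i\<in>UNIV. \<Sum>j\<in>UNIV. h i j x * (v i * v j))\<^sup>2
     \<le> ((f x)\<^sup>2 - 2) * (\<Sum>i\<in>UNIV. (v i)\<^sup>2)\<^sup>2"
    using Cauchy_Schwarz_double_sum[of "\<lambda>i j. h i j x" "\<lambda>i j. v i * v j"]
    by (simp add: h_norm power2_eq_square[of "sum _ _"] sum_product power_mult_distrib)
  then have "sqrt ((\<Sum>i\<in>UNIV. \<Sum>j\<in>UNIV. h i j x * (v i * v j))\<^sup>2)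
     \<le> sqrt (((f x)\<^sup>2 - 2) * (\<Sum>i\<in>UNIV. (v i)\<^sup>2)\<^sup>2)" by (rule real_sqrt_le_mono)
  then show ?thesis by (simp add: real_sqrt_mult sum_nonneg)
qed

lemma f_sq_ge: "2 \<le> (f x)\<^sup>2"
  using h_norm[of x] sum_nonneg[of UNIV "\<lambda>i. \<Sum>j\<in>UNIV. (h i j x)\<^sup>2"] by (simp add: sum_nonneg)

text \<open>The square of f - 1/f is f^2 - 2 + 1/f^2. Since sqrt (f^2 - 2) is the Frobenius norm of
  the Hessian, the gap 1/f becomes the lower ellipticity constant of \<open>F\<close>.\<close>

lemma sqrt_f_bound: "sqrt ((f x)\<^sup>2 - 2) \<le> f x - 1 / f x"
proof (rule real_le_lsqrt)
  have "1 \<le> (f x)\<^sup>2" using f_sq_ge[of x] by simp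
  then show "0 \<le> f x - 1 / f x" using f_pos[of x] by (simp add: field_simps power2_eq_square)
  show "(f x)\<^sup>2 - 2 \<le> (f x - 1 / f x)\<^sup>2" using f_pos[of x]
    by (simp add: power2_diff)
qed

lemma Fq_ge: "(1 / f x) * (\<Sum>i\<in>UNIV. (v i)\<^sup>2) \<le> Fq x v"
proof -
  have "(\<Sum>i\<in>UNIV. \<Sum>j\<in>UNIV. h i j x * (v i * v j)) \<le> sqrt ((f x)\<^sup>2 - 2) * (\<Sum>i\<in>UNIV. (v i)\<^sup>2)"
    using h_form_le[of x v] by linarith
  also have "\<dots> \<le> (f x - 1 / f x) * (\<Sum>i\<in>UNIV. (v i)\<^sup>2)"
    by (intro mult_right_mono sqrt_f_bound sum_nonneg) auto
  finally show ?thesis by (simp add: Fq_def algebra_simps)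
qed

lemma Fq_nonneg: "0 \<le> Fq x v"
  by (rule order_trans[OF _ Fq_ge]) (use f_pos[of x] in \<open>simp add: sum_nonneg\<close>)

lemma Fq_le: "Fq x v \<le> 2 * f x * (\<Sum>i\<in>UNIV. (v i)\<^sup>2)"
proof -
  have "- (\<Sum>i\<in>UNIV. \<Sum>j\<in>UNIV. h i j x * (v i * v j)) \<le> sqrt ((f x)\<^sup>2 - 2) * (\<Sum>i\<in>UNIV. (v i)\<^sup>2)"
    using h_form_le[of x v] by linarith
  also have "\<dots> \<le> f x * (\<Sum>i\<in>UNIV. (v i)\<^sup>2)"
  proof (rule mult_right_mono)
    have "0 < 1 / f x" using f_pos[of x] by simp
    then show "sqrt ((f x)\<^sup>2 - 2) \<le> f x" using sqrt_f_bound[of x] by linarith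
  qed (simp add: sum_nonneg)
  finally show ?thesis by (simp add: Fq_def algebra_simps)
qed

lemma Fq_cofactor:
  "Fq x v + Fq x (\<lambda>i. \<Sum>j\<in>UNIV. h i j x * v j) = V x * (\<Sum>i\<in>UNIV. (v i)\<^sup>2)"
proof -
  have s: "h 2 1 x = h 1 2 x" "h 3 1 x = h 1 3 x" "h 3 2 x = h 2 3 x" by (simp_all add: h_sym)
  have sig: "h 1 1 x * h 2 2 x + h 1 1 x * h 3 3 x + h 2 2 x * h 3 3 x - (h 1 2 x)\<^sup>2 - (h 1 3 x)\<^sup>2 - (h 2 3 x)\<^sup>2 = 1"
    using sigma2[of x] by (simp add: sum_3 s power2_eq_square algebra_simps)
  have Fq3: "Fq x v = (h 1 1 x + h 2 2 x + h 3 3 x) * ((v 1)\<^sup>2 + (v 2)\<^sup>2 + (v 3)\<^sup>2)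
      - (h 1 1 x * (v 1)\<^sup>2 + h 2 2 x * (v 2)\<^sup>2 + h 3 3 x * (v 3)\<^sup>2
        + 2 * h 1 2 x * v 1 * v 2 + 2 * h 1 3 x * v 1 * v 3 + 2 * h 2 3 x * v 2 * v 3)" for v
    by (simp add: Fq_def f_def sum_3 s power2_eq_square)
  show ?thesis
    unfolding Fq3 V_def f_def sum_3 s by (rule sigma2_cofactor_identity[OF sig])
qed

text \<open>Pythagoras on the gradient graph: for the extrinsic vector (v, w), the argument v + H w
  is its tangential part as a covector, and the discarded term with H v - w is its normal
  part.\<close>

lemma Fq_gradient_le:
  "Fq x (\<lambda>i. v i + (\<Sum>j\<in>UNIV. h i j x * w j)) \<le> V x * ((\<Sum>i\<in>UNIV. (v i)\<^sup>2) + (\<Sum>i\<in>UNIV. (w i)\<^sup>2))"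
proof -
  have s: "h 2 1 x = h 1 2 x" "h 3 1 x = h 1 3 x" "h 3 2 x = h 2 3 x" by (simp_all add: h_sym)
  have Fq3: "Fq x v = (h 1 1 x + h 2 2 x + h 3 3 x) * ((v 1)\<^sup>2 + (v 2)\<^sup>2 + (v 3)\<^sup>2)
      - (h 1 1 x * (v 1)\<^sup>2 + h 2 2 x * (v 2)\<^sup>2 + h 3 3 x * (v 3)\<^sup>2
        + 2 * h 1 2 x * v 1 * v 2 + 2 * h 1 3 x * v 1 * v 3 + 2 * h 2 3 x * v 2 * v 3)" for v
    by (simp add: Fq_def f_def sum_3 s power2_eq_square)
  have "Fq x (\<lambda>i. v i + (\<Sum>j\<in>UNIV. h i j x * w j)) + Fq x (\<lambda>i. (\<Sum>j\<in>UNIV. h i j x * v j) - w i)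
    = Fq x v + Fq x (\<lambda>i. \<Sum>j\<in>UNIV. h i j x * v j) + Fq x w + Fq x (\<lambda>i. \<Sum>j\<in>UNIV. h i j x * w j)"
    unfolding Fq3 sum_3 s by (rule cofactor_rotation_identity)
  also have "\<dots> = V x * ((\<Sum>i\<in>UNIV. (v i)\<^sup>2) + (\<Sum>i\<in>UNIV. (w i)\<^sup>2))"
    using Fq_cofactor[of x v] Fq_cofactor[of x w] by (simp add: distrib_left)
  finally show ?thesis using Fq_nonneg[of x "\<lambda>i. (\<Sum>j\<in>UNIV. h i j x * v j) - w i"] by linarith
qed

text \<open>The trace of F (I + H^2) = V I, with 3 the dimension. It is what makes the Laplacian of
  the squared extrinsic distance constant.\<close>

lemma trace_cofactor:
  "(\<Sum>i\<in>UNIV. F i i x) + (\<Sum>i\<in>UNIV. \<Sum>j\<in>UNIV. \<Sum>k\<in>UNIV. F j k x * (h i j x * h i k x)) = 3 * V x"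
proof -
  have a: "Fq x (\<lambda>i. of_bool (i = k)) = F k k x" for k
    unfolding Fq_eq mult.assoc[symmetric] by (simp only: sum_pick)
  have b: "Fq x (\<lambda>i. \<Sum>j\<in>UNIV. h i j x * of_bool (j = k)) = (\<Sum>i\<in>UNIV. \<Sum>j\<in>UNIV. F i j x * (h k i x * h k j x))" for k
    unfolding Fq_eq sum_pick by (simp only: h_sym[of _ k])
  have "F k k x + (\<Sum>i\<in>UNIV. \<Sum>j\<in>UNIV. F i j x * (h k i x * h k j x)) = V x" for k
    using Fq_cofactor[of x "\<lambda>i. of_bool (i = k)"] unfolding a b unfolding sum_pick by simp
  then have "(\<Sum>k\<in>UNIV. F k k x + (\<Sum>i\<in>UNIV. \<Sum>j\<in>UNIV. F i j x * (h k i x * h k j x))) = (\<Sum>k\<in>(UNIV::3 set). V x)"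
    by simp
  then show ?thesis by (simp add: sum.distrib)
qed

lemma V_ge: "1 / f x \<le> V x"
proof -
  define v :: "3 \<Rightarrow> real" where "v i = of_bool (i = 1)" for i
  have v: "(\<Sum>i\<in>UNIV. (v i)\<^sup>2) = 1" by (simp add: v_def sum_3)
  show ?thesis
    using Fq_cofactor[of x v] Fq_ge[of x v] Fq_nonneg[of x "\<lambda>i. \<Sum>j\<in>UNIV. h i j x * v j"]
    by (simp add: v)
qed

lemma V_pos: "0 < V x"
  using V_ge[of x] f_pos[of x] by (auto intro: less_le_trans[of _ "1 / f x"])

lemma h_entry_le: "\<bar>h i j x\<bar> \<le> f x"
proof -
  have "(h i j x)\<^sup>2 \<le> (\<Sum>j\<in>UNIV. (h i j x)\<^sup>2)" by (rule member_le_sum) auto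
  also have "\<dots> \<le> (\<Sum>i\<in>UNIV. \<Sum>j\<in>UNIV. (h i j x)\<^sup>2)"
    by (rule member_le_sum[of i UNIV "\<lambda>i. \<Sum>j\<in>UNIV. (h i j x)\<^sup>2"]) (auto intro: sum_nonneg)
  also have "\<dots> \<le> (f x)\<^sup>2" by (simp add: h_norm)
  finally show ?thesis using f_pos[of x] by (simp add: abs_le_square_iff[symmetric])
qed

lemma V_le: "V x \<le> f x + 6 * (f x)^3"
proof -
  define v :: "3 \<Rightarrow> real" where "v i = of_bool (i = 1)" for i
  have v: "(\<Sum>i\<in>UNIV. (v i)\<^sup>2) = 1" by (simp add: v_def sum_3)
  have hv: "(\<Sum>j\<in>UNIV. h i j x * v j) = h i 1 x" for i
    by (simp add: v_def sum_3)
  have "V x = F 1 1 x + Fq x (\<lambda>i. h i 1 x)"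
    using Fq_cofactor[of x v] unfolding hv v Fq_eq[of x v] by (simp add: v_def sum_3)
  also have "F 1 1 x \<le> f x + f x" using h_entry_le[of 1 1 x] by (simp add: F_def)
  finally have "V x \<le> 2 * f x + Fq x (\<lambda>i. h i 1 x)" by simp
  also have "Fq x (\<lambda>i. h i 1 x) \<le> 2 * f x * (\<Sum>i\<in>UNIV. (h i 1 x)\<^sup>2)" by (rule Fq_le)
  also have "(\<Sum>i\<in>UNIV. (h i 1 x)\<^sup>2) \<le> (\<Sum>i\<in>UNIV. \<Sum>j\<in>UNIV. (h i j x)\<^sup>2)"
    by (intro sum_mono member_le_sum) auto
  also have "\<dots> = (f x)\<^sup>2 - 2" by (rule h_norm)
  finally have "V x \<le> 2 * f x + 2 * f x * ((f x)\<^sup>2 - 2)" using f_pos[of x] by (simp add: mult_left_mono)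
  also have "\<dots> \<le> f x + 6 * (f x)^3" using f_pos[of x] by (simp add: algebra_simps power2_eq_square power3_eq_cube)
  finally show ?thesis .
qed

text \<open>The factor is 1 + 1/3: the 1 is consumed by the gradient term of L (ln f), and the 1/3
  is what remains for absorption at the maximum point.\<close>

lemma jacobi: "4 / 3 * Fq x (\<lambda>i. tau i x) \<le> f x * L theta x"
proof -
  obtain P lam where P: "orthogonal_matrix P" "\<And>i j. h i j x = (\<Sum>a\<in>UNIV. P$i$a * lam$a * P$j$a)"
    using h_diag[of x] by blast
  show ?thesis
    unfolding Fq_def trace_N T2_def
    by (rule sigma2_jacobi_algebra[OF P t_sym1 t_sym2 f_def f_pos _ tau_def first_derivative_eq])
      (simp add: h_norm)
qed

text \<open>The field \<open>W\<close> is F applied to g grad a - a grad g. As \<open>F\<close> is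
  symmetric with divergence-free rows, div \<open>W\<close> is the difference of the two integrands;
  \<open>W\<close> inherits the support of \<open>g\<close>, so \<open>a\<close> is arbitrary at
  infinity.\<close>

lemma green_identity:
  assumes a: "has_partials a a1" "\<And>i. has_partials (a1 i) (a2 i)" "\<And>i j. continuous_on UNIV (a2 i j)"
    and g: "has_partials g g1" "\<And>i. has_partials (g1 i) (g2 i)" "\<And>i j. continuous_on UNIV (g2 i j)"
    and supp: "\<And>x. norm x > R \<Longrightarrow> g x = 0" "\<And>i x. norm x > R \<Longrightarrow> g1 i x = 0"
      "\<And>i j x. norm x > R \<Longrightarrow> g2 i j x = 0"
  shows "(\<integral>x. g x * L a2 x \<partial>lborel) = (\<integral>x. a x * L g2 x \<partial>lborel)"
proof -
  define W where "W i x = (\<Sum>j\<in>UNIV. F i j x * (g x * a1 j x - a x * g1 j x))" for i x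
  define dF where "dF i j k x = of_bool (i = j) * tau k x - t i j k x" for i j k x
  define dW where "dW i k x = (\<Sum>j\<in>UNIV. dF i j k x * (g x * a1 j x - a x * g1 j x)
      + F i j x * ((g1 k x * a1 j x + g x * a2 j k x) - (a1 k x * g1 j x + a x * g2 j k x)))" for i k x
  have dF: "has_partials (F i j) (dF i j)" for i j
    unfolding F_def[abs_def] dF_def[abs_def] by (intro has_partials_diff has_partials_cmult df dh)
  have W: "has_partials (W i) (dW i)" for i
    unfolding W_def[abs_def] dW_def[abs_def]
    by (intro has_partials_sum has_partials_mult has_partials_diff dF a g)
  have ac: "continuous_on UNIV a" "continuous_on UNIV g" "\<And>i. continuous_on UNIV (a1 i)" "\<And>i. continuous_on UNIV (g1 i)"
    using a g has_partials_continuous by blast+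
  have dWc: "continuous_on UNIV (dW i k)" for i k
    unfolding dW_def dF_def
    by (intro continuous_intros F_continuous tau_continuous t_continuous ac a g)
  have Fsym: "F i j x = F j i x" for i j x by (simp add: F_def h_sym[of i j] eq_commute)
  \<comment> \<open>The divergence of f I is the gradient of the trace of D^2u, and by symmetry of
    third derivatives so is the divergence of D^2u.\<close>
  have div: "(\<Sum>i\<in>UNIV. dF i j i x) = 0" for j x
  proof -
    have "(\<Sum>i\<in>UNIV. dF i j i x) = tau j x - (\<Sum>i\<in>UNIV. t i j i x)"
      by (simp add: dF_def sum_subtractf sum_pick)
    then show ?thesis by (simp add: tau_def t_sym2[of _ j])
  qed
  have eq: "(\<Sum>i\<in>UNIV. dW i i x) = g x * L a2 x - a x * L g2 x" for x
  proof -
    have "(\<Sum>i\<in>UNIV. dW i i x) = (\<Sum>j\<in>UNIV. \<Sum>i\<in>UNIV. dF i j i x * (g x * a1 j x - a x * g1 j x))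
        + (\<Sum>i\<in>UNIV. \<Sum>j\<in>UNIV. F i j x * (g1 i x * a1 j x)) - (\<Sum>i\<in>UNIV. \<Sum>j\<in>UNIV. F i j x * (a1 i x * g1 j x))
        + (\<Sum>i\<in>UNIV. \<Sum>j\<in>UNIV. g x * (F i j x * a2 j i x)) - (\<Sum>i\<in>UNIV. \<Sum>j\<in>UNIV. a x * (F i j x * g2 j i x))"
      unfolding dW_def
      by (subst (2) sum.swap) (simp add: sum.distrib sum_subtractf algebra_simps)
    also have "(\<Sum>j\<in>UNIV. \<Sum>i\<in>UNIV. dF i j i x * (g x * a1 j x - a x * g1 j x)) = 0"
      by (simp add: sum_distrib_right[symmetric] div)
    also have "(\<Sum>i\<in>UNIV. \<Sum>j\<in>UNIV. F i j x * (g1 i x * a1 j x)) = (\<Sum>i\<in>UNIV. \<Sum>j\<in>UNIV. F i j x * (a1 i x * g1 j x))"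
      by (subst sum.swap) (simp add: Fsym mult.commute)
    also have "(\<Sum>i\<in>UNIV. \<Sum>j\<in>UNIV. g x * (F i j x * a2 j i x)) = g x * L a2 x"
      unfolding L_def sum_distrib_left by (subst sum.swap) (intro sum.cong refl, simp add: Fsym)
    also have "(\<Sum>i\<in>UNIV. \<Sum>j\<in>UNIV. a x * (F i j x * g2 j i x)) = a x * L g2 x"
      unfolding L_def sum_distrib_left by (subst sum.swap) (intro sum.cong refl, simp add: Fsym)
    finally show ?thesis by simp
  qed
  have Wsupp: "norm x > R \<Longrightarrow> W i x = 0" for i x by (simp add: W_def supp)
  have dWsupp: "norm x > R \<Longrightarrow> dW i i x = 0" for i x by (simp add: dW_def supp)
  have "(\<integral>x. (\<Sum>i\<in>UNIV. dW i i x) \<partial>lborel) = (\<Sum>i\<in>UNIV. (\<integral>x. dW i i x \<partial>lborel))"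
    by (intro Bochner_Integration.integral_sum integrable_continuous_support[OF dWc dWsupp])
  also have "\<dots> = 0" by (simp add: integral_partial_eq_0[OF W dWc Wsupp])
  finally have "(\<integral>x. g x * L a2 x - a x * L g2 x \<partial>lborel) = 0" by (simp add: eq)
  moreover have "integrable lborel (\<lambda>x. g x * L a2 x)"
    by (rule integrable_continuous_support[where R=R], intro continuous_intros L_continuous ac a)
      (simp add: supp)
  moreover have "integrable lborel (\<lambda>x. a x * L g2 x)"
    by (rule integrable_continuous_support[where R=R], intro continuous_intros L_continuous ac g)
      (simp add: supp L_def)
  ultimately show ?thesis by simp
qed

end

section \<open>Mean value inequality and energy bound\<close>

lemma has_real_derivative_pos_part_power:
  assumes "n \<ge> 1"
  shows "((\<lambda>s::real. (max 0 s) ^ Suc n) has_real_derivative real (Suc n) * (max 0 s) ^ n) (at s)"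
proof -
  consider "s > 0" | "s < 0" | "s = 0" by linarith
  then show ?thesis
  proof cases
    case 1
    have "((\<lambda>s::real. s ^ Suc n) has_real_derivative real (Suc n) * s ^ n) (at s)"
      using DERIV_pow[of "Suc n" s] by simp
    then have "((\<lambda>s::real. (max 0 s) ^ Suc n) has_real_derivative real (Suc n) * s ^ n) (at s)"
      by (rule has_field_derivative_transform_within_open[where S="{0<..}"]) (use 1 in auto)
    then show ?thesis using 1 by simp
  next
    case 2
    have "((\<lambda>s::real. 0) has_real_derivative 0) (at s)" by simp
    then have "((\<lambda>s::real. (max 0 s) ^ Suc n) has_real_derivative 0) (at s)"
      by (rule has_field_derivative_transform_within_open[where S="{..<0}"]) (use 2 in auto)
    then show ?thesis using 2 assms by (cases n) auto
  next
    case 3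
    have "((\<lambda>t. (max 0 t ^ Suc n) / t) \<longlongrightarrow> 0) (at (0::real))"
    proof (rule Lim_null_comparison)
      show "\<forall>\<^sub>F t in at 0. norm (max 0 t ^ Suc n / t) \<le> \<bar>t\<bar> ^ n"
        by (auto simp: max_def)
      have "((\<lambda>t::real. \<bar>t\<bar> ^ n) \<longlongrightarrow> \<bar>0\<bar> ^ n) (at 0)"
        by (rule tendsto_power[OF tendsto_rabs[OF tendsto_ident_at]])
      moreover have "abs (0::real) ^ n = 0" using assms by (cases n) auto
      ultimately show "((\<lambda>t::real. \<bar>t\<bar> ^ n) \<longlongrightarrow> 0) (at 0)" by (simp only:)
    qed
    moreover have z: "real (Suc n) * max 0 s ^ n = 0" using 3 assms by simp
    ultimately show ?thesis unfolding has_field_derivative_iff z using 3 by simp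
  qed
qed

text \<open>Used cubed in the kernel: the third power is the lowest integer power with two
  continuous derivatives, as a test function for \<open>green_identity\<close> needs.\<close>

definition cutoff :: "real \<Rightarrow> real \<Rightarrow> real" where "cutoff r s = max 0 (1 - s / r\<^sup>2)"
definition invsqrt :: "real \<Rightarrow> real \<Rightarrow> real" where "invsqrt e s = inverse (sqrt (s + e\<^sup>2))"

text \<open>A truncated regularisation of \<open>s\<^sup>-\<^sup>1\<^sup>/\<^sup>2\<close>, to be composed with the squared extrinsic distance
  \<open>s\<close> on the gradient graph: a substitute for the Green function of \<open>L\<close>.\<close>
definition kernel :: "real \<Rightarrow> real \<Rightarrow> real \<Rightarrow> real" where
  "kernel e r s = cutoff r s ^ 3 * invsqrt e s"
definition kernel1 :: "real \<Rightarrow> real \<Rightarrow> real \<Rightarrow> real" where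
  "kernel1 e r s = - (3 / r\<^sup>2 * (cutoff r s)\<^sup>2 * invsqrt e s + cutoff r s ^ 3 * invsqrt e s ^ 3 / 2)"
definition kernel2 :: "real \<Rightarrow> real \<Rightarrow> real \<Rightarrow> real" where
  "kernel2 e r s = 6 / r^4 * cutoff r s * invsqrt e s + 3 / r\<^sup>2 * (cutoff r s)\<^sup>2 * invsqrt e s ^ 3
     + 3 / 4 * cutoff r s ^ 3 * invsqrt e s ^ 5"

lemma cutoff_bounds: "0 \<le> cutoff r s" "0 \<le> s \<Longrightarrow> cutoff r s \<le> 1"
  by (auto simp: cutoff_def)

lemma cutoff_eq_0: "r > 0 \<Longrightarrow> r\<^sup>2 \<le> s \<Longrightarrow> cutoff r s = 0"
  by (simp add: cutoff_def pos_le_divide_eq)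

lemma invsqrt_pos: "e > 0 \<Longrightarrow> 0 \<le> s \<Longrightarrow> 0 < invsqrt e s"
  by (simp add: invsqrt_def add_nonneg_pos)

lemma invsqrt_sq: "e > 0 \<Longrightarrow> 0 \<le> s \<Longrightarrow> (invsqrt e s)\<^sup>2 * (s + e\<^sup>2) = 1"
  by (simp add: invsqrt_def power_inverse add_nonneg_pos less_imp_neq[symmetric])

lemma cutoff_DERIV:
  assumes "n \<ge> 1"
  shows "((\<lambda>s. cutoff r s ^ Suc n) has_real_derivative - (real (Suc n) * cutoff r s ^ n / r\<^sup>2)) (at s)"
proof -
  have "((\<lambda>s. 1 - s / r\<^sup>2) has_real_derivative - (1 / r\<^sup>2)) (at s)"
    using DERIV_diff[OF DERIV_const DERIV_cdivide[OF DERIV_ident]] by simp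
  from DERIV_chain2[OF has_real_derivative_pos_part_power[OF assms] this]
  show ?thesis by (simp add: cutoff_def)
qed

lemma invsqrt_DERIV:
  assumes "e > 0" "0 \<le> s"
  shows "(invsqrt e has_real_derivative - (invsqrt e s ^ 3 / 2)) (at s)"
proof -
  have p: "s + e\<^sup>2 > 0" using assms by (simp add: add_nonneg_pos)
  have "((\<lambda>s. inverse (sqrt (s + e\<^sup>2))) has_real_derivative
      - (inverse (sqrt (s + e\<^sup>2)) * (inverse (sqrt (s + e\<^sup>2)) / 2 * 1) * inverse (sqrt (s + e\<^sup>2)))) (at s)"
    using p by (auto intro!: derivative_eq_intros)
  then show ?thesis by (simp add: invsqrt_def[abs_def] power3_eq_cube)
qed

lemma kernel_DERIV:
  assumes e: "e > 0" and s: "0 \<le> s"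
  shows "(kernel e r has_real_derivative kernel1 e r s) (at s)"
    and "(kernel1 e r has_real_derivative kernel2 e r s) (at s)"
proof -
  note I = invsqrt_DERIV[OF e s]
  have c3: "((\<lambda>s. cutoff r s ^ 3) has_real_derivative - (3 * (cutoff r s)\<^sup>2 / r\<^sup>2)) (at s)"
    using cutoff_DERIV[of 2 r s] by (simp add: eval_nat_numeral)
  have c2: "((\<lambda>s. (cutoff r s)\<^sup>2) has_real_derivative - (2 * cutoff r s / r\<^sup>2)) (at s)"
    using cutoff_DERIV[of 1 r s] by (simp add: eval_nat_numeral)
  have I3: "((\<lambda>s. invsqrt e s ^ 3) has_real_derivative 3 * (invsqrt e s)\<^sup>2 * - (invsqrt e s ^ 3 / 2)) (at s)"
    using DERIV_power[OF I, of 3] by (simp add: eval_nat_numeral mult_ac)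
  show "(kernel e r has_real_derivative kernel1 e r s) (at s)"
    unfolding kernel_def[abs_def]
    by (rule DERIV_cong[OF DERIV_mult[OF c3 I]]) (simp add: kernel1_def algebra_simps)
  have "((\<lambda>s. - (3 / r\<^sup>2 * ((cutoff r s)\<^sup>2 * invsqrt e s) + (1 / 2) * (cutoff r s ^ 3 * invsqrt e s ^ 3)))
      has_real_derivative
      - (3 / r\<^sup>2 * (- (2 * cutoff r s / r\<^sup>2) * invsqrt e s + - (invsqrt e s ^ 3 / 2) * (cutoff r s)\<^sup>2)
        + (1 / 2) * (- (3 * (cutoff r s)\<^sup>2 / r\<^sup>2) * invsqrt e s ^ 3
          + 3 * (invsqrt e s)\<^sup>2 * - (invsqrt e s ^ 3 / 2) * cutoff r s ^ 3))) (at s)"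
    by (intro DERIV_minus DERIV_add DERIV_cmult DERIV_mult c3 c2 I I3)
  also have "(\<lambda>s. - (3 / r\<^sup>2 * ((cutoff r s)\<^sup>2 * invsqrt e s) + (1 / 2) * (cutoff r s ^ 3 * invsqrt e s ^ 3)))
    = kernel1 e r" by (simp add: kernel1_def[abs_def] mult_ac)
  also have "- (3 / r\<^sup>2 * (- (2 * cutoff r s / r\<^sup>2) * invsqrt e s + - (invsqrt e s ^ 3 / 2) * (cutoff r s)\<^sup>2)
        + (1 / 2) * (- (3 * (cutoff r s)\<^sup>2 / r\<^sup>2) * invsqrt e s ^ 3
          + 3 * (invsqrt e s)\<^sup>2 * - (invsqrt e s ^ 3 / 2) * cutoff r s ^ 3)) = kernel2 e r s"
  proof -
    have a: "3 / r\<^sup>2 * (2 * cutoff r s / r\<^sup>2) = 6 / r^4 * cutoff r s"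
      by (simp add: power2_eq_square power4_eq_xxxx)
    have b: "(invsqrt e s)\<^sup>2 * invsqrt e s ^ 3 = invsqrt e s ^ 5" by (simp add: power_add[symmetric])
    have "- (3 / r\<^sup>2 * (- (2 * cutoff r s / r\<^sup>2) * invsqrt e s + - (invsqrt e s ^ 3 / 2) * (cutoff r s)\<^sup>2)
        + (1 / 2) * (- (3 * (cutoff r s)\<^sup>2 / r\<^sup>2) * invsqrt e s ^ 3
          + 3 * (invsqrt e s)\<^sup>2 * - (invsqrt e s ^ 3 / 2) * cutoff r s ^ 3))
      = 3 / r\<^sup>2 * (2 * cutoff r s / r\<^sup>2) * invsqrt e s + 3 / r\<^sup>2 * (cutoff r s)\<^sup>2 * invsqrt e s ^ 3
        + 3 / 4 * cutoff r s ^ 3 * ((invsqrt e s)\<^sup>2 * invsqrt e s ^ 3)"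
      by (simp add: algebra_simps)
    then show ?thesis unfolding a b kernel2_def by simp
  qed
  finally show "(kernel1 e r has_real_derivative kernel2 e r s) (at s)" .
qed

lemma kernel2_nonneg: "e > 0 \<Longrightarrow> 0 \<le> s \<Longrightarrow> 0 \<le> kernel2 e r s"
  unfolding kernel2_def using cutoff_bounds(1)[of r s] invsqrt_pos[of e s]
  by (intro add_nonneg_nonneg mult_nonneg_nonneg) auto

text \<open>For convex phi, L (phi o s) is at most V (6 phi' + 4 s phi''), and phi = s^(-1/2) makes
  the bracket vanish. The regularisation by \<open>e\<close> turns 0 into -3 e^2 (s + e^2)^(-5/2),
  an approximate point mass; the truncation adds an error of size r^-3 on the set s <= r^2.\<close>

lemma kernel_superharmonic:
  assumes e: "e > 0" and s: "0 \<le> s" and r: "r > 0"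
  shows "6 * kernel1 e r s + 4 * s * kernel2 e r s
    \<le> 24 / r^3 * of_bool (s \<le> r\<^sup>2) - 3 * e\<^sup>2 * (cutoff r s ^ 3 * invsqrt e s ^ 5)"
proof (cases "s \<le> r\<^sup>2")
  case False
  then show ?thesis using cutoff_eq_0[OF r, of s] by (simp add: kernel1_def kernel2_def)
next
  case True
  define c where "c = cutoff r s"
  define I where "I = invsqrt e s"
  have c: "0 \<le> c" "c \<le> 1" using cutoff_bounds s by (auto simp: c_def)
  have I: "0 < I" "I\<^sup>2 * (s + e\<^sup>2) = 1" using invsqrt_pos invsqrt_sq e s by (auto simp: I_def)
  have sI2: "s * I\<^sup>2 = 1 - e\<^sup>2 * I\<^sup>2" using I(2) by (simp add: algebra_simps)
  have sI2': "s * I\<^sup>2 \<le> 1" by (simp add: sI2)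
  have sI: "s * I \<le> r"
  proof (rule power2_le_imp_le)
    have "(s * I)\<^sup>2 = s * (s * I\<^sup>2)" by (simp add: power2_eq_square)
    also have "\<dots> \<le> s * 1" by (intro mult_left_mono sI2' s)
    finally show "(s * I)\<^sup>2 \<le> r\<^sup>2" using True by simp
  qed (use r in simp)
  have "6 * kernel1 e r s + 4 * s * kernel2 e r s = - (18 / r\<^sup>2 * c\<^sup>2 * I) - 3 * c^3 * I^3
      + 24 * (s * I) * c / r^4 + 12 * c\<^sup>2 * I / r\<^sup>2 * (s * I\<^sup>2) + 3 * c^3 * I^3 * (s * I\<^sup>2)"
    unfolding kernel1_def kernel2_def c_def[symmetric] I_def[symmetric]
    by (simp add: algebra_simps power2_eq_square power3_eq_cube eval_nat_numeral)
  also have "3 * c^3 * I^3 * (s * I\<^sup>2) = 3 * c^3 * I^3 - 3 * e\<^sup>2 * (c^3 * I^5)"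
    unfolding sI2 by (simp add: algebra_simps eval_nat_numeral)
  also have "12 * c\<^sup>2 * I / r\<^sup>2 * (s * I\<^sup>2) \<le> 12 * c\<^sup>2 * I / r\<^sup>2 * 1"
    by (intro mult_left_mono sI2') (use I in simp)
  also have "24 * (s * I) * c / r^4 \<le> 24 * r * 1 / r^4"
    using sI c r s I by (intro divide_right_mono mult_mono) auto
  also have "24 * r * 1 / r^4 = 24 / r^3" using r by (simp add: eval_nat_numeral)
  \<comment> \<open>The first-order truncation term -18 outweighs the mixed second-order term 12, so
    their sum has a sign and is discarded.\<close>
  also have "- (18 / r\<^sup>2 * c\<^sup>2 * I) - 3 * c ^ 3 * I ^ 3 + 24 / r ^ 3 + 12 * c\<^sup>2 * I / r\<^sup>2 * 1
      + (3 * c ^ 3 * I ^ 3 - 3 * e\<^sup>2 * (c ^ 3 * I ^ 5))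
    = 24 / r^3 - 3 * e\<^sup>2 * (c ^ 3 * I ^ 5) - 6 / r\<^sup>2 * c\<^sup>2 * I" by simp
  also have "\<dots> \<le> 24 / r^3 - 3 * e\<^sup>2 * (c ^ 3 * I ^ 5)" using I by simp
  finally show ?thesis using True by (simp add: c_def I_def)
qed

lemma has_partials_eqI: "has_partials f g \<Longrightarrow> (\<And>i x. g i x = g' i x) \<Longrightarrow> has_partials f g'"
  by (simp add: has_partials_def)

lemma has_partials_lipschitz:
  assumes g: "has_partials g g1" and K: "\<And>x. (\<Sum>i\<in>UNIV. (g1 i x)\<^sup>2) \<le> K\<^sup>2" "0 \<le> K"
  shows "\<bar>g x - g a\<bar> \<le> K * norm (x - a)"
proof -
  have "\<exists>z>0. z < 1 \<and> g (a + 1 *\<^sub>R (x - a)) - g (a + 0 *\<^sub>R (x - a))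
      = (1 - 0) * (\<Sum>i\<in>UNIV. g1 i (a + z *\<^sub>R (x - a)) * (x - a)$i)"
    by (rule MVT2) (use has_partials_line[OF g, of a "x - a"] in auto)
  then obtain \<theta> where \<theta>: "g x - g a = (\<Sum>i\<in>UNIV. g1 i (a + \<theta> *\<^sub>R (x - a)) * (x - a)$i)"
    by auto
  have "(g x - g a)\<^sup>2 \<le> (\<Sum>i\<in>UNIV. (g1 i (a + \<theta> *\<^sub>R (x - a)))\<^sup>2) * (\<Sum>i\<in>UNIV. ((x - a)$i)\<^sup>2)"
    using \<theta> Cauchy_Schwarz_ineq_sum[of "\<lambda>i. g1 i (a + \<theta> *\<^sub>R (x - a))" "\<lambda>i. (x - a)$i" UNIV] by simp
  also have "\<dots> \<le> K\<^sup>2 * (norm (x - a))\<^sup>2"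
    unfolding power2_norm_eq_inner inner_vec_def power2_eq_square[of "(x - a)$_"] inner_real_def
    by (intro mult_right_mono K sum_nonneg) auto
  finally have "(g x - g a)\<^sup>2 \<le> (K * norm (x - a))\<^sup>2" by (simp add: power_mult_distrib)
  then show ?thesis using K(2) by (simp add: power2_le_iff_abs_le)
qed

context sigma2_solution
begin

section \<open>Squared extrinsic distance on the gradient graph\<close>

definition sd :: "real^3 \<Rightarrow> real^3 \<Rightarrow> real" where
  "sd a x = (\<Sum>i\<in>UNIV. (x$i - a$i)\<^sup>2) + (\<Sum>i\<in>UNIV. (p i x - p i a)\<^sup>2)"
definition sd1 :: "real^3 \<Rightarrow> 3 \<Rightarrow> real^3 \<Rightarrow> real" where
  "sd1 a j x = 2 * ((x$j - a$j) + (\<Sum>i\<in>UNIV. h j i x * (p i x - p i a)))"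
definition sd2 :: "real^3 \<Rightarrow> 3 \<Rightarrow> 3 \<Rightarrow> real^3 \<Rightarrow> real" where
  "sd2 a j k x = 2 * (of_bool (k = j) + (\<Sum>i\<in>UNIV. t j i k x * (p i x - p i a) + h j i x * h i k x))"

lemma sd_partials: "has_partials (sd a) (sd1 a)" "has_partials (sd1 a j) (sd2 a j)"
proof -
  have c: "has_partials (\<lambda>x. x$i - a$i) (\<lambda>j x. of_bool (j = i) - 0)" for i :: 3
    by (intro has_partials_diff has_partials_coord has_partials_const)
  have d: "has_partials (\<lambda>x. p i x - p i a) (\<lambda>j x. h i j x - 0)" for i
    by (intro has_partials_diff dp has_partials_const)
  have "has_partials (\<lambda>x. (\<Sum>i\<in>UNIV. (x$i - a$i) * (x$i - a$i)) + (\<Sum>i\<in>UNIV. (p i x - p i a) * (p i x - p i a)))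
    (\<lambda>j x. (\<Sum>i\<in>UNIV. (of_bool (j = i) - 0) * (x$i - a$i) + (x$i - a$i) * (of_bool (j = i) - 0))
      + (\<Sum>i\<in>UNIV. (h i j x - 0) * (p i x - p i a) + (p i x - p i a) * (h i j x - 0)))"
    by (intro has_partials_add has_partials_sum has_partials_mult c d)
  then have "has_partials (sd a)
    (\<lambda>j x. (\<Sum>i\<in>UNIV. (of_bool (j = i) - 0) * (x$i - a$i) + (x$i - a$i) * (of_bool (j = i) - 0))
      + (\<Sum>i\<in>UNIV. (h i j x - 0) * (p i x - p i a) + (p i x - p i a) * (h i j x - 0)))"
    by (simp add: sd_def[abs_def] power2_eq_square)
  then show "has_partials (sd a) (sd1 a)"
  proof (rule has_partials_eqI)
    fix j x
    have 1: "(\<Sum>i\<in>UNIV. (x$i - a$i) * of_bool (j = i)) = x$j - a$j"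
      using sum_pick(3)[of j "\<lambda>i. x$i - a$i"] by (simp add: mult.commute)
    have 2: "(\<Sum>i\<in>UNIV. h i j x * (p i x - p i a)) = (\<Sum>i\<in>UNIV. h j i x * (p i x - p i a))"
      "(\<Sum>i\<in>UNIV. (p i x - p i a) * h i j x) = (\<Sum>i\<in>UNIV. h j i x * (p i x - p i a))"
      by (intro sum.cong refl, simp only: h_sym[of _ j] mult.commute)+
    show "(\<Sum>i\<in>UNIV. (of_bool (j = i) - 0) * (x$i - a$i) + (x$i - a$i) * (of_bool (j = i) - 0))
      + (\<Sum>i\<in>UNIV. (h i j x - 0) * (p i x - p i a) + (p i x - p i a) * (h i j x - 0)) = sd1 a j x"
      unfolding diff_zero sum.distrib sum_pick(3) 1 2 by (simp add: sd1_def)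
  qed
  have "has_partials (\<lambda>x. 2 * ((x$j - a$j) + (\<Sum>i\<in>UNIV. h j i x * (p i x - p i a))))
    (\<lambda>k x. 2 * ((of_bool (k = j) - 0) + (\<Sum>i\<in>UNIV. t j i k x * (p i x - p i a) + h j i x * (h i k x - 0))))"
    by (intro has_partials_cmult has_partials_add has_partials_sum has_partials_mult c d dh)
  then show "has_partials (sd1 a j) (sd2 a j)"
    by (simp add: sd1_def[abs_def] sd2_def[abs_def])
qed

lemma sd_nonneg: "0 \<le> sd a x"
  by (simp add: sd_def sum_nonneg)

lemma norm_le_sd: "(norm (x - a))\<^sup>2 \<le> sd a x"
proof -
  have "(norm (x - a))\<^sup>2 = (\<Sum>i\<in>UNIV. (x$i - a$i)\<^sup>2)"
    unfolding power2_norm_eq_inner inner_vec_def power2_eq_square[of "x$_ - a$_"] by simp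
  then show ?thesis by (simp add: sd_def sum_nonneg)
qed

text \<open>Each of the three gradient components is \<open>K\<close>-Lipschitz, whence 3 K^2.
  Together with \<open>norm_le_sd\<close>, extrinsic and Euclidean distance are comparable once the
  Hessian is bounded.\<close>

lemma sd_le:
  assumes K: "\<And>x. f x \<le> K"
  shows "sd a x \<le> (1 + 3 * K\<^sup>2) * (norm (x - a))\<^sup>2"
proof -
  have K0: "0 \<le> K" using K[of a] f_pos[of a] by simp
  have n: "(norm (x - a))\<^sup>2 = (\<Sum>i\<in>UNIV. (x$i - a$i)\<^sup>2)"
    unfolding power2_norm_eq_inner inner_vec_def power2_eq_square[of "x$_ - a$_"] by simp
  have hb: "(\<Sum>j\<in>UNIV. (h i j y)\<^sup>2) \<le> K\<^sup>2" for i y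
  proof -
    have "(\<Sum>j\<in>UNIV. (h i j y)\<^sup>2) \<le> (\<Sum>i\<in>UNIV. \<Sum>j\<in>UNIV. (h i j y)\<^sup>2)"
      by (rule member_le_sum[of i UNIV "\<lambda>i. \<Sum>j\<in>UNIV. (h i j y)\<^sup>2"]) (auto intro: sum_nonneg)
    also have "\<dots> \<le> (f y)\<^sup>2" by (simp add: h_norm)
    also have "\<dots> \<le> K\<^sup>2" using K[of y] f_pos[of y] by (intro power_mono) auto
    finally show ?thesis .
  qed
  have "(p i x - p i a)\<^sup>2 \<le> (K * norm (x - a))\<^sup>2" for i
    using has_partials_lipschitz[OF dp hb K0, of i x a] K0 by (simp add: power2_le_iff_abs_le)
  then have "(\<Sum>i\<in>UNIV. (p i x - p i a)\<^sup>2) \<le> (\<Sum>i\<in>(UNIV::3 set). (K * norm (x - a))\<^sup>2)"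
    by (intro sum_mono)
  then show ?thesis by (simp add: sd_def n[symmetric] algebra_simps power_mult_distrib)
qed

lemma Fq_scale: "Fq x (\<lambda>i. c * v i) = c\<^sup>2 * Fq x v"
  by (simp add: Fq_eq sum_distrib_left power2_eq_square mult_ac)

lemma Fq_sd1: "0 \<le> Fq x (\<lambda>i. sd1 a i x)" "Fq x (\<lambda>i. sd1 a i x) \<le> 4 * sd a x * V x"
proof -
  show "0 \<le> Fq x (\<lambda>i. sd1 a i x)" by (rule Fq_nonneg)
  have "Fq x (\<lambda>i. sd1 a i x) = 4 * Fq x (\<lambda>j. (x$j - a$j) + (\<Sum>i\<in>UNIV. h j i x * (p i x - p i a)))"
    using Fq_scale[of x 2 "\<lambda>j. (x$j - a$j) + (\<Sum>i\<in>UNIV. h j i x * (p i x - p i a))"] by (simp add: sd1_def)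
  also have "\<dots> \<le> 4 * (V x * sd a x)"
    unfolding sd_def by (intro mult_left_mono Fq_gradient_le) simp
  finally show "Fq x (\<lambda>i. sd1 a i x) \<le> 4 * sd a x * V x" by (simp add: mult_ac)
qed

text \<open>The third-derivative terms vanish because each \<open>p i\<close> is annihilated by
  \<open>L\<close>, which is the linearised equation; the rest is twice
  \<open>trace_cofactor\<close>. This is the rule that the Laplacian of the squared position is
  twice the dimension on a minimal submanifold.\<close>

lemma L_sd2: "L (sd2 a) x = 6 * V x"
proof -
  have zero: "(\<Sum>j\<in>UNIV. \<Sum>k\<in>UNIV. F j k x * t j i k x) = 0" for i
  proof -
    have "(\<Sum>j\<in>UNIV. \<Sum>k\<in>UNIV. F j k x * t j i k x) = L (\<lambda>j k. t j k i) x"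
      by (simp add: L_def t_sym2[of _ i])
    also have "\<dots> = 0"
      unfolding L_eq using first_derivative_eq[of x i] by (simp add: tau_def)
    finally show ?thesis .
  qed
  have "F j k x * sd2 a j k x = 2 * (F j k x * of_bool (k = j))
    + 2 * (\<Sum>i\<in>UNIV. (p i x - p i a) * (F j k x * t j i k x))
    + 2 * (\<Sum>i\<in>UNIV. F j k x * (h i j x * h i k x))" for j k
    by (simp only: sd2_def distrib_left sum.distrib sum_distrib_left h_sym[of j] mult_ac)
  then have 1: "L (sd2 a) x = 2 * (\<Sum>j\<in>UNIV. \<Sum>k\<in>UNIV. F j k x * of_bool (k = j))
      + 2 * (\<Sum>j\<in>UNIV. \<Sum>k\<in>UNIV. \<Sum>i\<in>UNIV. (p i x - p i a) * (F j k x * t j i k x))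
      + 2 * (\<Sum>j\<in>UNIV. \<Sum>k\<in>UNIV. \<Sum>i\<in>UNIV. F j k x * (h i j x * h i k x))"
    by (simp only: L_def sum.distrib sum_distrib_left[symmetric])
  have 2: "(\<Sum>j\<in>UNIV. \<Sum>k\<in>UNIV. \<Sum>i\<in>UNIV. (p i x - p i a) * (F j k x * t j i k x))
      = (\<Sum>i\<in>UNIV. (p i x - p i a) * (\<Sum>j\<in>UNIV. \<Sum>k\<in>UNIV. F j k x * t j i k x))"
    unfolding sum_distrib_left by (subst (2) sum.swap, subst sum.swap) (rule refl)
  have 3: "(\<Sum>j\<in>UNIV. \<Sum>k\<in>UNIV. \<Sum>i\<in>UNIV. F j k x * (h i j x * h i k x))
      = (\<Sum>i\<in>UNIV. \<Sum>j\<in>UNIV. \<Sum>k\<in>UNIV. F j k x * (h i j x * h i k x))"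
    by (subst (2) sum.swap, subst sum.swap) (rule refl)
  have 4: "(\<Sum>j\<in>UNIV. \<Sum>k\<in>UNIV. F j k x * of_bool (k = j)) = (\<Sum>j\<in>UNIV. F j j x)"
    by (simp only: sum_pick)
  show ?thesis unfolding 1 2 3 4 zero using trace_cofactor[of x] by simp
qed

lemma sd_continuous: "continuous_on S (sd a)" "continuous_on S (sd1 a i)" "continuous_on S (sd2 a i j)"
  unfolding sd_def[abs_def] sd1_def[abs_def] sd2_def[abs_def]
  by (intro continuous_intros p_continuous h_continuous t_continuous)+

lemma kernel_continuous:
  assumes "e > 0"
  shows "continuous_on S (\<lambda>x. cutoff r (sd a x))" "continuous_on S (\<lambda>x. invsqrt e (sd a x))"
    "continuous_on S (\<lambda>x. kernel e r (sd a x))"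
    "continuous_on S (\<lambda>x. kernel1 e r (sd a x))" "continuous_on S (\<lambda>x. kernel2 e r (sd a x))"
proof -
  have p: "sd a x + e\<^sup>2 > 0" for x using sd_nonneg[of a x] assms by (simp add: add_nonneg_pos)
  show c: "continuous_on S (\<lambda>x. cutoff r (sd a x))"
    unfolding cutoff_def divide_inverse by (intro continuous_intros sd_continuous continuous_on_max)
  show i: "continuous_on S (\<lambda>x. invsqrt e (sd a x))"
    unfolding invsqrt_def using p by (intro continuous_intros sd_continuous) (metis less_irrefl real_sqrt_eq_0_iff)
  show "continuous_on S (\<lambda>x. kernel e r (sd a x))"
    "continuous_on S (\<lambda>x. kernel1 e r (sd a x))" "continuous_on S (\<lambda>x. kernel2 e r (sd a x))"
    unfolding kernel_def kernel1_def kernel2_def by (intro continuous_intros c i; simp)+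
qed

lemma cutoff_sd_eq_0:
  assumes "r > 0" "norm x > norm a + r"
  shows "cutoff r (sd a x) = 0"
proof -
  have "norm (x - a) > r" using assms(2) norm_triangle_ineq2[of x a] by simp
  then have "r\<^sup>2 \<le> (norm (x - a))\<^sup>2" using assms(1) by (intro power_mono) auto
  then have "r\<^sup>2 \<le> sd a x" using norm_le_sd by (rule order_trans)
  with assms(1) show ?thesis by (rule cutoff_eq_0)
qed

text \<open>\<open>L\<close> is moved from \<open>g\<close> onto the kernel, which is nearly
  superharmonic. The two terms on the left serve different purposes: with g = f the first is the
  energy, while for a subsolution the second, concentrated near \<open>a\<close>, gives the mean
  value inequality.\<close>

lemma kernel_test:
  assumes g: "has_partials g g1" "\<And>i. has_partials (g1 i) (g2 i)" "\<And>i j. continuous_on UNIV (g2 i j)"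
    and g0: "\<And>x. 0 \<le> g x" and r: "r > 0" and e: "e > 0"
  shows "(\<integral>x. kernel e r (sd a x) * L g2 x \<partial>lborel)
      + (\<integral>x. 3 * e\<^sup>2 * (g x * V x * (cutoff r (sd a x) ^ 3 * invsqrt e (sd a x) ^ 5)) \<partial>lborel)
    \<le> 24 / r^3 * (\<integral>x. indicator (cball a r) x * (g x * V x) \<partial>lborel)"
proof -
  define k1 where "k1 i x = kernel1 e r (sd a x) * sd1 a i x" for i x
  define k2 where "k2 i j x = (kernel2 e r (sd a x) * sd1 a j x) * sd1 a i x
      + kernel1 e r (sd a x) * sd2 a i j x" for i j x
  have k: "has_partials (\<lambda>x. kernel e r (sd a x)) k1"
    unfolding k1_def[abs_def]
    by (intro has_partials_compose sd_partials kernel_DERIV e sd_nonneg)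
  have kk: "has_partials (k1 i) (k2 i)" for i
    unfolding k1_def[abs_def] k2_def[abs_def]
    by (intro has_partials_mult has_partials_compose sd_partials kernel_DERIV e sd_nonneg)
  have k2c: "continuous_on UNIV (k2 i j)" for i j
    unfolding k2_def[abs_def] by (intro continuous_intros kernel_continuous e sd_continuous)
  have gc: "continuous_on S g" for S
    using continuous_on_subset[OF has_partials_continuous[OF g(1)]] by blast
  define R where "R = norm a + r"
  have cut: "cutoff r (sd a x) = 0" if "norm x > R" for x
    using that unfolding R_def by (rule cutoff_sd_eq_0[OF r])
  have "(\<integral>x. kernel e r (sd a x) * L g2 x \<partial>lborel) = (\<integral>x. g x * L k2 x \<partial>lborel)"
    by (rule green_identity[OF g k kk k2c, where R=R])
      (auto simp: cut kernel_def kernel1_def kernel2_def k1_def k2_def)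
  moreover
  define B where "B x = cutoff r (sd a x) ^ 3 * invsqrt e (sd a x) ^ 5" for x
  have Lk: "L k2 x = kernel2 e r (sd a x) * Fq x (\<lambda>i. sd1 a i x) + kernel1 e r (sd a x) * (6 * V x)" for x
    unfolding L_sd2[symmetric, of x a] L_def Fq_eq k2_def
    by (simp add: distrib_left sum.distrib sum_distrib_left mult_ac)
  have ptw: "g x * L k2 x + 3 * e\<^sup>2 * (g x * V x * B x) \<le> 24 / r^3 * (indicator (cball a r) x * (g x * V x))" for x
  proof -
    \<comment> \<open>Convexity of the kernel is essential: only a nonnegative
      \<open>kernel2\<close> lets the upper bound for F(grad s, grad s) be inserted.\<close>
    have "L k2 x \<le> kernel2 e r (sd a x) * (4 * sd a x * V x) + kernel1 e r (sd a x) * (6 * V x)"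
      unfolding Lk by (intro add_right_mono mult_left_mono Fq_sd1 kernel2_nonneg e sd_nonneg)
    also have "\<dots> = (6 * kernel1 e r (sd a x) + 4 * sd a x * kernel2 e r (sd a x)) * V x"
      by (simp add: algebra_simps)
    also have "\<dots> \<le> (24 / r^3 * of_bool (sd a x \<le> r\<^sup>2) - 3 * e\<^sup>2 * B x) * V x"
      unfolding B_def using V_pos[of x] by (intro mult_right_mono kernel_superharmonic e sd_nonneg r) auto
    finally have "g x * L k2 x \<le> g x * ((24 / r^3 * of_bool (sd a x \<le> r\<^sup>2) - 3 * e\<^sup>2 * B x) * V x)"
      by (intro mult_left_mono g0)
    then have "g x * L k2 x + 3 * e\<^sup>2 * (g x * V x * B x) \<le> 24 / r^3 * (of_bool (sd a x \<le> r\<^sup>2) * (g x * V x))"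
      by (simp add: algebra_simps)
    also have "\<dots> \<le> 24 / r^3 * (indicator (cball a r) x * (g x * V x))"
    proof (intro mult_left_mono mult_right_mono)
      have "norm (x - a) \<le> r" if "sd a x \<le> r\<^sup>2"
        using power2_le_imp_le[OF order_trans[OF norm_le_sd that]] r by simp
      then show "of_bool (sd a x \<le> r\<^sup>2) \<le> (indicator (cball a r) x :: real)"
        by (auto simp: indicator_def dist_norm norm_minus_commute)
    qed (use g0[of x] V_pos[of x] r in auto)
    finally show ?thesis .
  qed
  have i1: "integrable lborel (\<lambda>x. g x * L k2 x)"
    by (rule integrable_continuous_support[where R=R], intro continuous_intros L_continuous k2c gc)
      (simp add: L_def k2_def kernel1_def kernel2_def cut)
  have i2: "integrable lborel (\<lambda>x. 3 * e\<^sup>2 * (g x * V x * B x))"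
    unfolding B_def
    by (rule integrable_continuous_support[where R=R], intro continuous_intros V_continuous kernel_continuous[OF e] gc)
      (simp add: cut)
  have i3: "integrable lborel (\<lambda>x. indicator (cball a r) x * (g x * V x))"
  proof -
    have "continuous_on (cball a r) (\<lambda>x. g x * V x)" by (intro continuous_intros V_continuous gc)
    from borel_integrable_compact[OF compact_cball this] show ?thesis by simp
  qed
  have "(\<integral>x. g x * L k2 x + 3 * e\<^sup>2 * (g x * V x * B x) \<partial>lborel)
    \<le> (\<integral>x. 24 / r^3 * (indicator (cball a r) x * (g x * V x)) \<partial>lborel)"
    by (rule integral_mono[OF Bochner_Integration.integrable_add[OF i1 i2] integrable_mult_right[OF i3] ptw])
  then have "(\<integral>x. g x * L k2 x \<partial>lborel) + (\<integral>x. 3 * e\<^sup>2 * (g x * V x * B x) \<partial>lborel)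
    \<le> 24 / r^3 * (\<integral>x. indicator (cball a r) x * (g x * V x) \<partial>lborel)"
    by (simp only: Bochner_Integration.integral_add[OF i1 i2] integral_mult_right_zero)
  ultimately show ?thesis by (simp add: B_def)
qed

end

lemma measure_cball_scale:
  fixes a :: "real^3"
  assumes "r > 0"
  shows "measure lborel (cball a r) = unit_ball_vol 3 * r ^ 3"
  using content_cball[of r a] assms by simp

lemma unit_ball_vol_3_pos: "0 < unit_ball_vol 3"
  by (simp add: unit_ball_vol_def)

context sigma2_solution
begin

text \<open>A Lipschitz constant of x -> (x, Du(x)) when f <= \<open>K\<close>; the Euclidean ball
  of radius d / kap lies in the extrinsic ball of radius d.\<close>

definition kap :: "real \<Rightarrow> real" where "kap K = sqrt (1 + 3 * K\<^sup>2)"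

lemma kap: "1 \<le> kap K" "0 < kap K" "(kap K)\<^sup>2 = 1 + 3 * K\<^sup>2"
proof -
  show "1 \<le> kap K" by (simp add: kap_def)
  then show "0 < kap K" by simp
  show "(kap K)\<^sup>2 = 1 + 3 * K\<^sup>2" by (simp add: kap_def)
qed

lemma sd_le_kap:
  assumes K: "\<And>x. f x \<le> K" and "norm (x - a) \<le> d / kap K" "0 \<le> d"
  shows "sd a x \<le> d\<^sup>2"
proof -
  have "kap K * norm (x - a) \<le> d" using assms(2) kap(2)[of K] by (simp add: pos_le_divide_eq mult.commute)
  then have "(kap K * norm (x - a))\<^sup>2 \<le> d\<^sup>2" using kap(2)[of K] by (intro power_mono) auto
  moreover have "sd a x \<le> (kap K)\<^sup>2 * (norm (x - a))\<^sup>2" unfolding kap(3) by (rule sd_le[OF K])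
  ultimately show ?thesis by (simp add: power_mult_distrib)
qed

lemma integrable_cball:
  assumes "continuous_on UNIV (g :: real^3 \<Rightarrow> real)"
  shows "integrable lborel (\<lambda>x. indicator (cball a r) x * g x)"
  using borel_integrable_compact[OF compact_cball continuous_on_subset[OF assms], of a r] by simp

text \<open>The factors come from \<open>mean_value\<close>: the fraction inverts the kernel mass
  near the centre, 24 is the truncation error, and the last factor bounds \<open>V\<close>. None of
  them depends on the radius.\<close>

definition mvc :: "real \<Rightarrow> real" where
  "mvc K = 12 * K * kap K ^ 3 / unit_ball_vol 3 * 24 * (K + 6 * K ^ 3)"

lemma V_le_K:
  assumes "\<And>x. f x \<le> K"
  shows "V x \<le> K + 6 * K ^ 3"
proof -
  have "V x \<le> f x + 6 * f x ^ 3" by (rule V_le)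
  also have "\<dots> \<le> K + 6 * K ^ 3"
    using assms[of x] f_pos[of x] by (intro add_mono mult_left_mono power_mono) auto
  finally show ?thesis .
qed

text \<open>The mass that the regularised kernel puts on the ball of radius e / kap is bounded below
  independently of \<open>e\<close>. Hence one small \<open>e\<close>, chosen by continuity of
  \<open>g\<close> at \<open>a\<close>, suffices, and no limit is taken.\<close>

lemma mean_value:
  assumes K: "\<And>x. f x \<le> K"
    and g: "has_partials g g1" "\<And>i. has_partials (g1 i) (g2 i)" "\<And>i j. continuous_on UNIV (g2 i j)"
    and g0: "\<And>x. 0 \<le> g x" and Lg: "\<And>x. 0 \<le> L g2 x" and r: "r > 0"
  shows "g a \<le> mvc K / r^3 * (\<integral>x. indicator (cball a r) x * g x \<partial>lborel)"
proof -
  have K0: "K > 0" using K[of a] f_pos[of a] by simp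
  have kp: "0 < kap K" "1 \<le> kap K" by (rule kap)+
  have w: "0 < unit_ball_vol 3" by (rule unit_ball_vol_3_pos)
  have m0: "mvc K \<ge> 0" unfolding mvc_def using K0 kp w by simp
  have gc: "continuous_on UNIV g" by (rule has_partials_continuous[OF g(1)])
  have I0: "0 \<le> (\<integral>x. indicator (cball a r) x * g x \<partial>lborel)"
    by (intro Bochner_Integration.integral_nonneg mult_nonneg_nonneg g0) auto
  show ?thesis
  proof (cases "g a = 0")
    case True
    then show ?thesis using m0 I0 r by simp
  next
    case False
    then have ga: "g a > 0" using g0[of a] by simp
    then obtain d where d: "d > 0" "\<And>x. dist x a < d \<Longrightarrow> dist (g x) (g a) < g a / 2"
      using gc[unfolded continuous_on_iff, rule_format, of a "g a / 2"] by auto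
    \<comment> \<open>Below \<open>d\<close>, so that \<open>g\<close> stays above half of
      \<open>g a\<close>; at most r / 2, so that the cutoff is at least 3/4.\<close>
    define e where "e = min (d / 2) (r / 2)"
    have e: "e > 0" "e < d" "e \<le> r / 2" using d(1) r by (auto simp: e_def)
    define B where "B x = cutoff r (sd a x) ^ 3 * invsqrt e (sd a x) ^ 5" for x
    have B0: "0 \<le> B x" for x
      unfolding B_def using cutoff_bounds(1) invsqrt_pos[OF e(1) sd_nonneg] by (simp add: less_imp_le)
    have lower: "g a / (12 * K * e^3) * indicator (cball a (e / kap K)) x \<le> 3 * e\<^sup>2 * (g x * V x * B x)" for x
    proof (cases "x \<in> cball a (e / kap K)")
      case False
      then show ?thesis using g0[of x] V_pos[of x] B0[of x] by simp
    next
      case True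
      then have n: "norm (x - a) \<le> e / kap K" by (simp add: dist_norm norm_minus_commute)
      have sd: "sd a x \<le> e\<^sup>2" by (rule sd_le_kap[OF K n]) (use e in simp)
      have "e / kap K \<le> e" using kp e by (simp add: divide_le_eq)
      then have "dist x a < d" using n e by (simp add: dist_norm)
      then have "dist (g x) (g a) < g a / 2" by (rule d(2))
      then have gx: "g a / 2 \<le> g x" by (simp add: dist_real_def abs_if split: if_splits)
      have "e\<^sup>2 \<le> (r / 2)\<^sup>2" using e by (intro power_mono) auto
      then have "sd a x / r\<^sup>2 \<le> 1 / 4" using sd r by (simp add: field_simps)
      then have "3 / 4 \<le> 1 - sd a x / r\<^sup>2" by linarith
      then have c: "3 / 4 \<le> cutoff r (sd a x)" unfolding cutoff_def by (rule order_trans) simp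
      \<comment> \<open>Rounding sqrt 2 up to 3/2 keeps the constants rational.\<close>
      have "sqrt (sd a x + e\<^sup>2) \<le> 3 / 2 * e"
      proof (rule real_le_lsqrt)
        have "(3 / 2 * e)\<^sup>2 = 9 / 4 * e\<^sup>2" by (simp add: power2_eq_square)
        then show "sd a x + e\<^sup>2 \<le> (3 / 2 * e)\<^sup>2" using sd zero_le_power2[of e] by linarith
      qed (use e sd_nonneg[of a x] in auto)
      moreover have "0 < sqrt (sd a x + e\<^sup>2)" using sd_nonneg[of a x] e by (simp add: add_nonneg_pos)
      ultimately have "inverse (3 / 2 * e) \<le> invsqrt e (sd a x)"
        unfolding invsqrt_def by (intro le_imp_inverse_le)
      then have i: "2 / (3 * e) \<le> invsqrt e (sd a x)" by (simp add: inverse_eq_divide)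
      have "(3 / 4) ^ 3 * (2 / (3 * e)) ^ 5 \<le> B x"
        unfolding B_def using c i e by (intro mult_mono power_mono) auto
      also have "(3 / 4) ^ 3 * (2 / (3 * e)) ^ 5 = 1 / (18 * e ^ 5)"
        using e by (simp add: field_simps eval_nat_numeral)
      finally have B: "1 / (18 * e ^ 5) \<le> B x" .
      have "1 / K \<le> 1 / f x" using K[of x] f_pos[of x] by (intro divide_left_mono) auto
      then have Vx: "1 / K \<le> V x" using V_ge[of x] by simp
      have "g a / 2 * (1 / K) * (1 / (18 * e ^ 5)) \<le> g x * V x * B x"
        using gx Vx B ga K0 e V_pos[of x] g0[of x] by (intro mult_mono) auto
      then have "3 * e\<^sup>2 * (g a / 2 * (1 / K) * (1 / (18 * e ^ 5))) \<le> 3 * e\<^sup>2 * (g x * V x * B x)"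
        by (intro mult_left_mono) auto
      moreover have "3 * e\<^sup>2 * (g a / 2 * (1 / K) * (1 / (18 * e ^ 5))) = g a / (12 * K * e^3)"
        using e K0 by (simp add: field_simps eval_nat_numeral)
      ultimately show ?thesis using True by simp
    qed
    have iB: "integrable lborel (\<lambda>x. 3 * e\<^sup>2 * (g x * V x * B x))"
      unfolding B_def
      by (rule integrable_continuous_support[where R="norm a + r"],
          intro continuous_intros V_continuous kernel_continuous[OF e(1)] gc)
        (simp add: cutoff_sd_eq_0 r)
    have fin: "integrable lborel (\<lambda>x. g a / (12 * K * e^3) * indicator (cball a (e / kap K)) x)"
      by (intro integrable_mult_right integrable_real_indicator)
        (use emeasure_compact_finite[OF compact_cball] in auto)
    have "(\<integral>x. g a / (12 * K * e^3) * indicator (cball a (e / kap K)) x \<partial>lborel)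
        \<le> (\<integral>x. 3 * e\<^sup>2 * (g x * V x * B x) \<partial>lborel)"
      by (rule integral_mono[OF fin iB lower])
    moreover have "(\<integral>x. g a / (12 * K * e^3) * indicator (cball a (e / kap K)) x \<partial>lborel)
        = g a * (unit_ball_vol 3 / (12 * K * kap K ^ 3))"
    proof -
      have "measure lborel (cball a (e / kap K)) = unit_ball_vol 3 * (e / kap K) ^ 3"
        by (rule measure_cball_scale) (use e kp in simp)
      then show ?thesis using e by (simp add: power_divide)
    qed
    moreover have "0 \<le> (\<integral>x. kernel e r (sd a x) * L g2 x \<partial>lborel)"
      unfolding kernel_def
      using cutoff_bounds(1) invsqrt_pos[OF e(1) sd_nonneg] Lg
      by (intro Bochner_Integration.integral_nonneg mult_nonneg_nonneg) (auto simp: less_imp_le)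
    moreover note kernel_test[OF g g0 r e(1), of a]
    ultimately have "g a * (unit_ball_vol 3 / (12 * K * kap K ^ 3))
        \<le> 24 / r^3 * (\<integral>x. indicator (cball a r) x * (g x * V x) \<partial>lborel)"
      unfolding B_def by linarith
    also have "\<dots> \<le> 24 / r^3 * (\<integral>x. (K + 6 * K^3) * (indicator (cball a r) x * g x) \<partial>lborel)"
    proof (intro mult_left_mono integral_mono integrable_mult_right integrable_cball gc)
      show "continuous_on UNIV (\<lambda>x. g x * V x)" by (intro continuous_intros gc V_continuous)
      fix x
      show "indicator (cball a r) x * (g x * V x) \<le> (K + 6 * K^3) * (indicator (cball a r) x * g x)"
        using mult_right_mono[OF V_le_K[OF K] mult_nonneg_nonneg[OF indicator_pos_le g0[of x]],
            of x "cball a r" x] by (simp add: mult_ac)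
    qed (use r in simp)
    finally have *: "g a * (unit_ball_vol 3 / (12 * K * kap K ^ 3))
        \<le> 24 / r^3 * ((K + 6 * K^3) * (\<integral>x. indicator (cball a r) x * g x \<partial>lborel))" by simp
    have "g a = g a * (unit_ball_vol 3 / (12 * K * kap K ^ 3)) * (12 * K * kap K ^ 3 / unit_ball_vol 3)"
      using less_imp_neq[OF w, symmetric] less_imp_neq[OF K0, symmetric] less_imp_neq[OF kp(1), symmetric] by simp
    also have "\<dots> \<le> 24 / r^3 * ((K + 6 * K^3) * (\<integral>x. indicator (cball a r) x * g x \<partial>lborel))
        * (12 * K * kap K ^ 3 / unit_ball_vol 3)"
      by (intro mult_right_mono *) (use w K0 kp in simp)
    also have "\<dots> = mvc K / r^3 * (\<integral>x. indicator (cball a r) x * g x \<partial>lborel)"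
      by (simp add: mvc_def mult_ac)
    finally show ?thesis .
  qed
qed

lemma mean_value_nn:
  assumes K: "\<And>x. f x \<le> K"
    and g: "has_partials g g1" "\<And>i. has_partials (g1 i) (g2 i)" "\<And>i j. continuous_on UNIV (g2 i j)"
    and g0: "\<And>x. 0 \<le> g x" and Lg: "\<And>x. 0 \<le> L g2 x" and r: "r > 0"
  shows "ennreal (g a) \<le> ennreal (mvc K / r^3) * (\<integral>\<^sup>+x. ennreal (g x) * indicator (cball a r) x \<partial>lborel)"
proof -
  have K0: "K > 0" using K[of a] f_pos[of a] by simp
  have m0: "0 \<le> mvc K / r^3" unfolding mvc_def using K0 kap(2)[of K] unit_ball_vol_3_pos r by simp
  have gc: "continuous_on UNIV g" by (rule has_partials_continuous[OF g(1)])
  have "ennreal (\<integral>x. indicator (cball a r) x * g x \<partial>lborel) = (\<integral>\<^sup>+x. ennreal (indicator (cball a r) x * g x) \<partial>lborel)"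
    by (rule nn_integral_eq_integral[symmetric, OF integrable_cball[OF gc]]) (simp add: g0)
  also have "\<dots> = (\<integral>\<^sup>+x. ennreal (g x) * indicator (cball a r) x \<partial>lborel)"
    by (intro nn_integral_cong) (simp add: indicator_def)
  finally have I: "ennreal (\<integral>x. indicator (cball a r) x * g x \<partial>lborel)
      = (\<integral>\<^sup>+x. ennreal (g x) * indicator (cball a r) x \<partial>lborel)" .
  have "ennreal (g a) \<le> ennreal (mvc K / r^3 * (\<integral>x. indicator (cball a r) x * g x \<partial>lborel))"
    by (rule ennreal_leI[OF mean_value[OF K g g0 Lg r]])
  then show ?thesis unfolding ennreal_mult'[OF m0] I .
qed

text \<open>\<open>kernel_test\<close> with g = f and e = 1. The factor \<open>\<rho>\<close>^-3 on
  the right meets the volume of a ball of radius \<open>\<rho>\<close>, so the bound does not depend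
  on \<open>r\<close>; on the left, the kernel is bounded below by a multiple of the weight.\<close>

lemma energy_bound:
  assumes K: "\<And>x. f x \<le> K"
  shows "\<exists>C. \<forall>r>0. (\<integral>x. indicator (cball 0 r) x * (T2 x / sqrt ((kap K)\<^sup>2 * (norm x)\<^sup>2 + 1)) \<partial>lborel) \<le> C"
proof (intro exI allI impI)
  fix r :: real assume r: "r > 0"
  have K0: "K > 0" using K[of 0] f_pos[of 0] by simp
  have kp: "0 < kap K" by (rule kap)
  \<comment> \<open>With this radius the extrinsic distance is at most \<open>\<rho>\<close> / 2 on
    the ball of radius \<open>r\<close>, so the cutoff is at least 3/4; its cube is the 27/64 in
    \<open>c\<close>.\<close>
  define \<rho> where "\<rho> = 2 * kap K * r"
  have \<rho>: "\<rho> > 0" using r kp by (simp add: \<rho>_def)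
  define W where "W x = T2 x / sqrt ((kap K)\<^sup>2 * (norm x)\<^sup>2 + 1)" for x
  have den: "0 < sqrt ((kap K)\<^sup>2 * (norm x)\<^sup>2 + 1)" for x :: "real^3" by (simp add: add_nonneg_pos)
  have Wc: "continuous_on UNIV W"
    unfolding W_def[abs_def] using den by (intro continuous_intros T2_continuous) (metis less_irrefl)
  define c where "c = 27 / 64 * (2 / K\<^sup>2)"
  have c0: "c > 0" using K0 by (simp add: c_def)
  have Lt: "2 / K\<^sup>2 * T2 x \<le> L theta x" for x
  proof -
    have "2 / K\<^sup>2 \<le> 2 / (f x)\<^sup>2" using K[of x] f_pos[of x] by (intro divide_left_mono power_mono) auto
    then have "2 / K\<^sup>2 * T2 x \<le> 2 / (f x)\<^sup>2 * T2 x" by (rule mult_right_mono) (rule T2_nonneg)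
    then show ?thesis using T2_le_L_f[of x] by simp
  qed
  have Lt0: "0 \<le> L theta x" for x
    by (rule order_trans[OF _ Lt]) (simp add: T2_nonneg)
  have k0: "0 \<le> kernel 1 \<rho> (sd 0 x)" for x
    unfolding kernel_def using cutoff_bounds(1) invsqrt_pos[OF zero_less_one sd_nonneg]
    by (simp add: less_imp_le)
  have lower: "c * (indicator (cball 0 r) x * W x) \<le> kernel 1 \<rho> (sd 0 x) * L theta x" for x
  proof (cases "x \<in> cball 0 r")
    case False
    then show ?thesis using Lt0 k0 by simp
  next
    case True
    have n: "norm (x - 0) \<le> (\<rho> / 2) / kap K" using True kp by (simp add: \<rho>_def)
    have "sd 0 x \<le> (\<rho> / 2)\<^sup>2" by (rule sd_le_kap[OF K n]) (use \<rho> in simp)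
    then have "sd 0 x / \<rho>\<^sup>2 \<le> 1 / 4" using \<rho> by (simp add: field_simps)
    then have "3 / 4 \<le> 1 - sd 0 x / \<rho>\<^sup>2" by linarith
    then have cc: "3 / 4 \<le> cutoff \<rho> (sd 0 x)" unfolding cutoff_def by (rule order_trans) simp
    have "sd 0 x + 1\<^sup>2 \<le> (kap K)\<^sup>2 * (norm x)\<^sup>2 + 1" using sd_le[OF K, of 0 x] by (simp add: kap(3))
    moreover have "0 < sd 0 x + 1\<^sup>2" using sd_nonneg[of 0 x] by simp
    ultimately have i: "1 / sqrt ((kap K)\<^sup>2 * (norm x)\<^sup>2 + 1) \<le> invsqrt 1 (sd 0 x)"
      unfolding invsqrt_def inverse_eq_divide by (intro divide_left_mono) (auto intro: mult_pos_pos den)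
    have "(3 / 4)^3 * (1 / sqrt ((kap K)\<^sup>2 * (norm x)\<^sup>2 + 1)) \<le> kernel 1 \<rho> (sd 0 x)"
      unfolding kernel_def using cc i den[of x] by (intro mult_mono power_mono) auto
    then have "(3 / 4)^3 * (1 / sqrt ((kap K)\<^sup>2 * (norm x)\<^sup>2 + 1)) * (2 / K\<^sup>2 * T2 x) \<le> kernel 1 \<rho> (sd 0 x) * L theta x"
      using Lt[of x] k0[of x] T2_nonneg[of x] by (intro mult_mono) auto
    moreover have "(3 / 4)^3 * (1 / sqrt ((kap K)\<^sup>2 * (norm x)\<^sup>2 + 1)) * (2 / K\<^sup>2 * T2 x) = c * W x"
      by (simp add: c_def W_def power3_eq_cube)
    ultimately show ?thesis using True by simp
  qed
  have "(\<integral>x. c * (indicator (cball 0 r) x * W x) \<partial>lborel) \<le> (\<integral>x. kernel 1 \<rho> (sd 0 x) * L theta x \<partial>lborel)"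
  proof (intro integral_mono lower integrable_mult_right integrable_cball Wc)
    show "integrable lborel (\<lambda>x. kernel 1 \<rho> (sd 0 x) * L theta x)"
      by (rule integrable_continuous_support[where R="norm (0::real^3) + \<rho>"],
          intro continuous_intros L_continuous theta_continuous kernel_continuous[OF zero_less_one])
        (use cutoff_sd_eq_0[OF \<rho>, of 0] in \<open>simp add: kernel_def\<close>)
  qed
  moreover have "0 \<le> (\<integral>x. 3 * 1\<^sup>2 * (f x * V x * (cutoff \<rho> (sd 0 x) ^ 3 * invsqrt 1 (sd 0 x) ^ 5)) \<partial>lborel)"
    using f_pos V_pos cutoff_bounds(1) invsqrt_pos[OF zero_less_one sd_nonneg]
    by (intro Bochner_Integration.integral_nonneg mult_nonneg_nonneg zero_le_power)
      (auto simp: less_imp_le)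
  moreover note kernel_test[OF df dtau theta_continuous less_imp_le[OF f_pos] \<rho> zero_less_one, of 0]
  ultimately have "c * (\<integral>x. indicator (cball 0 r) x * W x \<partial>lborel)
      \<le> 24 / \<rho>^3 * (\<integral>x. indicator (cball 0 \<rho>) x * (f x * V x) \<partial>lborel)"
    by simp
  also have "\<dots> \<le> 24 / \<rho>^3 * (\<integral>x. indicator (cball (0::real^3) \<rho>) x * (K * (K + 6 * K^3)) \<partial>lborel)"
  proof (rule mult_left_mono[OF integral_mono])
    fix x
    have "f x * V x \<le> K * (K + 6 * K^3)"
      using K[of x] f_pos[of x] V_pos[of x] V_le_K[OF K, of x] K0 by (intro mult_mono) auto
    then show "indicator (cball 0 \<rho>) x * (f x * V x) \<le> indicator (cball 0 \<rho>) x * (K * (K + 6 * K^3))"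
      by (intro mult_left_mono) auto
  next
    show "integrable lborel (\<lambda>x. indicator (cball 0 \<rho>) x * (f x * V x))"
      by (intro integrable_cball continuous_intros f_continuous V_continuous)
    show "integrable lborel (\<lambda>x. indicator (cball (0::real^3) \<rho>) x * (K * (K + 6 * K^3)))"
      by (intro integrable_cball continuous_intros)
  qed (use \<rho> in simp)
  also have "\<dots> = 24 * unit_ball_vol 3 * (K * (K + 6 * K^3))"
    using \<rho> measure_cball_scale[OF \<rho>, of 0] by simp
  finally have "(\<integral>x. indicator (cball 0 r) x * W x \<partial>lborel) \<le> 24 * unit_ball_vol 3 * (K * (K + 6 * K^3)) / c"
    using c0 by (simp add: pos_le_divide_eq mult.commute)
  then show "(\<integral>x. indicator (cball 0 r) x * (T2 x / sqrt ((kap K)\<^sup>2 * (norm x)\<^sup>2 + 1)) \<partial>lborel)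
    \<le> 24 * unit_ball_vol 3 * (K * (K + 6 * K^3)) / (27 / 64 * (2 / K\<^sup>2))"
    unfolding W_def c_def .
qed

text \<open>The energy bound on balls by itself makes these quotients merely bounded. It also makes
  the weighted energy integrable over the whole space, and a multiple of its density dominates the
  integrands, which tend to 0 pointwise.\<close>

lemma scaled_energy_tendsto_0:
  assumes K: "\<And>x. f x \<le> K" and c: "c > 0"
  shows "(\<lambda>n. (\<integral>x. indicator (cball 0 (c * real (Suc n))) x * T2 x \<partial>lborel) / real (Suc n)) \<longlonglongrightarrow> 0"
proof -
  define D where "D x = sqrt ((kap K)\<^sup>2 * (norm x)\<^sup>2 + 1)" for x :: "real^3"
  define W where "W x = T2 x / D x" for x
  have D: "0 < D x" for x unfolding D_def by (simp add: add_nonneg_pos)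
  have W0: "0 \<le> W x" for x using D[of x] T2_nonneg[of x] by (simp add: W_def)
  have Dc: "continuous_on UNIV D" unfolding D_def[abs_def] by (intro continuous_intros)
  have Wc: "continuous_on UNIV W"
    unfolding W_def[abs_def] using D by (intro continuous_intros T2_continuous Dc) (metis less_irrefl)
  have [measurable]: "W \<in> borel_measurable borel" "T2 \<in> borel_measurable borel"
    using Wc T2_continuous by (auto intro: borel_measurable_continuous_onI)
  have [measurable]: "cball a q \<in> sets borel" for a :: "real^3" and q by simp
  obtain C where C: "\<And>r. r > 0 \<Longrightarrow> (\<integral>x. indicator (cball 0 r) x * W x \<partial>lborel) \<le> C"
    using energy_bound[OF K] unfolding W_def D_def by blast
  have iW: "integrable lborel W"
  proof (rule integrableI_bounded)
    have "(\<integral>\<^sup>+x. ennreal (norm (W x)) \<partial>lborel)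
        = (\<integral>\<^sup>+x. (SUP n. ennreal (indicator (cball 0 (real (Suc n))) x * W x)) \<partial>lborel)"
    proof (rule nn_integral_cong)
      fix x :: "real^3"
      obtain N where N: "norm x \<le> real N" using real_arch_simple by blast
      have "(SUP n. ennreal (indicator (cball 0 (real (Suc n))) x * W x)) = ennreal (W x)"
      proof (rule SUP_eqI)
        show "ennreal (indicator (cball 0 (real (Suc n))) x * W x) \<le> ennreal (W x)" for n
          using W0[of x] by (intro ennreal_leI) (auto simp: indicator_def)
        fix y assume "\<And>n. n \<in> UNIV \<Longrightarrow> ennreal (indicator (cball 0 (real (Suc n))) x * W x) \<le> y"
        from this[of N] show "ennreal (W x) \<le> y" using N by (simp add: indicator_def)
      qed
      then show "ennreal (norm (W x)) = (SUP n. ennreal (indicator (cball 0 (real (Suc n))) x * W x))"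
        using W0[of x] by simp
    qed
    also have "\<dots> = (SUP n. (\<integral>\<^sup>+x. ennreal (indicator (cball 0 (real (Suc n))) x * W x) \<partial>lborel))"
    proof (rule nn_integral_monotone_convergence_SUP)
      show "incseq (\<lambda>n x. ennreal (indicator (cball 0 (real (Suc n))) x * W x))"
        using W0 by (auto simp: incseq_def le_fun_def indicator_def intro!: ennreal_leI)
    qed measurable
    also have "\<dots> \<le> ennreal C"
    proof (rule SUP_least)
      fix n
      have "(\<integral>\<^sup>+x. ennreal (indicator (cball 0 (real (Suc n))) x * W x) \<partial>lborel)
        = ennreal (\<integral>x. indicator (cball 0 (real (Suc n))) x * W x \<partial>lborel)"
        by (rule nn_integral_eq_integral[OF integrable_cball[OF Wc]]) (simp add: W0)
      also have "\<dots> \<le> ennreal C" by (intro ennreal_leI C) simp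
      finally show "(\<integral>\<^sup>+x. ennreal (indicator (cball 0 (real (Suc n))) x * W x) \<partial>lborel) \<le> ennreal C" .
    qed
    finally show "(\<integral>\<^sup>+x. ennreal (norm (W x)) \<partial>lborel) < \<infinity>"
      by (rule le_less_trans) simp
  qed measurable
  have "(\<lambda>n. \<integral>x. indicator (cball 0 (c * real (Suc n))) x * T2 x / real (Suc n) \<partial>lborel) \<longlonglongrightarrow> (\<integral>x. 0 \<partial>(lborel :: (real^3) measure))"
  proof (rule integral_dominated_convergence[where w="\<lambda>x. (kap K * c + 1) * W x"])
    show "integrable lborel (\<lambda>x. (kap K * c + 1) * W x)" using iW by simp
    show "AE x in lborel. (\<lambda>n. indicator (cball 0 (c * real (Suc n))) x * T2 x / real (Suc n)) \<longlonglongrightarrow> 0"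
    proof (rule AE_I2)
      fix x
      show "(\<lambda>n. indicator (cball 0 (c * real (Suc n))) x * T2 x / real (Suc n)) \<longlonglongrightarrow> 0"
      proof (rule Lim_null_comparison)
        show "\<forall>\<^sub>F n in sequentially. norm (indicator (cball 0 (c * real (Suc n))) x * T2 x / real (Suc n))
            \<le> T2 x * inverse (real (Suc n))"
          using T2_nonneg[of x] by (auto simp: indicator_def divide_inverse)
        show "(\<lambda>n. T2 x * inverse (real (Suc n))) \<longlonglongrightarrow> 0"
          using tendsto_mult_right_zero[OF LIMSEQ_inverse_real_of_nat] by simp
      qed
    qed
    show "AE x in lborel. norm (indicator (cball 0 (c * real (Suc n))) x * T2 x / real (Suc n))
        \<le> (kap K * c + 1) * W x" for n
    proof (rule AE_I2)
      fix x
      show "norm (indicator (cball 0 (c * real (Suc n))) x * T2 x / real (Suc n)) \<le> (kap K * c + 1) * W x"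
      proof (cases "x \<in> cball 0 (c * real (Suc n))")
        case False
        then show ?thesis using W0[of x] kap(2)[of K] c by simp
      next
        case True
        \<comment> \<open>On the ball of radius c (n + 1) the weight \<open>D\<close> grows at most
          linearly in n + 1, which is what the division by n + 1 pays for.\<close>
        have "D x \<le> kap K * norm x + 1"
        proof (unfold D_def, rule real_le_lsqrt)
          show "(kap K)\<^sup>2 * (norm x)\<^sup>2 + 1 \<le> (kap K * norm x + 1)\<^sup>2"
            using kap(2)[of K] by (simp add: power2_eq_square algebra_simps)
        qed (use kap(2)[of K] in auto)
        also have "\<dots> \<le> kap K * (c * real (Suc n)) + real (Suc n)"
          using True kap(2)[of K] by (intro add_mono mult_left_mono) auto
        also have "\<dots> = (kap K * c + 1) * real (Suc n)" by (simp add: algebra_simps)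
        finally have "D x * W x \<le> (kap K * c + 1) * real (Suc n) * W x"
          by (rule mult_right_mono) (rule W0)
        moreover have "D x * W x = T2 x" using D[of x] by (simp add: W_def)
        ultimately have "T2 x / real (Suc n) \<le> (kap K * c + 1) * W x"
          by (simp add: divide_le_eq mult_ac)
        then show ?thesis using True T2_nonneg[of x] by simp
      qed
    qed
  qed measurable
  then show ?thesis by simp
qed

end

section \<open>Bounded Hessians are constant\<close>

text \<open>The reversed Cauchy-Schwarz inequality of the Lorentzian form, with \<open>a\<close> and
  \<open>b\<close> the traces and \<open>c\<close> the inner product of two Hessians. It follows
  from (a^2 - 2) (b^2 - 2) = (a b - 2)^2 - 2 (a - b)^2, whose last term also settles the equality
  case.\<close>

lemma two_variable_defect:
  fixes a b c :: real
  assumes a: "a > 0" "2 \<le> a\<^sup>2" and b: "b > 0" "2 \<le> b\<^sup>2" and c: "c\<^sup>2 \<le> (a\<^sup>2 - 2) * (b\<^sup>2 - 2)"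
  shows "c \<le> a * b - 2" and "c = a * b - 2 \<Longrightarrow> a = b"
proof -
  have "2 * 2 \<le> a\<^sup>2 * b\<^sup>2" using a b by (intro mult_mono) auto
  then have "2\<^sup>2 \<le> (a * b)\<^sup>2" by (simp add: power_mult_distrib)
  then have ab: "2 \<le> a * b" using a b by (intro power2_le_imp_le[of 2 "a * b"]) auto
  have eq: "(a\<^sup>2 - 2) * (b\<^sup>2 - 2) = (a * b - 2)\<^sup>2 - 2 * (a - b)\<^sup>2"
    by (simp add: power2_eq_square algebra_simps)
  have "c\<^sup>2 \<le> (a * b - 2)\<^sup>2" using c unfolding eq using zero_le_power2[of "a - b"] by linarith
  then show "c \<le> a * b - 2" using ab power2_le_imp_le[of c "a * b - 2"] by simp
  assume "c = a * b - 2"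
  then have "(a - b)\<^sup>2 \<le> 0" using c unfolding eq by simp
  then show "a = b" by simp
qed

lemma nn_integral_double_sum:
  fixes e :: "'i::finite \<Rightarrow> 'j::finite \<Rightarrow> 'a \<Rightarrow> ennreal"
  assumes [measurable]: "\<And>i j. e i j \<in> borel_measurable M"
  shows "(\<integral>\<^sup>+x. (\<Sum>i\<in>UNIV. \<Sum>j\<in>UNIV. e i j x) \<partial>M) = (\<Sum>i\<in>UNIV. \<Sum>j\<in>UNIV. (\<integral>\<^sup>+x. e i j x \<partial>M))"
  by (simp add: nn_integral_sum)

context sigma2_solution
begin

text \<open>-sigma_2 of the difference, expanded with sigma_2 = 1 at both points. In this form it is
  affine in D^2u(x) for fixed \<open>y\<close>, so that \<open>L\<close> of it is linear in the
  source terms \<open>N\<close>.\<close>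

definition psi :: "real^3 \<Rightarrow> real^3 \<Rightarrow> real" where
  "psi y x = f y * f x - (\<Sum>i\<in>UNIV. \<Sum>j\<in>UNIV. h i j y * h i j x) - 2"
definition S :: "real^3 \<Rightarrow> real^3 \<Rightarrow> real" where
  "S y x = (\<Sum>i\<in>UNIV. \<Sum>j\<in>UNIV. (h i j y - h i j x)\<^sup>2)"

lemma psi_sym: "psi y x = psi x y"
  by (simp add: psi_def mult.commute)

lemma psi_eq: "2 * psi y x = S y x - (f y - f x)\<^sup>2"
proof -
  have "S y x = (\<Sum>i\<in>UNIV. \<Sum>j\<in>UNIV. (h i j y)\<^sup>2) + (\<Sum>i\<in>UNIV. \<Sum>j\<in>UNIV. (h i j x)\<^sup>2)
      - 2 * (\<Sum>i\<in>UNIV. \<Sum>j\<in>UNIV. h i j y * h i j x)"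
    by (simp add: S_def power2_diff sum.distrib sum_subtractf sum_distrib_left mult.assoc)
  then show ?thesis unfolding h_norm by (simp add: psi_def power2_eq_square algebra_simps)
qed

lemma psi_defect:
  "(\<Sum>i\<in>UNIV. \<Sum>j\<in>UNIV. h i j y * h i j x)\<^sup>2 \<le> ((f y)\<^sup>2 - 2) * ((f x)\<^sup>2 - 2)"
  using Cauchy_Schwarz_double_sum[of "\<lambda>i j. h i j y" "\<lambda>i j. h i j x"] by (simp add: h_norm)

lemma psi_nonneg: "0 \<le> psi y x"
  using two_variable_defect(1)[OF f_pos f_sq_ge f_pos f_sq_ge psi_defect[of y x]]
  by (simp add: psi_def)

lemma psi_eq_0D:
  assumes "psi y x = 0"
  shows "h i j y = h i j x"
proof -
  have "f y = f x"
    using two_variable_defect(2)[OF f_pos f_sq_ge f_pos f_sq_ge psi_defect[of y x]] assms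
    by (simp add: psi_def)
  then have "S y x = 0" using psi_eq[of y x] assms by simp
  then have "(\<Sum>j\<in>UNIV. (h i j y - h i j x)\<^sup>2) = 0"
    unfolding S_def by (subst (asm) sum_nonneg_eq_0_iff) (auto intro: sum_nonneg)
  then show ?thesis by (simp add: sum_nonneg_eq_0_iff)
qed

lemma psi_partials:
  "has_partials (psi y) (\<lambda>k x. f y * tau k x - (\<Sum>i\<in>UNIV. \<Sum>j\<in>UNIV. h i j y * t i j k x))"
  "has_partials (\<lambda>x. f y * tau k x - (\<Sum>i\<in>UNIV. \<Sum>j\<in>UNIV. h i j y * t i j k x))
    (\<lambda>l x. f y * theta k l x - (\<Sum>i\<in>UNIV. \<Sum>j\<in>UNIV. h i j y * q i j k l x))"
proof -
  have "has_partials (\<lambda>x. f y * f x - (\<Sum>i\<in>UNIV. \<Sum>j\<in>UNIV. h i j y * h i j x) - 2)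
    (\<lambda>k x. f y * tau k x - (\<Sum>i\<in>UNIV. \<Sum>j\<in>UNIV. h i j y * t i j k x) - 0)"
    by (intro has_partials_diff has_partials_cmult has_partials_sum has_partials_const df dh)
  then show "has_partials (psi y) (\<lambda>k x. f y * tau k x - (\<Sum>i\<in>UNIV. \<Sum>j\<in>UNIV. h i j y * t i j k x))"
    by (simp add: psi_def[abs_def])
  show "has_partials (\<lambda>x. f y * tau k x - (\<Sum>i\<in>UNIV. \<Sum>j\<in>UNIV. h i j y * t i j k x))
    (\<lambda>l x. f y * theta k l x - (\<Sum>i\<in>UNIV. \<Sum>j\<in>UNIV. h i j y * q i j k l x))"
    by (intro has_partials_diff has_partials_cmult has_partials_sum dtau dt)
qed

text \<open>L psi is the pairing of f I - D^2u at \<open>y\<close> with the source matrix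
  \<open>N\<close> at \<open>x\<close>. The latter is positive semidefinite, and the Frobenius norm
  of the Hessian at \<open>y\<close> is at most \<open>f y\<close>, so
  \<open>psd_pairing_nonneg\<close> applies across the two points.\<close>

lemma L_psi_nonneg:
  "0 \<le> L (\<lambda>k l x. f y * theta k l x - (\<Sum>i\<in>UNIV. \<Sum>j\<in>UNIV. h i j y * q i j k l x)) x"
proof -
  have "L (\<lambda>k l x. f y * theta k l x - (\<Sum>i\<in>UNIV. \<Sum>j\<in>UNIV. h i j y * q i j k l x)) x
    = f y * L theta x - (\<Sum>k\<in>UNIV. \<Sum>l\<in>UNIV. \<Sum>i\<in>UNIV. \<Sum>j\<in>UNIV. h i j y * (F k l x * q i j k l x))"
    by (simp add: L_def right_diff_distrib sum_subtractf sum_distrib_left mult_ac)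
  also have "(\<Sum>k\<in>UNIV. \<Sum>l\<in>UNIV. \<Sum>i\<in>UNIV. \<Sum>j\<in>UNIV. h i j y * (F k l x * q i j k l x))
    = (\<Sum>i\<in>UNIV. \<Sum>j\<in>UNIV. \<Sum>k\<in>UNIV. \<Sum>l\<in>UNIV. h i j y * (F k l x * q i j k l x))"
    by (subst (2) sum.swap, subst (3) sum.swap, subst sum.swap, subst (2) sum.swap) (rule refl)
  also have "\<dots> = (\<Sum>i\<in>UNIV. \<Sum>j\<in>UNIV. h i j y * N i j x)"
    by (simp add: L_h[symmetric] L_def sum_distrib_left)
  finally have *: "L (\<lambda>k l x. f y * theta k l x - (\<Sum>i\<in>UNIV. \<Sum>j\<in>UNIV. h i j y * q i j k l x)) x
    = f y * (\<Sum>k\<in>UNIV. N k k x) - (\<Sum>i\<in>UNIV. \<Sum>j\<in>UNIV. h i j y * N i j x)"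
    by (simp add: L_f)
  have "(\<Sum>i\<in>UNIV. \<Sum>j\<in>UNIV. h i j y * N i j x) \<le> f y * (\<Sum>k\<in>UNIV. N k k x)"
    by (rule psd_pairing_nonneg[OF N_psd N_sym]) (use f_pos[of y] in \<open>auto simp: h_norm\<close>)
  then show ?thesis unfolding * by simp
qed

lemma psi_mean_value:
  assumes K: "\<And>x. f x \<le> K" and r: "r > 0"
  shows "ennreal (psi y a) \<le> ennreal (mvc K / r^3) * (\<integral>\<^sup>+x. ennreal (psi y x) * indicator (cball a r) x \<partial>lborel)"
  by (rule mean_value_nn[OF K psi_partials _ psi_nonneg L_psi_nonneg r])
    (intro continuous_intros theta_continuous q_continuous)

lemma S_poincare:
  "(\<integral>\<^sup>+x. ennreal (S (x + z) x) * indicator (cball c r) x \<partial>lborel)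
    \<le> ennreal ((norm z)\<^sup>2) * (\<integral>\<^sup>+x. ennreal (T2 x) * indicator (cball c (r + norm z)) x \<partial>lborel)"
proof -
  have [measurable]: "h i j \<in> borel_measurable borel" "t i j k \<in> borel_measurable borel" for i j k
    using h_continuous t_continuous by (auto intro: borel_measurable_continuous_onI)
  have [measurable]: "cball a q \<in> sets borel" for a :: "real^3" and q by simp
  have "(\<integral>\<^sup>+x. ennreal (S (x + z) x) * indicator (cball c r) x \<partial>lborel)
    = (\<integral>\<^sup>+x. (\<Sum>i\<in>UNIV. \<Sum>j\<in>UNIV. ennreal ((h i j (x + z) - h i j x)\<^sup>2) * indicator (cball c r) x) \<partial>lborel)"
    by (simp add: S_def sum_nonneg sum_distrib_right flip: sum_ennreal)
  also have "\<dots> = (\<Sum>i\<in>UNIV. \<Sum>j\<in>UNIV. (\<integral>\<^sup>+x. ennreal ((h i j (x + z) - h i j x)\<^sup>2) * indicator (cball c r) x \<partial>lborel))"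
    by (rule nn_integral_double_sum) measurable
  also have "\<dots> \<le> (\<Sum>i\<in>UNIV. \<Sum>j\<in>UNIV. ennreal ((norm z)\<^sup>2) *
      (\<integral>\<^sup>+x. ennreal (\<Sum>k\<in>UNIV. (t i j k x)\<^sup>2) * indicator (cball c (r + norm z)) x \<partial>lborel))"
    by (intro sum_mono translation_poincare[OF dh t_continuous])
  also have "\<dots> = ennreal ((norm z)\<^sup>2) * (\<Sum>i\<in>UNIV. \<Sum>j\<in>UNIV.
      (\<integral>\<^sup>+x. ennreal (\<Sum>k\<in>UNIV. (t i j k x)\<^sup>2) * indicator (cball c (r + norm z)) x \<partial>lborel))"
    by (simp only: sum_distrib_left)
  also have "(\<Sum>i\<in>UNIV. \<Sum>j\<in>UNIV.
      (\<integral>\<^sup>+x. ennreal (\<Sum>k\<in>UNIV. (t i j k x)\<^sup>2) * indicator (cball c (r + norm z)) x \<partial>lborel))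
    = (\<integral>\<^sup>+x. (\<Sum>i\<in>UNIV. \<Sum>j\<in>UNIV. ennreal (\<Sum>k\<in>UNIV. (t i j k x)\<^sup>2) * indicator (cball c (r + norm z)) x) \<partial>lborel)"
    by (rule nn_integral_double_sum[symmetric]) measurable
  also have "\<dots> = (\<integral>\<^sup>+x. ennreal (T2 x) * indicator (cball c (r + norm z)) x \<partial>lborel)"
    by (simp add: T2_def sum_nonneg sum_distrib_right flip: sum_ennreal)
  finally show ?thesis .
qed

text \<open>After the mean value inequality in each variable, the double integral is rewritten in
  \<open>x\<close> and the difference z = y - x, so that the Poincare estimate applies for each
  \<open>z\<close>. The constant collects 1/2 from \<open>psiS\<close>, 9 from (3 r)^2 and 27 from
  the volume of the ball of radius 3 r.\<close>

lemma psi_le_energy: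
  assumes K: "\<And>x. f x \<le> K" and r: "r > 0" "norm a + norm b \<le> r"
  shows "psi b a \<le> 243 / 2 * (mvc K)\<^sup>2 * unit_ball_vol 3 * ((\<integral>x. indicator (cball 0 (5 * r)) x * T2 x \<partial>lborel) / r)"
proof -
  have [measurable]: "h i j \<in> borel_measurable borel" "f \<in> borel_measurable borel" "T2 \<in> borel_measurable borel" for i j
    using h_continuous f_continuous T2_continuous by (auto intro: borel_measurable_continuous_onI)
  have [measurable]: "cball a q \<in> sets borel" for a :: "real^3" and q by simp
  have [measurable]: "(\<lambda>(x, y). S x y) \<in> borel_measurable (borel \<Otimes>\<^sub>M borel)" unfolding S_def by measurable
  have m0: "mvc K \<ge> 0"
    unfolding mvc_def using f_pos[of 0] K[of 0] kap(2)[of K] unit_ball_vol_3_pos by simp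
  define m where "m = ennreal (mvc K / r^3)"
  define E where "E = (\<integral>\<^sup>+x. ennreal (T2 x) * indicator (cball 0 (5 * r)) x \<partial>lborel)"
  have E: "E = ennreal (\<integral>x. indicator (cball 0 (5 * r)) x * T2 x \<partial>lborel)"
  proof -
    have "ennreal (\<integral>x. indicator (cball 0 (5 * r)) x * T2 x \<partial>lborel)
        = (\<integral>\<^sup>+x. ennreal (indicator (cball 0 (5 * r)) x * T2 x) \<partial>lborel)"
      by (rule nn_integral_eq_integral[symmetric, OF integrable_cball[OF T2_continuous]]) (simp add: T2_nonneg)
    also have "\<dots> = E"
      unfolding E_def by (intro nn_integral_cong) (simp add: indicator_def)
    finally show ?thesis by simp
  qed
  have psiS: "psi x y \<le> 1 / 2 * S (x + (y - x)) x" for x y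
  proof -
    have "S x y = S y x" by (simp add: S_def power2_commute)
    moreover have "2 * psi x y \<le> S x y" using psi_eq[of x y] zero_le_power2[of "f x - f y"] by linarith
    ultimately show ?thesis by simp
  qed
  \<comment> \<open>\<open>y\<close> - \<open>x\<close> has norm at most r + |b| + |a| + r <= 3 r.
    The Poincare estimate then enlarges the ball around \<open>a\<close> to radius 4 r, which fits
    into radius 5 r around 0.\<close>
  define k where "k x z = ennreal (S (x + z) x) * indicator (cball a r) x * indicator (cball 0 (3 * r)) z" for x z
  have [measurable]: "case_prod k \<in> borel_measurable (borel \<Otimes>\<^sub>M borel)"
    unfolding k_def S_def by measurable
  have inner: "ennreal (psi b x) * indicator (cball a r) x
      \<le> m * ennreal (1 / 2) * (\<integral>\<^sup>+z. k x z \<partial>lborel)" for x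
  proof (cases "x \<in> cball a r")
    case True
    \<comment> \<open>By symmetry \<open>psi\<close> is also a subsolution in its first
      argument.\<close>
    have "ennreal (psi b x) = ennreal (psi x b)" by (simp add: psi_sym)
    also have "\<dots> \<le> m * (\<integral>\<^sup>+y. ennreal (psi x y) * indicator (cball b r) y \<partial>lborel)"
      unfolding m_def by (rule psi_mean_value[OF K r(1)])
    also have "(\<integral>\<^sup>+y. ennreal (psi x y) * indicator (cball b r) y \<partial>lborel)
        \<le> (\<integral>\<^sup>+y. ennreal (1 / 2) * k x (y - x) \<partial>lborel)"
    proof (rule nn_integral_mono)
      fix y
      show "ennreal (psi x y) * indicator (cball b r) y \<le> ennreal (1 / 2) * k x (y - x)"
      proof (cases "y \<in> cball b r")
        case y: True
        have "norm (y - x) \<le> norm (y - b) + norm b + norm a + norm (x - a)"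
          using norm_triangle_ineq4[of "y - b + b" "x - a + a"] norm_triangle_ineq[of "y - b" b]
            norm_triangle_ineq[of "x - a" a] by simp
        then have "y - x \<in> cball 0 (3 * r)"
          using True y r(2) by (simp add: dist_norm norm_minus_commute)
        moreover have "ennreal (psi x y) \<le> ennreal (1 / 2 * S (x + (y - x)) x)"
          by (rule ennreal_leI[OF psiS])
        moreover have "ennreal (1 / 2 * S (x + (y - x)) x) = ennreal (1 / 2) * ennreal (S (x + (y - x)) x)"
          by (rule ennreal_mult') simp
        ultimately show ?thesis using True y by (simp add: k_def)
      qed simp
    qed
    also have "\<dots> = ennreal (1 / 2) * (\<integral>\<^sup>+y. k x (y - x) \<partial>lborel)"
      by (rule nn_integral_cmult) measurable
    also have "(\<integral>\<^sup>+y. k x (y - x) \<partial>lborel) = (\<integral>\<^sup>+z. k x z \<partial>lborel)"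
      using nn_integral_lborel_translate[of "k x" "- x"] by simp
    finally show ?thesis using True by (simp add: mult.assoc mult_left_mono)
  qed simp
  have "ennreal (psi b a) \<le> m * (\<integral>\<^sup>+x. ennreal (psi b x) * indicator (cball a r) x \<partial>lborel)"
    unfolding m_def by (rule psi_mean_value[OF K r(1)])
  also have "\<dots> \<le> m * (\<integral>\<^sup>+x. m * ennreal (1 / 2) * (\<integral>\<^sup>+z. k x z \<partial>lborel) \<partial>lborel)"
    by (intro mult_left_mono nn_integral_mono inner) auto
  also have "(\<integral>\<^sup>+x. m * ennreal (1 / 2) * (\<integral>\<^sup>+z. k x z \<partial>lborel) \<partial>lborel)
      = m * ennreal (1 / 2) * (\<integral>\<^sup>+x. (\<integral>\<^sup>+z. k x z \<partial>lborel) \<partial>lborel)"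
    by (rule nn_integral_cmult) measurable
  also have "(\<integral>\<^sup>+x. (\<integral>\<^sup>+z. k x z \<partial>lborel) \<partial>lborel) = (\<integral>\<^sup>+z. (\<integral>\<^sup>+x. k x z \<partial>lborel) \<partial>lborel)"
    by (rule lborel_pair.Fubini'[symmetric]) measurable
  also have "\<dots> \<le> (\<integral>\<^sup>+z. ennreal ((3 * r)\<^sup>2) * E * indicator (cball (0::real^3) (3 * r)) z \<partial>lborel)"
  proof (rule nn_integral_mono)
    fix z :: "real^3"
    show "(\<integral>\<^sup>+x. k x z \<partial>lborel) \<le> ennreal ((3 * r)\<^sup>2) * E * indicator (cball 0 (3 * r)) z"
    proof (cases "z \<in> cball 0 (3 * r)")
      case True
      have sub: "cball a (r + norm z) \<subseteq> cball 0 (5 * r)"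
      proof
        fix y assume "y \<in> cball a (r + norm z)"
        then have "norm (y - a) \<le> r + norm z" by (simp add: dist_norm norm_minus_commute)
        moreover have "norm y \<le> norm (y - a) + norm a" using norm_triangle_ineq[of "y - a" a] by simp
        moreover have "norm z \<le> 3 * r" using True by simp
        ultimately have "norm y \<le> 5 * r" using r(2) norm_ge_zero[of b] by linarith
        then show "y \<in> cball 0 (5 * r)" by simp
      qed
      have "(\<integral>\<^sup>+x. k x z \<partial>lborel) = (\<integral>\<^sup>+x. ennreal (S (x + z) x) * indicator (cball a r) x \<partial>lborel)"
        using True by (simp add: k_def)
      also have "\<dots> \<le> ennreal ((norm z)\<^sup>2) * (\<integral>\<^sup>+x. ennreal (T2 x) * indicator (cball a (r + norm z)) x \<partial>lborel)"
        by (rule S_poincare)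
      also have "\<dots> \<le> ennreal ((3 * r)\<^sup>2) * E"
        unfolding E_def
      proof (intro mult_mono nn_integral_mono ennreal_leI power_mono)
        show "norm z \<le> 3 * r" using True by simp
        show "indicator (cball a (r + norm z)) x \<le> (indicator (cball 0 (5 * r)) x :: ennreal)" for x
          using sub by (auto simp: indicator_def)
      qed auto
      finally show ?thesis using True by simp
    qed (simp add: k_def)
  qed
  also have "\<dots> = ennreal ((3 * r)\<^sup>2) * E * emeasure lborel (cball (0::real^3) (3 * r))"
    by (rule nn_integral_cmult_indicator) simp
  also have "emeasure lborel (cball (0::real^3) (3 * r)) = ennreal (unit_ball_vol 3 * (3 * r) ^ 3)"
    using emeasure_cball[of "3 * r" "0::real^3"] r by simp
  finally have "ennreal (psi b a) \<le> m * (m * ennreal (1 / 2) * (ennreal ((3 * r)\<^sup>2) * E * ennreal (unit_ball_vol 3 * (3 * r) ^ 3)))"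
    by (simp add: mult_left_mono)
  also have "\<dots> = ennreal (mvc K / r^3 * (mvc K / r^3 * (1 / 2) * ((3 * r)\<^sup>2 *
      (\<integral>x. indicator (cball 0 (5 * r)) x * T2 x \<partial>lborel) * (unit_ball_vol 3 * (3 * r) ^ 3))))"
  proof -
    have "0 \<le> (\<integral>x. indicator (cball 0 (5 * r)) x * T2 x \<partial>lborel)"
      by (intro Bochner_Integration.integral_nonneg mult_nonneg_nonneg T2_nonneg) auto
    then show ?thesis
      unfolding m_def E using m0 r(1) unit_ball_vol_3_pos
      by (simp only: ennreal_mult' ennreal_mult'' mult_nonneg_nonneg divide_nonneg_nonneg zero_le_power
          zero_le_power2 less_imp_le zero_le_divide_1_iff zero_le_numeral)
  qed
  finally have "psi b a \<le> mvc K / r^3 * (mvc K / r^3 * (1 / 2) * ((3 * r)\<^sup>2 *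
      (\<integral>x. indicator (cball 0 (5 * r)) x * T2 x \<partial>lborel) * (unit_ball_vol 3 * (3 * r) ^ 3)))"
  proof (rule ennreal_le_iff[THEN iffD1, rotated])
    have "0 \<le> (\<integral>x. indicator (cball 0 (5 * r)) x * T2 x \<partial>lborel)"
      by (intro Bochner_Integration.integral_nonneg mult_nonneg_nonneg T2_nonneg) auto
    then show "0 \<le> mvc K / r^3 * (mvc K / r^3 * (1 / 2) * ((3 * r)\<^sup>2 *
      (\<integral>x. indicator (cball 0 (5 * r)) x * T2 x \<partial>lborel) * (unit_ball_vol 3 * (3 * r) ^ 3)))"
      using m0 r(1) unit_ball_vol_3_pos by (intro mult_nonneg_nonneg divide_nonneg_nonneg zero_le_power) auto
  qed
  also have "\<dots> = 243 / 2 * (mvc K)\<^sup>2 * unit_ball_vol 3 * ((\<integral>x. indicator (cball 0 (5 * r)) x * T2 x \<partial>lborel) / r)"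
    using r(1) by (simp add: field_simps eval_nat_numeral)
  finally show ?thesis .
qed

lemma bounded_hessian_constant:
  assumes K: "\<And>x. f x \<le> K"
  shows "h i j b = h i j a"
proof (rule psi_eq_0D)
  define c where "c = 243 / 2 * (mvc K)\<^sup>2 * unit_ball_vol 3"
  define I where "I r = (\<integral>x. indicator (cball 0 (5 * r)) x * T2 x \<partial>lborel)" for r
  have "(\<lambda>n. I (real (Suc n)) / real (Suc n)) \<longlonglongrightarrow> 0"
    unfolding I_def by (rule scaled_energy_tendsto_0[OF K]) simp
  then have "(\<lambda>n. c * (I (real (Suc n)) / real (Suc n))) \<longlonglongrightarrow> c * 0"
    by (rule tendsto_mult_left)
  moreover have "\<forall>\<^sub>F n in sequentially. psi b a \<le> c * (I (real (Suc n)) / real (Suc n))"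
  proof -
    obtain n0 where n0: "norm a + norm b \<le> real n0" using real_arch_simple by blast
    show ?thesis
    proof (rule eventually_sequentiallyI[of n0])
      fix n assume "n0 \<le> n"
      then have "norm a + norm b \<le> real (Suc n)" using n0 by simp
      then show "psi b a \<le> c * (I (real (Suc n)) / real (Suc n))"
        unfolding c_def I_def by (intro psi_le_energy[OF K]) auto
    qed
  qed
  ultimately have "psi b a \<le> 0"
    using tendsto_lowerbound[of "\<lambda>n. c * (I (real (Suc n)) / real (Suc n))" "c * 0" sequentially "psi b a"] by simp
  then show "psi b a = 0" using psi_nonneg[of b a] by simp
qed

end

section \<open>The Pogorelov estimate\<close>

lemma second_derivative_local_max:
  fixes \<phi> :: "real \<Rightarrow> real"
  assumes d: "d > 0" and \<phi>: "\<And>s. \<bar>s\<bar> < d \<Longrightarrow> (\<phi> has_real_derivative \<phi>1 s) (at s)"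
    and \<phi>1: "(\<phi>1 has_real_derivative l) (at 0)" and max: "\<And>s. \<bar>s\<bar> < d \<Longrightarrow> \<phi> s \<le> \<phi> 0"
  shows "\<phi>1 0 = 0" and "l \<le> 0"
proof -
  show z: "\<phi>1 0 = 0"
    by (rule DERIV_local_max[OF \<phi> d]) (use d max in auto)
  show "l \<le> 0"
  proof (rule ccontr)
    assume "\<not> l \<le> 0"
    then obtain e where e: "e > 0" "\<And>s. 0 < s \<Longrightarrow> s < e \<Longrightarrow> \<phi>1 0 < \<phi>1 (0 + s)"
      using DERIV_pos_inc_right[OF \<phi>1] by auto
    define s where "s = min d e / 2"
    have s: "s > 0" "s < d" "s < e" using d e(1) by (auto simp: s_def)
    obtain y where y: "0 < y" "y < s" "\<phi> s - \<phi> 0 = (s - 0) * \<phi>1 y"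
      using MVT2[OF s(1), of \<phi> \<phi>1] \<phi> s by force
    have "\<phi>1 y > 0" using e(2)[of y] y s z by simp
    then have "\<phi> s > \<phi> 0" using y s by (metis diff_gt_0_iff_gt diff_zero mult_pos_pos)
    then show False using max[of s] s by simp
  qed
qed

context sigma2_solution
begin

lemma theta_sym: "theta i j x = theta j i x"
  by (rule mixed_partials_commute[OF df dtau theta_continuous])

lemma Fq_add_le: "Fq x (\<lambda>i. v i + w i) \<le> 2 * Fq x v + 2 * Fq x w"
proof -
  have "Fq x (\<lambda>i. v i + w i) + Fq x (\<lambda>i. v i - w i) = 2 * Fq x v + 2 * Fq x w"
    by (simp add: Fq_eq sum_distrib_left sum.distrib[symmetric] algebra_simps)
  then show ?thesis using Fq_nonneg[of x "\<lambda>i. v i - w i"] by linarith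
qed

lemma L_h_eq_2: "L h x = 2"
  unfolding L_eq using sigma2[of x] by (simp add: f_def power2_eq_square)

text \<open>The exponent 6 is the smallest that works: at the critical point the term with Du equals
  1/6 of the form of grad f / f + dl x, the parallelogram law doubles this, and 2/6 is the surplus
  1/3 of the Jacobi inequality. The weight exp contributes -2 dl f, half of which absorbs the term
  in dl x.\<close>

lemma pogorelov_critical_point:
  assumes ut: "u m < T" and dl: "dl > 0"
    and max: "\<forall>\<^sub>F x in at m. (T - u x)^6 * f x * exp (dl * (norm x)\<^sup>2 / 2)
        \<le> (T - u m)^6 * f m * exp (dl * (norm m)\<^sup>2 / 2)"
    and m: "4 * dl * (norm m)\<^sup>2 \<le> 6"
  shows "f m * (T - u m) \<le> 12 / dl"
proof -
  \<comment> \<open>The logarithm of the maximised function, defined near \<open>m\<close>, where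
    \<open>u\<close> stays below \<open>T\<close>.\<close>
  define P where "P x = 6 * ln (T - u x) + ln (f x) + dl * ((norm x)\<^sup>2 / 2)" for x
  have Pe: "exp (P x) = (T - u x)^6 * f x * exp (dl * (norm x)\<^sup>2 / 2)" if "u x < T" for x
  proof -
    have "exp (6 * ln (T - u x)) = (T - u x) ^ 6"
      using that exp_of_nat_mult[of 6 "ln (T - u x)"] by simp
    then show ?thesis using f_pos[of x] by (simp add: P_def exp_add)
  qed
  have "\<forall>\<^sub>F x in at m. u x < T"
    by (rule order_tendstoD[OF _ ut]) (use u_continuous[of UNIV] in \<open>simp add: continuous_on_def\<close>)
  with max have "\<forall>\<^sub>F x in at m. u x < T \<and> P x \<le> P m"
  proof eventually_elim
    case (elim x)
    then have "exp (P x) \<le> exp (P m)" using Pe ut by simp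
    then show ?case using elim by simp
  qed
  then obtain d where d: "d > 0" "\<And>x. x \<noteq> m \<Longrightarrow> dist x m < d \<Longrightarrow> u x < T \<and> P x \<le> P m"
    by (auto simp: eventually_at)
  have d': "u x < T" "P x \<le> P m" if "dist x m < d" for x
    using d(2)[of x] that ut by (cases "x = m"; simp)+
  have nrm: "(norm x)\<^sup>2 = (\<Sum>i\<in>UNIV. x$i * x$i)" for x :: "real^3"
    unfolding power2_norm_eq_inner inner_vec_def by simp
  define s where "s = T - u m"
  have s: "s > 0" using ut by (simp add: s_def)
  \<comment> \<open>Minus the Hessian of \<open>P\<close> at \<open>m\<close>, hence positive
    semidefinite.\<close>
  define M where "M i j = 6 / s * h i j m + 6 / s\<^sup>2 * (p i m * p j m) - 1 / f m * theta i j m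
      + 1 / (f m)\<^sup>2 * (tau i m * tau j m) - dl * of_bool (i = j)" for i j
  \<comment> \<open>Both conditions at the maximum are obtained by restricting \<open>P\<close> to
    lines through \<open>m\<close>.\<close>
  have line: "(\<Sum>i\<in>UNIV. (- (6 * p i m / s) + tau i m / f m + dl * m$i) * e$i) = 0 \<and>
     0 \<le> (\<Sum>i\<in>UNIV. \<Sum>j\<in>UNIV. M i j * e$i * e$j)" for e :: "real^3"
  proof -
    define \<gamma> where "\<gamma> \<tau> = m + \<tau> *\<^sub>R e" for \<tau>
    define U1 where "U1 \<tau> = (\<Sum>i\<in>UNIV. p i (\<gamma> \<tau>) * e$i)" for \<tau>
    define U2 where "U2 \<tau> = (\<Sum>i\<in>UNIV. (\<Sum>j\<in>UNIV. h i j (\<gamma> \<tau>) * e$j) * e$i)" for \<tau>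
    define f1 where "f1 \<tau> = (\<Sum>i\<in>UNIV. tau i (\<gamma> \<tau>) * e$i)" for \<tau>
    define f2 where "f2 \<tau> = (\<Sum>i\<in>UNIV. (\<Sum>j\<in>UNIV. theta i j (\<gamma> \<tau>) * e$j) * e$i)" for \<tau>
    define n1 where "n1 \<tau> = (\<Sum>i\<in>UNIV. (\<gamma> \<tau>)$i * e$i)" for \<tau>
    have D: "((\<lambda>\<tau>. u (\<gamma> \<tau>)) has_real_derivative U1 \<tau>) (at \<tau>)"
      "(U1 has_real_derivative U2 \<tau>) (at \<tau>)"
      "((\<lambda>\<tau>. f (\<gamma> \<tau>)) has_real_derivative f1 \<tau>) (at \<tau>)"
      "(f1 has_real_derivative f2 \<tau>) (at \<tau>)" for \<tau>
      unfolding U1_def[abs_def] U2_def f1_def[abs_def] f2_def \<gamma>_def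
      by (intro DERIV_sum DERIV_cmult_right has_partials_line du dp df dtau)+
    have Dc: "((\<lambda>\<tau>. (\<gamma> \<tau>)$i) has_real_derivative e$i) (at \<tau>)" for i \<tau>
      unfolding \<gamma>_def by (auto intro!: derivative_eq_intros)
    have Dn: "((\<lambda>\<tau>. (norm (\<gamma> \<tau>))\<^sup>2 / 2) has_real_derivative n1 \<tau>) (at \<tau>)"
      "(n1 has_real_derivative (\<Sum>i\<in>UNIV. e$i * e$i)) (at \<tau>)" for \<tau>
    proof -
      have "((\<lambda>\<tau>. (\<Sum>i\<in>UNIV. (\<gamma> \<tau>)$i * (\<gamma> \<tau>)$i) / 2) has_real_derivative
        (\<Sum>i\<in>UNIV. e$i * (\<gamma> \<tau>)$i + e$i * (\<gamma> \<tau>)$i) / 2) (at \<tau>)"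
        by (intro DERIV_cdivide DERIV_sum DERIV_mult Dc)
      moreover have "(\<Sum>i\<in>UNIV. e$i * (\<gamma> \<tau>)$i + e$i * (\<gamma> \<tau>)$i) / 2 = n1 \<tau>"
        unfolding n1_def mult_2[symmetric] sum_distrib_left[symmetric] by (simp add: mult.commute)
      ultimately show "((\<lambda>\<tau>. (norm (\<gamma> \<tau>))\<^sup>2 / 2) has_real_derivative n1 \<tau>) (at \<tau>)"
        unfolding nrm by simp
      show "(n1 has_real_derivative (\<Sum>i\<in>UNIV. e$i * e$i)) (at \<tau>)"
        unfolding n1_def[abs_def] by (intro DERIV_sum DERIV_cmult_right Dc)
    qed
    define \<phi>1 where "\<phi>1 \<tau> = - (6 * (U1 \<tau> * inverse (T - u (\<gamma> \<tau>)))) + f1 \<tau> * inverse (f (\<gamma> \<tau>)) + dl * n1 \<tau>" for \<tau>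
    define b where "b = d / (norm e + 1)"
    have b: "b > 0" using d by (simp add: b_def add_nonneg_pos)
    have near: "dist (\<gamma> \<tau>) m < d" if "\<bar>\<tau>\<bar> < b" for \<tau>
    proof -
      have "\<bar>\<tau>\<bar> * norm e \<le> \<bar>\<tau>\<bar> * (norm e + 1)" by (intro mult_left_mono) auto
      also have "\<dots> < d" using that by (simp add: b_def pos_less_divide_eq add_nonneg_pos)
      finally show ?thesis by (simp add: \<gamma>_def dist_norm)
    qed
    have \<phi>: "((\<lambda>\<tau>. P (\<gamma> \<tau>)) has_real_derivative \<phi>1 \<tau>) (at \<tau>)" if "\<bar>\<tau>\<bar> < b" for \<tau>
    proof -
      have "T - u (\<gamma> \<tau>) > 0" using d'(1)[OF near[OF that]] by simp
      then have "((\<lambda>\<tau>. 6 * ln (T - u (\<gamma> \<tau>)) + ln (f (\<gamma> \<tau>)) + dl * ((norm (\<gamma> \<tau>))\<^sup>2 / 2)) has_real_derivative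
        6 * (inverse (T - u (\<gamma> \<tau>)) * (0 - U1 \<tau>)) + inverse (f (\<gamma> \<tau>)) * f1 \<tau> + dl * n1 \<tau>) (at \<tau>)"
        by (intro DERIV_add DERIV_cmult DERIV_chain2[OF DERIV_ln] DERIV_diff DERIV_const D Dn f_pos)
      then show ?thesis by (simp add: P_def \<phi>1_def mult_ac)
    qed
    have g0: "\<gamma> 0 = m" by (simp add: \<gamma>_def)
    have \<phi>1: "(\<phi>1 has_real_derivative
        - (6 * (U2 0 * inverse s + - (inverse s * (0 - U1 0) * inverse s) * U1 0))
        + (f2 0 * inverse (f m) + - (inverse (f m) * f1 0 * inverse (f m)) * f1 0)
        + dl * (\<Sum>i\<in>UNIV. e$i * e$i)) (at 0)"
    proof -
      have ne: "T - u (\<gamma> 0) \<noteq> 0" "f (\<gamma> 0) \<noteq> 0" using ut f_pos[of m] by (auto simp: g0)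
      have "(\<phi>1 has_real_derivative
        - (6 * (U2 0 * inverse (T - u (\<gamma> 0)) + - (inverse (T - u (\<gamma> 0)) * (0 - U1 0) * inverse (T - u (\<gamma> 0))) * U1 0))
        + (f2 0 * inverse (f (\<gamma> 0)) + - (inverse (f (\<gamma> 0)) * f1 0 * inverse (f (\<gamma> 0))) * f1 0)
        + dl * (\<Sum>i\<in>UNIV. e$i * e$i)) (at 0)"
        unfolding \<phi>1_def[abs_def]
        by (intro DERIV_add DERIV_cmult DERIV_minus DERIV_mult DERIV_inverse' DERIV_diff DERIV_const D Dn ne)
      then show ?thesis by (simp add: g0 s_def)
    qed
    have mx: "P (\<gamma> \<tau>) \<le> P (\<gamma> 0)" if "\<bar>\<tau>\<bar> < b" for \<tau>
      using d'(2)[OF near[OF that]] by (simp add: g0)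
    note res = second_derivative_local_max[OF b \<phi> \<phi>1 mx]
    have "\<phi>1 0 = (\<Sum>i\<in>UNIV. (- (6 * p i m / s) + tau i m / f m + dl * m$i) * e$i)"
    proof -
      have "(- (6 * p i m / s) + tau i m / f m + dl * m$i) * e$i
        = - (6 * ((p i m * e$i) * inverse s)) + (tau i m * e$i) * inverse (f m) + dl * (m$i * e$i)" for i
        by (simp add: divide_inverse algebra_simps)
      then show ?thesis
        by (simp only: sum.distrib sum_negf sum_distrib_left[symmetric] sum_distrib_right[symmetric]
            \<phi>1_def U1_def f1_def n1_def g0 s_def[symmetric])
    qed
    moreover have "(\<Sum>i\<in>UNIV. \<Sum>j\<in>UNIV. M i j * e$i * e$j)
      = 6 / s * U2 0 + 6 / s\<^sup>2 * (U1 0 * U1 0) - 1 / f m * f2 0 + 1 / (f m)\<^sup>2 * (f1 0 * f1 0)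
        - dl * (\<Sum>i\<in>UNIV. e$i * e$i)"
    proof -
      have "(\<Sum>j\<in>UNIV. M i j * e$i * e$j) = 6 / s * (\<Sum>j\<in>UNIV. h i j m * e$j * e$i)
        + 6 / s\<^sup>2 * (\<Sum>j\<in>UNIV. (p i m * e$i) * (p j m * e$j)) - 1 / f m * (\<Sum>j\<in>UNIV. theta i j m * e$j * e$i)
        + 1 / (f m)\<^sup>2 * (\<Sum>j\<in>UNIV. (tau i m * e$i) * (tau j m * e$j)) - dl * (e$i * e$i)" for i
      proof -
        have "M i j * e$i * e$j = 6 / s * (h i j m * e$j * e$i)
          + 6 / s\<^sup>2 * ((p i m * e$i) * (p j m * e$j)) - 1 / f m * (theta i j m * e$j * e$i)
          + 1 / (f m)\<^sup>2 * ((tau i m * e$i) * (tau j m * e$j)) - of_bool (i = j) * (dl * (e$i * e$j))" for j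
          by (simp add: M_def algebra_simps)
        then show ?thesis
          by (simp only: sum.distrib sum_subtractf sum_distrib_left[symmetric] sum_pick)
      qed
      then show ?thesis
        by (simp only: sum.distrib sum_subtractf sum_distrib_left[symmetric] sum_distrib_right[symmetric]
            U1_def U2_def f1_def f2_def g0)
    qed
    ultimately show ?thesis using res s f_pos[of m]
      by (simp add: divide_inverse power2_eq_square mult_ac)
  qed
  have grad: "6 / s * p i m = tau i m / f m + dl * m$i" for i
    using line[of "axis i 1"]
    by (simp add: axis_def if_distrib cong: if_cong)
  have psd: "0 \<le> (\<Sum>i\<in>UNIV. \<Sum>j\<in>UNIV. M i j * v i * v j)" for v
    using line[of "\<chi> i. v i"] by simp
  have Msym: "M i j = M j i" for i j
    by (simp add: M_def h_sym[of i j] theta_sym[of i j] mult.commute eq_commute)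
  have "(\<Sum>i\<in>UNIV. \<Sum>j\<in>UNIV. h i j m * M i j) \<le> f m * (\<Sum>i\<in>UNIV. M i i)"
    by (rule psd_pairing_nonneg[OF psd Msym]) (use f_pos[of m] in \<open>auto simp: h_norm\<close>)
  then have "0 \<le> L (\<lambda>i j x. M i j) m" by (simp add: L_eq)
  also have "L (\<lambda>i j x. M i j) m = 6 / s * L h m + 6 / s\<^sup>2 * Fq m (\<lambda>i. p i m) - 1 / f m * L theta m
      + 1 / (f m)\<^sup>2 * Fq m (\<lambda>i. tau i m) - dl * (2 * f m)"
  proof -
    have "F i j m * M i j = 6 / s * (F i j m * h i j m) + 6 / s\<^sup>2 * (F i j m * (p i m * p j m))
      - 1 / f m * (F i j m * theta i j m) + 1 / (f m)\<^sup>2 * (F i j m * (tau i m * tau j m))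
      - dl * (of_bool (i = j) * F i j m)" for i j
      by (simp add: M_def algebra_simps)
    then have "L (\<lambda>i j x. M i j) m = 6 / s * L h m + 6 / s\<^sup>2 * Fq m (\<lambda>i. p i m) - 1 / f m * L theta m
      + 1 / (f m)\<^sup>2 * Fq m (\<lambda>i. tau i m) - dl * (\<Sum>i\<in>UNIV. F i i m)"
      by (simp only: L_def Fq_eq sum.distrib sum_subtractf sum_distrib_left[symmetric] sum_pick)
    moreover have "(\<Sum>i\<in>UNIV. F i i m) = 2 * f m"
      by (simp add: F_def sum_subtractf f_def[symmetric])
    ultimately show ?thesis by simp
  qed
  finally have 1: "0 \<le> 12 / s + 6 / s\<^sup>2 * Fq m (\<lambda>i. p i m) - 1 / f m * L theta m
      + 1 / (f m)\<^sup>2 * Fq m (\<lambda>i. tau i m) - dl * (2 * f m)"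
    by (simp add: L_h_eq_2)
  have 2: "4 / 3 * (1 / (f m)\<^sup>2 * Fq m (\<lambda>i. tau i m)) \<le> 1 / f m * L theta m"
    using mult_left_mono[OF jacobi[of m], of "1 / (f m)\<^sup>2"] f_pos[of m] by (simp add: power2_eq_square)
  have 3: "6 / s\<^sup>2 * Fq m (\<lambda>i. p i m) \<le> 1 / 3 * (1 / (f m)\<^sup>2 * Fq m (\<lambda>i. tau i m)) + dl * f m"
  proof -
    have "6 / s\<^sup>2 * Fq m (\<lambda>i. p i m) = 1 / 6 * Fq m (\<lambda>i. 6 / s * p i m)"
      unfolding Fq_scale by (simp add: power2_eq_square)
    also have "\<dots> = 1 / 6 * Fq m (\<lambda>i. 1 / f m * tau i m + dl * m$i)" unfolding grad by simp
    also have "\<dots> \<le> 1 / 6 * (2 * Fq m (\<lambda>i. 1 / f m * tau i m) + 2 * Fq m (\<lambda>i. dl * m$i))"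
      by (intro mult_left_mono Fq_add_le) simp
    also have "\<dots> = 1 / 3 * (1 / (f m)\<^sup>2 * Fq m (\<lambda>i. tau i m)) + 1 / 3 * (dl\<^sup>2 * Fq m (\<lambda>i. m$i))"
      unfolding Fq_scale by (simp add: power_one_over)
    also have "1 / 3 * (dl\<^sup>2 * Fq m (\<lambda>i. m$i)) \<le> dl * f m"
    proof -
      have "Fq m (\<lambda>i. m$i) \<le> 2 * f m * (norm m)\<^sup>2"
        unfolding nrm using Fq_le[of m "\<lambda>i. m$i"] by (simp add: power2_eq_square)
      then have "1 / 3 * (dl\<^sup>2 * Fq m (\<lambda>i. m$i)) \<le> 1 / 3 * (dl\<^sup>2 * (2 * f m * (norm m)\<^sup>2))"
        by (intro mult_left_mono) auto
      also have "\<dots> = (dl * f m) / 6 * (4 * dl * (norm m)\<^sup>2)" by (simp add: power2_eq_square)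
      also have "\<dots> \<le> (dl * f m) / 6 * 6" using dl f_pos[of m] by (intro mult_left_mono m) simp
      finally show ?thesis by simp
    qed
    finally show ?thesis by simp
  qed
  \<comment> \<open>All gradient terms cancel: 1/3 - 4/3 + 1 = 0. The 12 is 6 times L u = 2 sigma_2
    = 2.\<close>
  have "dl * f m \<le> 12 / s" using 1 2 3 by (simp add: algebra_simps)
  then have "dl * (f m * s) \<le> 12" using s by (simp add: pos_le_divide_eq mult_ac)
  then show ?thesis using dl by (simp add: s_def pos_le_divide_eq mult.commute)
qed

text \<open>Both \<open>T + c\<close> and the radius scale are compared with \<open>T - u x\<close>,
  so they drop out and the bound depends on \<open>b\<close> alone; 512 is 8 times 2^6.\<close>

lemma hessian_bound:
  assumes b: "b > 0" and c: "c > 0" and growth: "\<And>x. b * (norm x)\<^sup>2 - c \<le> u x"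
  shows "f x \<le> 512 / b * exp (3 / 4)"
proof -
  \<comment> \<open>Large enough, for the given point \<open>x\<close>, that \<open>T + c\<close> is
    at most twice \<open>T - u x\<close>; the ratio 2 enters to the power 6.\<close>
  define T where "T = \<bar>2 * u x\<bar> + c + 1"
  have T: "T > 0" "u x < T" "T + c \<le> 2 * (T - u x)" using c by (auto simp: T_def)
  define D where "D = (T + c) / b"
  have D: "D > 0" using T c b by (simp add: D_def)
  \<comment> \<open>\<open>D\<close> bounds |y|^2 on the sublevel set, so this is the largest value
    for which 4 dl |m|^2 <= 6 is guaranteed there.\<close>
  define dl where "dl = 3 / (2 * D)"
  have dl: "dl > 0" using D by (simp add: dl_def)
  define \<Phi> where "\<Phi> y = (T - u y)^6 * f y * exp (dl * (norm y)\<^sup>2 / 2)" for y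
  have nD: "(norm y)\<^sup>2 \<le> D" if "u y \<le> T" for y
    using growth[of y] that b by (simp add: D_def pos_le_divide_eq mult.commute)
  define A where "A = {y. u y \<le> T}"
  have "compact A"
  proof -
    have "closed A"
      unfolding A_def by (intro closed_Collect_le u_continuous continuous_intros)
    moreover have "bounded A"
      unfolding bounded_iff A_def
    proof (intro exI[of _ "sqrt D"] ballI)
      fix y assume "y \<in> {y. u y \<le> T}"
      then have "(norm y)\<^sup>2 \<le> D" using nD by simp
      then show "norm y \<le> sqrt D" by (simp add: real_le_rsqrt)
    qed
    ultimately show ?thesis by (simp add: compact_eq_bounded_closed)
  qed
  moreover have xA: "x \<in> A" using T by (simp add: A_def)
  moreover have "continuous_on A \<Phi>"
    unfolding \<Phi>_def[abs_def] by (intro continuous_intros u_continuous f_continuous) auto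
  ultimately obtain m where m: "m \<in> A" "\<And>y. y \<in> A \<Longrightarrow> \<Phi> y \<le> \<Phi> m"
    using continuous_attains_sup[of A \<Phi>] by auto
  \<comment> \<open>\<open>\<Phi>\<close> vanishes where u = \<open>T\<close>, so a positive maximum
    is attained in the open sublevel set and is a local maximum in space.\<close>
  have "0 < \<Phi> x" unfolding \<Phi>_def using T f_pos[of x] by simp
  then have "0 < \<Phi> m" using m(2)[OF xA] by simp
  then have "u m \<noteq> T" by (auto simp: \<Phi>_def)
  then have um: "u m < T" using m(1) by (simp add: A_def)
  have "\<forall>\<^sub>F y in at m. u y < T"
    by (rule order_tendstoD[OF _ um]) (use u_continuous[of UNIV] in \<open>simp add: continuous_on_def\<close>)
  then have ev: "\<forall>\<^sub>F y in at m. \<Phi> y \<le> \<Phi> m"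
    by eventually_elim (auto intro!: m(2) simp: A_def)
  have nm: "(norm m)\<^sup>2 \<le> D" using nD um by simp
  have "4 * dl * (norm m)\<^sup>2 \<le> 4 * dl * D" using nm dl by (intro mult_left_mono) auto
  then have "4 * dl * (norm m)\<^sup>2 \<le> 6" using D by (simp add: dl_def)
  from pogorelov_critical_point[OF um dl ev[unfolded \<Phi>_def] this]
  have fm: "f m * (T - u m) \<le> 8 * D" using D by (simp add: dl_def)
  have uc: "T - u m \<le> T + c" using growth[of m] b zero_le_power2[of "norm m"]
    by (smt (verit) mult_nonneg_nonneg)
  have em: "exp (dl * (norm m)\<^sup>2 / 2) \<le> exp (3 / 4)"
  proof -
    have "dl * (norm m)\<^sup>2 / 2 \<le> dl * D / 2" using nm dl by simp
    also have "\<dots> = 3 / 4" using D by (simp add: dl_def)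
    finally show ?thesis by simp
  qed
  have "(T - u x)^6 * f x * 1 \<le> \<Phi> x"
    unfolding \<Phi>_def using T f_pos[of x] dl by (intro mult_left_mono) auto
  also have "\<dots> \<le> \<Phi> m" by (rule m(2)[OF xA])
  also have "\<dots> = (T - u m)^5 * (f m * (T - u m)) * exp (dl * (norm m)\<^sup>2 / 2)"
    by (simp add: \<Phi>_def eval_nat_numeral)
  also have "\<dots> \<le> (T + c)^5 * (8 * D) * exp (3 / 4)"
  proof -
    have "(T - u m)^5 \<le> (T + c)^5" using um uc by (intro power_mono) auto
    then have "(T - u m)^5 * (f m * (T - u m)) \<le> (T + c)^5 * (8 * D)"
      by (rule mult_mono[OF _ fm]) (use um f_pos[of m] T c in auto)
    then show ?thesis by (rule mult_mono[OF _ em]) (use T c D in auto)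
  qed
  also have "\<dots> = (T + c)^6 * (8 / b * exp (3 / 4))"
    by (simp add: D_def eval_nat_numeral)
  also have "\<dots> \<le> (2 * (T - u x))^6 * (8 / b * exp (3 / 4))"
    using T c b by (intro mult_right_mono power_mono) auto
  also have "\<dots> = (T - u x)^6 * (512 / b * exp (3 / 4))"
    unfolding power_mult_distrib by simp
  finally have "(T - u x)^6 * f x \<le> (T - u x)^6 * (512 / b * exp (3 / 4))" by (simp only: mult_1_right)
  then show ?thesis by (rule mult_left_le_imp_le) (use T in simp)
qed

section \<open>From a constant Hessian to a quadratic polynomial\<close>

lemma entire_solution_quadratic:
  assumes b: "b > 0" and c: "c > 0" and growth: "\<And>x. b * (norm x)\<^sup>2 - c \<le> u x"
  shows "\<exists>(A::real^3^3) (v::real^3) d. \<forall>x. u x = x \<bullet> (A *v x) + v \<bullet> x + d"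
proof -
  define H where "H i j = h i j 0" for i j
  have H: "h i j x = H i j" for i j x
    unfolding H_def by (rule bounded_hessian_constant[OF hessian_bound[OF assms]])
  have Hsym: "H i j = H j i" for i j unfolding H_def by (rule h_sym)
  have const: "g x = g 0" if "has_partials g (\<lambda>i x. 0)" for g :: "real^3 \<Rightarrow> real" and x
    using has_partials_lipschitz[OF that, of 0 x 0] by simp
  have lin: "has_partials (\<lambda>x. \<Sum>j\<in>UNIV. w j * x$j) (\<lambda>k x. w k)" for w :: "3 \<Rightarrow> real"
  proof -
    have "has_partials (\<lambda>x. \<Sum>j\<in>UNIV. w j * x$j) (\<lambda>k x. \<Sum>j\<in>UNIV. w j * of_bool (k = j))"
      by (intro has_partials_sum has_partials_cmult has_partials_coord)
    then show ?thesis
      using sum_pick(3)[of _ w] by (simp add: mult.commute)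
  qed
  have p: "p i x = p i 0 + (\<Sum>j\<in>UNIV. H i j * x$j)" for i x
  proof -
    have "has_partials (\<lambda>x. p i x - (\<Sum>j\<in>UNIV. H i j * x$j)) (\<lambda>k x. h i k x - H i k)"
      by (intro has_partials_diff dp lin)
    then have "has_partials (\<lambda>x. p i x - (\<Sum>j\<in>UNIV. H i j * x$j)) (\<lambda>k x. 0)" by (simp add: H)
    from const[OF this, of x] show ?thesis by simp
  qed
  define Q where "Q x = (\<Sum>i\<in>UNIV. x$i * (\<Sum>j\<in>UNIV. (H i j / 2) * x$j))" for x :: "real^3"
  have Q: "has_partials Q (\<lambda>k x. \<Sum>j\<in>UNIV. H k j * x$j)"
  proof -
    have "has_partials Q (\<lambda>k x. \<Sum>i\<in>UNIV. of_bool (k = i) * (\<Sum>j\<in>UNIV. (H i j / 2) * x$j) + x$i * (H i k / 2))"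
      unfolding Q_def[abs_def] by (intro has_partials_sum has_partials_mult has_partials_coord lin)
    moreover have "(\<Sum>i\<in>UNIV. of_bool (k = i) * (\<Sum>j\<in>UNIV. (H i j / 2) * x$j) + x$i * (H i k / 2))
      = (\<Sum>j\<in>UNIV. H k j * x$j)" for k x
      unfolding sum.distrib sum_pick(3) unfolding sum.distrib[symmetric]
      by (intro sum.cong refl) (simp add: Hsym[of _ k])
    ultimately show ?thesis by simp
  qed
  have "has_partials (\<lambda>x. u x - (Q x + (\<Sum>j\<in>UNIV. p j 0 * x$j)))
    (\<lambda>k x. p k x - ((\<Sum>j\<in>UNIV. H k j * x$j) + p k 0))"
    by (intro has_partials_diff has_partials_add du Q lin)
  then have "has_partials (\<lambda>x. u x - (Q x + (\<Sum>j\<in>UNIV. p j 0 * x$j))) (\<lambda>k x. 0)"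
    by (rule has_partials_eqI) (use p in \<open>metis add.commute diff_self\<close>)
  from const[OF this] have ux: "u x = Q x + (\<Sum>j\<in>UNIV. p j 0 * x$j) + (u 0 - Q 0)" for x
    by (simp add: algebra_simps)
  show ?thesis
  proof (intro exI allI)
    fix x
    show "u x = x \<bullet> ((\<chi> i j. H i j / 2) *v x) + (\<chi> j. p j 0) \<bullet> x + (u 0 - Q 0)"
      unfolding ux[of x] by (simp add: Q_def inner_vec_def matrix_vector_mult_def)
  qed
qed

end

section \<open>From elementary symmetric functions of eigenvalues to traces and norms\<close>

lemma sigma_1:
  fixes lam :: "real^'n"
  shows "sigma 1 lam = (\<Sum>i\<in>UNIV. lam$i)"
proof -
  have "{S::'n set. card S = 1} = (\<lambda>i. {i}) ` UNIV" by (auto simp: card_1_singleton_iff)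
  then show ?thesis unfolding sigma_def by (simp only:) (simp add: sum.reindex)
qed

lemma sigma_2_dim3:
  fixes lam :: "real^3"
  shows "2 * sigma 2 lam = (\<Sum>i\<in>UNIV. lam$i)\<^sup>2 - (\<Sum>i\<in>UNIV. (lam$i)\<^sup>2)"
proof -
  have "{S::3 set. card S = 2} = {{1,2},{1,3},{2,3}}"
  proof (intro equalityI subsetI)
    fix S :: "3 set" assume "S \<in> {S. card S = 2}"
    then obtain x y where "S = {x, y}" "x \<noteq> y" by (auto simp: card_2_iff)
    then show "S \<in> {{1,2},{1,3},{2,3}}" using exhaust_3[of x] exhaust_3[of y] by auto
  qed auto
  moreover have "{1::3,2} \<noteq> {1,3}" "{1::3,2} \<noteq> {2,3}" "{1::3,3} \<noteq> {2,3}"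
    by (auto simp: doubleton_eq_iff)
  ultimately have "sigma 2 lam = lam$1 * lam$2 + lam$1 * lam$3 + lam$2 * lam$3"
    by (simp add: sigma_def)
  then show ?thesis by (simp add: sum_3 power2_eq_square algebra_simps)
qed

lemma is_eigenvalues_entries:
  assumes "is_eigenvalues W lam"
  obtains P where "orthogonal_matrix P" "\<And>i j. W$i$j = (\<Sum>a\<in>UNIV. P$i$a * lam$a * P$j$a)"
proof -
  obtain P where P: "orthogonal_matrix P" "W = P ** diag_mat lam ** transpose P"
    using assms by (auto simp: is_eigenvalues_def)
  have "W$i$j = (\<Sum>a\<in>UNIV. P$i$a * lam$a * P$j$a)" for i j
    unfolding P(2) by (simp add: matrix_matrix_mult_def diag_mat_def transpose_def if_distrib cong: if_cong)
  then show thesis using P(1) that by blast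
qed

text \<open>Trace and Frobenius norm do not depend on the diagonalisation. Hence the sign of the
  trace may come from the eigenvalues given by 2-convexity and the equation from those selected in
  \<open>sigma_mat\<close>, with no comparison of the two.\<close>

lemma sigma2_solution_of_C4:
  fixes u :: "real^3 \<Rightarrow> real"
  assumes C4: "C_k 4 u" and conv: "k_convex 2 u" and eq: "\<forall>x. sigma_mat 2 (hessian u x) = 1"
  shows "sigma2_solution u (\<lambda>i. partial_deriv i u) (\<lambda>i j. partial_deriv j (partial_deriv i u))
    (\<lambda>i j k. partial_deriv k (partial_deriv j (partial_deriv i u)))
    (\<lambda>i j k l. partial_deriv l (partial_deriv k (partial_deriv j (partial_deriv i u))))"
proof -
  have hess: "partial_deriv j (partial_deriv i u) x = hessian u x $ i $ j" for i j x
    by (simp add: hessian_def)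
  have ex: "\<exists>P lam. orthogonal_matrix P \<and>
      (\<forall>i j. partial_deriv j (partial_deriv i u) x = (\<Sum>a\<in>UNIV. P$i$a * lam$a * P$j$a))
      \<and> sigma 1 lam > 0" for x
  proof -
    obtain lam where lam: "is_eigenvalues (hessian u x) lam" "lam \<in> garding_cone 2"
      using conv by (auto simp: k_convex_def)
    have "sigma 1 lam > 0" using lam(2) unfolding garding_cone_def by fastforce
    moreover obtain P where "orthogonal_matrix P" "\<And>i j. hessian u x $ i $ j = (\<Sum>a\<in>UNIV. P$i$a * lam$a * P$j$a)"
      by (rule is_eigenvalues_entries[OF lam(1)], rule that)
    ultimately show ?thesis unfolding hess by (intro exI[of _ P] exI[of _ lam]) simp
  qed
  have C: "C_k (Suc (Suc (Suc (Suc 0)))) u" using C4 by (simp add: eval_nat_numeral)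
  show ?thesis
  proof
    show "partial_deriv j (partial_deriv i u) x = partial_deriv i (partial_deriv j u) x" for i j x
      using ex[of x] by (auto simp: mult_ac)
    show "\<exists>P lam. orthogonal_matrix P \<and>
      (\<forall>i j. partial_deriv j (partial_deriv i u) x = (\<Sum>a\<in>UNIV. P$i$a * lam$a * P$j$a))" for x
      using ex[of x] by blast
    show "0 < (\<Sum>i\<in>UNIV. partial_deriv i (partial_deriv i u) x)" for x
    proof -
      obtain P lam where P: "orthogonal_matrix P"
        "\<And>i j. partial_deriv j (partial_deriv i u) x = (\<Sum>a\<in>UNIV. P$i$a * lam$a * P$j$a)" "sigma 1 lam > 0"
        using ex[of x] by blast
      show ?thesis
        using orthogonal_diagonal_trace[OF P(1,2)] P(3) unfolding sigma_1 by simp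
    qed
    show "(\<Sum>i\<in>UNIV. partial_deriv i (partial_deriv i u) x)\<^sup>2
      - (\<Sum>i\<in>UNIV. \<Sum>j\<in>UNIV. (partial_deriv j (partial_deriv i u) x)\<^sup>2) = 2" for x
    proof -
      \<comment> \<open>The vector chosen by \<open>sigma_mat\<close>; it consists of eigenvalues
        because 2-convexity shows that some exist.\<close>
      define mu where "mu = (SOME lam. is_eigenvalues (hessian u x) lam)"
      have "\<exists>lam. is_eigenvalues (hessian u x) lam"
        using conv by (auto simp: k_convex_def)
      then have ev: "is_eigenvalues (hessian u x) mu" unfolding mu_def by (rule someI_ex)
      obtain P where P: "orthogonal_matrix P"
        "\<And>i j. partial_deriv j (partial_deriv i u) x = (\<Sum>a\<in>UNIV. P$i$a * mu$a * P$j$a)"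
        by (rule is_eigenvalues_entries[OF ev], rule that) (simp_all add: hess)
      have "sigma 2 mu = 1" using eq by (simp add: sigma_mat_def mu_def)
      then show ?thesis
        using orthogonal_diagonal_trace[OF P] orthogonal_diagonal_norm[OF P] sigma_2_dim3[of mu] by simp
    qed
  qed (use C in \<open>auto intro!: has_partials_partial_deriv\<close>)
qed

theorem theorem1p2:
  fixes u :: "real^3 \<Rightarrow> real"
  assumes "C_k 4 u"
    and "k_convex 2 u"
    and "\<forall>x. sigma_mat 2 (hessian u x) = 1"
    and "\<exists>b c R. b > 0 \<and> c > 0 \<and> R > 0 \<and> (\<forall>x. norm x \<ge> R \<longrightarrow> u x \<ge> b * (norm x)^2 - c)"
  shows "\<exists>(A::real^3^3) (q::real^3) (d::real). \<forall>x. u x = x \<bullet> (A *v x) + q \<bullet> x + d"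
proof -
  interpret sigma2_solution u "\<lambda>i. partial_deriv i u" "\<lambda>i j. partial_deriv j (partial_deriv i u)"
    "\<lambda>i j k. partial_deriv k (partial_deriv j (partial_deriv i u))"
    "\<lambda>i j k l. partial_deriv l (partial_deriv k (partial_deriv j (partial_deriv i u)))"
    by (rule sigma2_solution_of_C4[OF assms(1-3)])
  obtain b c R where b: "b > 0" and c: "c > 0" and R: "R > 0"
    and growth: "\<And>x. norm x \<ge> R \<Longrightarrow> u x \<ge> b * (norm x)^2 - c"
    using assms(4) by blast
  have "cball 0 R \<noteq> ({} :: (real^3) set)" using R by simp
  from continuous_attains_inf[OF compact_cball this u_continuous]
  obtain y where y: "\<And>x. x \<in> cball 0 R \<Longrightarrow> u y \<le> u x" by blast
  \<comment> \<open>The growth bound is made global by enlarging the constant: inside the ball of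
    radius \<open>R\<close>, \<open>u\<close> is at least its minimum \<open>u y\<close> and b |x|^2
    is at most b R^2.\<close>
  have "b * (norm x)\<^sup>2 - (c + \<bar>u y\<bar> + b * R\<^sup>2) \<le> u x" for x
  proof (cases "norm x \<ge> R")
    case True
    then show ?thesis using growth[of x] b zero_le_power2[of R] by (smt (verit) mult_nonneg_nonneg)
  next
    case False
    then have "b * (norm x)\<^sup>2 \<le> b * R\<^sup>2" using b by (intro mult_left_mono power_mono) auto
    then show ?thesis using y[of x] False c by simp
  qed
  moreover have "c + \<bar>u y\<bar> + b * R\<^sup>2 > 0" using b c by (simp add: add_pos_nonneg)
  ultimately show ?thesis using entire_solution_quadratic[OF b] by blast
qed

end
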